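(* Let $a_2,c_2$ be deformation parameters. There is a two-parameter Hopf algebra $U_{a_2,c_2}(\mathcal S)$, a quantum deformation of the extended Schrödinger Lie bialgebra with $r=a_2D\wedge H+c_2P\wedge K$, generated by $D,H,P,K,C,M$ with coproduct $\Delta(H)=1\otimes H+H\otimes1$, $\Delta(M)=1\otimes M+M\otimes1$, $\Delta(D)=1\otimes D+D\otimes e^{-2a_2H}$, $\Delta(C)=1\otimes C+C\otimes e^{-2a_2H}$, $\Delta(P)=1\otimes P+P\otimes e^{a_2H}e^{-c_2M}$, $\Delta(K)=1\otimes K+K\otimes e^{-a_2H}e^{-c_2M}+a_2D\otimes e^{-2a_2H}P$, and commutation rules $[D,P]=-P$, $[D,K]=K$, $[K,P]=\dfrac{1-e^{-2c_2M}}{2c_2}$, $[D,H]=\dfrac{e^{-2a_2H}-1}{a_2}$, $[D,C]=2C-a_2D^2$, $[H,C]=D$, $[K,H]=e^{-2a_2H}P$, $[K,C]=-\tfrac12a_2(KD+DK)$, $[M,\cdot]=0$, $[P,C]=-K+\tfrac12a_2(DP+PD)$, $[P,H]=0$.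
   Context: $\mathcal S$ is the real Lie algebra with basis $\{D,H,P,K,C,M\}$ and brackets $[D,P]=-P$, $[D,K]=K$, $[K,P]=M$, $[D,H]=-2H$, $[D,C]=2C$, $[H,C]=D$, $[K,H]=P$, $[K,C]=0$, $[P,C]=-K$, $[P,H]=0$, $[M,\cdot]=0$. $X\wedge Y=X\otimes Y-Y\otimes X$; the Lie bialgebra defined by $r$ has cocommutator $\delta(X)=[1\otimes X+X\otimes1,r]$. Exponentials and quotients such as $\frac{e^{-2a_2H}-1}{a_2}$ are understood as formal power series in the deformation parameters, so the Hopf algebra is a topological one over $\mathbb R[[a_2,c_2]]$ (with completed tensor products). It is a quantum deformation of $(\mathcal S,\delta)$ in the sense that it reduces to $U(\mathcal S)$ with primitive generators when the parameters vanish, and that $\Delta(X)-\sigma\circ\Delta(X)=\delta(X)$ up to terms of order two in the parameters for each generator $X$, where $\sigma(X\otimes Y)=Y\otimes X$. *)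

theory Defs
  imports "HOL-Library.Poly_Mapping" "HOL-Library.Product_Plus"
    "HOL-Computational_Algebra.Formal_Power_Series"
begin

unbundle fps_syntax

section \<open>Complete monoid algebras over a power series ring in two variables\<close>

text \<open>Words under concatenation: the free monoid. With it \<open>'g list \<Rightarrow>\<^sub>0 real\<close>, with the
  convolution product of the library, is the free unital associative real algebra on \<open>'g\<close>, and
  \<open>('g list \<times> 'g list) \<Rightarrow>\<^sub>0 real\<close> is its tensor square.\<close>

instantiation list :: (type) monoid_add
begin
definition zero_list_def: "0 = []"
definition plus_list_def: "xs + ys = xs @ ys"
instance by standard (simp_all add: zero_list_def plus_list_def)
end

text \<open>The scalars are the power series in the two deformation parameters \<open>a\<close> (the outer variable)
  and \<open>c\<close> (the inner variable). For a monoid \<open>'m\<close> the type \<open>'m ser\<close> is the power series ring in the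
  same central variables over the real monoid algebra of \<open>'m\<close>; this is the completion of the
  monoid algebra over the scalars, and \<open>('m \<times> 'n) ser\<close> is the completed tensor product
  of \<open>'m ser\<close> and \<open>'n ser\<close>. The coefficient of \<open>a^i c^j\<close> in \<open>x\<close> is \<open>x $ i $ j\<close>.\<close>

type_synonym scalar = "real fps fps"
type_synonym 'm ser = "('m \<Rightarrow>\<^sub>0 real) fps fps"

abbreviation par_a :: "'r::{zero,one} fps fps" where "par_a \<equiv> fps_X"
abbreviation par_c :: "'r::{zero,one} fps fps" where "par_c \<equiv> fps_const fps_X"

abbreviation const2 :: "'r::zero \<Rightarrow> 'r fps fps" where "const2 t \<equiv> fps_const (fps_const t)"

definition scal :: "scalar \<Rightarrow> ('m::zero) ser"
  where "scal s = Abs_fps (\<lambda>i. Abs_fps (\<lambda>j. Poly_Mapping.single 0 (s $ i $ j)))"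

definition smult :: "scalar \<Rightarrow> ('m::monoid_add) ser \<Rightarrow> 'm ser"  (infixr "\<odot>" 75)
  where "s \<odot> x = scal s * x"

definition basis :: "'m \<Rightarrow> 'm ser"
  where "basis m = const2 (Poly_Mapping.single m 1)"

text \<open>The \<open>k\<close>-th power of the ideal generated by \<open>a\<close> and \<open>c\<close>; these define the topology.\<close>

definition adic :: "nat \<Rightarrow> ('r::zero) fps fps set"
  where "adic k = {x. \<forall>i j. i + j < k \<longrightarrow> x $ i $ j = 0}"

text \<open>The unique scalar-linear (hence continuous) map with prescribed values on the basis.\<close>

definition lin_ext :: "('m \<Rightarrow> 'n ser) \<Rightarrow> 'm ser \<Rightarrow> ('n::monoid_add) ser"
  where "lin_ext f x = Abs_fps (\<lambda>k. Abs_fps (\<lambda>l. \<Sum>i\<le>k. \<Sum>j\<le>l. \<Sum>m\<in>Poly_Mapping.keys (x $ i $ j).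
      Poly_Mapping.single 0 (Poly_Mapping.lookup (x $ i $ j) m) * (f m $ (k - i) $ (l - j))))"

definition tens :: "('m::monoid_add) ser \<Rightarrow> ('n::monoid_add) ser \<Rightarrow> ('m \<times> 'n) ser"  (infixr "\<otimes>" 75)
  where "x \<otimes> y = lin_ext (\<lambda>m. basis (m, 0)) x * lin_ext (\<lambda>n. basis (0, n)) y"

text \<open>Completed tensor product of scalar-linear maps, flip, associator and multiplication map.\<close>

definition tens_map :: "('m ser \<Rightarrow> 'p ser) \<Rightarrow> ('n ser \<Rightarrow> 'q ser) \<Rightarrow> ('m \<times> 'n) ser
    \<Rightarrow> ('p::monoid_add \<times> 'q::monoid_add) ser"
  where "tens_map F G = lin_ext (\<lambda>(m, n). F (basis m) \<otimes> G (basis n))"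

definition flip :: "('m \<times> 'n) ser \<Rightarrow> ('n::monoid_add \<times> 'm::monoid_add) ser"
  where "flip = lin_ext (\<lambda>(m, n). basis (n, m))"

definition assoc :: "(('m \<times> 'n) \<times> 'p) ser
    \<Rightarrow> ('m::monoid_add \<times> ('n::monoid_add \<times> 'p::monoid_add)) ser"
  where "assoc = lin_ext (\<lambda>((m, n), p). basis (m, (n, p)))"

definition mult_map :: "('m \<times> 'm) ser \<Rightarrow> ('m::monoid_add) ser"
  where "mult_map = lin_ext (\<lambda>(m, n). basis (m + n))"

text \<open>The exponential, for series without constant term: then the \<open>n\<close>-th power lies in \<open>adic n\<close>, so
  only the powers with \<open>n \<le> i + j\<close> contribute to the coefficient of \<open>a^i c^j\<close>.\<close>

definition sexp :: "('m::monoid_add) ser \<Rightarrow> 'm ser"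
  where "sexp x = Abs_fps (\<lambda>i. Abs_fps (\<lambda>j.
      \<Sum>n\<le>i + j. Poly_Mapping.single 0 (1 / fact n) * ((x ^ n) $ i $ j)))"

text \<open>The quotient by a central non-zero-divisor \<open>p\<close> (used for \<open>p = a\<close> and \<open>p = 2c\<close> only).\<close>

definition quot :: "('m::monoid_add) ser \<Rightarrow> 'm ser \<Rightarrow> 'm ser"
  where "quot x p = (THE y. p * y = x)"

definition comm :: "'r::ring \<Rightarrow> 'r \<Rightarrow> 'r"
  where "comm x y = x * y - y * x"


section \<open>Presented algebras and topological Hopf algebras\<close>

definition two_sided_ideal :: "('r::ring_1) set \<Rightarrow> bool"
  where "two_sided_ideal J \<longleftrightarrow> 0 \<in> J \<and> (\<forall>x\<in>J. \<forall>y\<in>J. x + y \<in> J)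
    \<and> (\<forall>x\<in>J. \<forall>y. y * x \<in> J \<and> x * y \<in> J)"

definition closed_ideal :: "('m::monoid_add) ser set \<Rightarrow> bool"
  where "closed_ideal J \<longleftrightarrow> two_sided_ideal J
    \<and> (\<forall>x. (\<forall>k. \<exists>y\<in>J. x - y \<in> adic k) \<longrightarrow> x \<in> J)"

text \<open>A complete algebra topologically generated by \<open>'g\<close> is a quotient of \<open>'g list ser\<close> by a closed
  ideal \<open>I\<close>. Its elements are represented by elements of \<open>'g list ser\<close>, and maps between such
  quotients by maps of representatives which respect the ideals. The completed tensor product of
  the quotients by \<open>I\<close> and \<open>J\<close> is the quotient of \<open>('m \<times> 'n) ser\<close> by the following closed ideal.\<close>

definition tens_ideal :: "('m::monoid_add) ser set \<Rightarrow> ('n::monoid_add) ser set \<Rightarrow> ('m \<times> 'n) ser set"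
  where "tens_ideal I J = closed_ideal hull ({x \<otimes> 1 | x. x \<in> I} \<union> {1 \<otimes> y | y. y \<in> J})"

definition gen :: "'g \<Rightarrow> 'g list ser"
  where "gen g = basis [g]"

definition presented_ideal :: "('g list ser \<times> 'g list ser) set \<Rightarrow> 'g list ser set"
  where "presented_ideal R = closed_ideal hull {x - y | x y. (x, y) \<in> R}"

definition ser_linear :: "(('m::monoid_add) ser \<Rightarrow> ('n::monoid_add) ser) \<Rightarrow> bool"
  where "ser_linear F \<longleftrightarrow> (\<forall>x y. F (x + y) = F x + F y) \<and> (\<forall>s x. F (s \<odot> x) = s \<odot> F x)"

definition ser_hom :: "(('m::monoid_add) ser \<Rightarrow> ('n::monoid_add) ser) \<Rightarrow> bool"
  where "ser_hom F \<longleftrightarrow> ser_linear F \<and> F 1 = 1 \<and> (\<forall>x y. F (x * y) = F x * F y)"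

definition ser_character :: "(('m::monoid_add) ser \<Rightarrow> scalar) \<Rightarrow> bool"
  where "ser_character E \<longleftrightarrow> (\<forall>x y. E (x + y) = E x + E y) \<and> (\<forall>s x. E (s \<odot> x) = s * E x)
    \<and> E 1 = 1 \<and> (\<forall>x y. E (x * y) = E x * E y)"

text \<open>The quotient by \<open>I\<close> is a Hopf algebra with coproduct \<open>\<Delta>\<close>, counit \<open>E\<close> and antipode \<open>S\<close>.\<close>

definition top_hopf_algebra :: "('g list) ser set \<Rightarrow> ('g list ser \<Rightarrow> ('g list \<times> 'g list) ser)
    \<Rightarrow> ('g list ser \<Rightarrow> scalar) \<Rightarrow> ('g list ser \<Rightarrow> 'g list ser) \<Rightarrow> bool"
  where "top_hopf_algebra I \<Delta> E S \<longleftrightarrow>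
      closed_ideal I
    \<and> ser_hom \<Delta> \<and> (\<forall>x\<in>I. \<Delta> x \<in> tens_ideal I I)
    \<and> ser_character E \<and> (\<forall>x\<in>I. E x = 0)
    \<and> ser_linear S \<and> (\<forall>x\<in>I. S x \<in> I)
    \<and> (\<forall>x. assoc (tens_map \<Delta> id (\<Delta> x)) - tens_map id \<Delta> (\<Delta> x) \<in> tens_ideal I (tens_ideal I I))
    \<and> (\<forall>x. lin_ext (\<lambda>(m, n). E (basis m) \<odot> basis n) (\<Delta> x) - x \<in> I)
    \<and> (\<forall>x. lin_ext (\<lambda>(m, n). E (basis n) \<odot> basis m) (\<Delta> x) - x \<in> I)
    \<and> (\<forall>x. mult_map (tens_map S id (\<Delta> x)) - E x \<odot> 1 \<in> I)
    \<and> (\<forall>x. mult_map (tens_map id S (\<Delta> x)) - E x \<odot> 1 \<in> I)"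


section \<open>Quantum deformations of coboundary Lie bialgebras\<close>

text \<open>A Lie algebra with finite basis \<open>'g\<close> is given by its brackets of basis elements.\<close>

definition emb :: "('g::finite \<Rightarrow>\<^sub>0 real) \<Rightarrow> ('g list \<Rightarrow>\<^sub>0 real)"
  where "emb v = (\<Sum>g\<in>UNIV. Poly_Mapping.single [g] (Poly_Mapping.lookup v g))"

text \<open>The universal enveloping algebra is the free algebra modulo this ideal.\<close>

definition enveloping_ideal :: "('g::finite \<Rightarrow> 'g \<Rightarrow> ('g \<Rightarrow>\<^sub>0 real)) \<Rightarrow> ('g list \<Rightarrow>\<^sub>0 real) set"
  where "enveloping_ideal br = two_sided_ideal hull
    {comm (Poly_Mapping.single [X] 1) (Poly_Mapping.single [Y] 1) - emb (br X Y) | X Y. True}"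

text \<open>The cocommutator \<open>\<delta>(X) = [1 \<otimes> X + X \<otimes> 1, r]\<close> for \<open>r = \<Sum> r U V (U \<otimes> V)\<close>, the brackets being
  those of the Lie algebra: \<open>[1 \<otimes> X + X \<otimes> 1, U \<otimes> V] = [X,U] \<otimes> V + U \<otimes> [X,V]\<close>.\<close>

definition cocommutator :: "('g::finite \<Rightarrow> 'g \<Rightarrow> ('g \<Rightarrow>\<^sub>0 real)) \<Rightarrow> ('g \<Rightarrow> 'g \<Rightarrow> scalar) \<Rightarrow> 'g
    \<Rightarrow> ('g list \<times> 'g list) ser"
  where "cocommutator br r X = (\<Sum>U\<in>UNIV. \<Sum>V\<in>UNIV.
    r U V \<odot> (const2 (emb (br X U)) \<otimes> gen V + gen U \<otimes> const2 (emb (br X V))))"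

text \<open>Equality in the quotient by \<open>I\<close>, up to terms of order \<open>k\<close> in the parameters.\<close>

definition eq_upto :: "('m::monoid_add) ser set \<Rightarrow> nat \<Rightarrow> 'm ser \<Rightarrow> 'm ser \<Rightarrow> bool"
  where "eq_upto I k x y \<longleftrightarrow> (\<exists>z\<in>I. x - y - z \<in> adic k)"

text \<open>The quotient by \<open>I\<close> is topologically free over the scalars: the power series with
  coefficients in some real vector space \<open>V\<close> map bijectively onto it.\<close>

definition top_free :: "('m::monoid_add) ser set \<Rightarrow> bool"
  where "top_free I \<longleftrightarrow> (\<exists>V :: ('m \<Rightarrow>\<^sub>0 real) set.
      (0 \<in> V \<and> (\<forall>u\<in>V. \<forall>v\<in>V. u + v \<in> V) \<and> (\<forall>t. \<forall>v\<in>V. Poly_Mapping.single 0 t * v \<in> V))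
    \<and> (\<forall>x. \<exists>!v. (\<forall>i j. v $ i $ j \<in> V) \<and> x - v \<in> I))"

text \<open>The second conjunct says that the quotient modulo \<open>a\<close> and \<open>c\<close> is the enveloping algebra, with
  generators corresponding to generators.\<close>

definition quantum_deformation :: "('g::finite \<Rightarrow> 'g \<Rightarrow> ('g \<Rightarrow>\<^sub>0 real)) \<Rightarrow> ('g \<Rightarrow> 'g \<Rightarrow> scalar)
    \<Rightarrow> 'g list ser set \<Rightarrow> ('g list ser \<Rightarrow> ('g list \<times> 'g list) ser) \<Rightarrow> bool"
  where "quantum_deformation br r I \<Delta> \<longleftrightarrow>
      top_free I
    \<and> {x $ 0 $ 0 | x. x \<in> I} = enveloping_ideal br
    \<and> (\<forall>X. eq_upto (tens_ideal I I) 1 (\<Delta> (gen X)) (1 \<otimes> gen X + gen X \<otimes> 1))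
    \<and> (\<forall>X. eq_upto (tens_ideal I I) 2 (\<Delta> (gen X) - flip (\<Delta> (gen X))) (cocommutator br r X))"


section \<open>The extended Schroedinger Lie bialgebra and its quantum algebra\<close>

datatype sgen = Dg | Hg | Pg | Kg | Cg | Mg

lemma UNIV_sgen: "UNIV = {Dg, Hg, Pg, Kg, Cg, Mg}"
  by (auto intro: sgen.exhaust)

instance sgen :: finite
  by standard (simp add: UNIV_sgen)

abbreviation vec :: "sgen \<Rightarrow> real \<Rightarrow> (sgen \<Rightarrow>\<^sub>0 real)"
  where "vec X t \<equiv> Poly_Mapping.single X t"

fun sch_bracket :: "sgen \<Rightarrow> sgen \<Rightarrow> (sgen \<Rightarrow>\<^sub>0 real)" where
  "sch_bracket Dg Pg = vec Pg (-1)"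
| "sch_bracket Pg Dg = vec Pg 1"
| "sch_bracket Dg Kg = vec Kg 1"
| "sch_bracket Kg Dg = vec Kg (-1)"
| "sch_bracket Kg Pg = vec Mg 1"
| "sch_bracket Pg Kg = vec Mg (-1)"
| "sch_bracket Dg Hg = vec Hg (-2)"
| "sch_bracket Hg Dg = vec Hg 2"
| "sch_bracket Dg Cg = vec Cg 2"
| "sch_bracket Cg Dg = vec Cg (-2)"
| "sch_bracket Hg Cg = vec Dg 1"
| "sch_bracket Cg Hg = vec Dg (-1)"
| "sch_bracket Kg Hg = vec Pg 1"
| "sch_bracket Hg Kg = vec Pg (-1)"
| "sch_bracket Pg Cg = vec Kg (-1)"
| "sch_bracket Cg Pg = vec Kg 1"
| "sch_bracket _ _ = 0"

lemma sch_bracket_antisym: "sch_bracket X Y = - sch_bracket Y X"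
  by (cases X; cases Y) (simp_all add: single_uminus)

lemma sch_bracket_jacobi:
  "(\<Sum>V\<in>UNIV. Poly_Mapping.lookup (sch_bracket X Y) V * Poly_Mapping.lookup (sch_bracket V Z) W
    + Poly_Mapping.lookup (sch_bracket Y Z) V * Poly_Mapping.lookup (sch_bracket V X) W
    + Poly_Mapping.lookup (sch_bracket Z X) V * Poly_Mapping.lookup (sch_bracket V Y) W) = 0"
  by (cases X; cases Y; cases Z) (simp_all add: UNIV_sgen lookup_single when_def)

fun sch_r :: "sgen \<Rightarrow> sgen \<Rightarrow> scalar" where
  "sch_r Dg Hg = par_a"
| "sch_r Hg Dg = - par_a"
| "sch_r Pg Kg = par_c"
| "sch_r Kg Pg = - par_c"
| "sch_r _ _ = 0"

abbreviation D\<^sub>q :: "sgen list ser" where "D\<^sub>q \<equiv> gen Dg"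
abbreviation H\<^sub>q :: "sgen list ser" where "H\<^sub>q \<equiv> gen Hg"
abbreviation P\<^sub>q :: "sgen list ser" where "P\<^sub>q \<equiv> gen Pg"
abbreviation K\<^sub>q :: "sgen list ser" where "K\<^sub>q \<equiv> gen Kg"
abbreviation C\<^sub>q :: "sgen list ser" where "C\<^sub>q \<equiv> gen Cg"
abbreviation M\<^sub>q :: "sgen list ser" where "M\<^sub>q \<equiv> gen Mg"

definition sch_relations :: "(sgen list ser \<times> sgen list ser) set"
  where "sch_relations =
    { (comm D\<^sub>q P\<^sub>q, - P\<^sub>q),
      (comm D\<^sub>q K\<^sub>q, K\<^sub>q),
      (comm K\<^sub>q P\<^sub>q, quot (1 - sexp (- 2 * par_c * M\<^sub>q)) (2 * par_c)),
      (comm D\<^sub>q H\<^sub>q, quot (sexp (- 2 * par_a * H\<^sub>q) - 1) par_a),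
      (comm D\<^sub>q C\<^sub>q, 2 * C\<^sub>q - par_a * D\<^sub>q ^ 2),
      (comm H\<^sub>q C\<^sub>q, D\<^sub>q),
      (comm K\<^sub>q H\<^sub>q, sexp (- 2 * par_a * H\<^sub>q) * P\<^sub>q),
      (comm K\<^sub>q C\<^sub>q, - (const2 (1 / 2) * par_a) \<odot> (K\<^sub>q * D\<^sub>q + D\<^sub>q * K\<^sub>q)),
      (comm P\<^sub>q C\<^sub>q, - K\<^sub>q + (const2 (1 / 2) * par_a) \<odot> (D\<^sub>q * P\<^sub>q + P\<^sub>q * D\<^sub>q)),
      (comm P\<^sub>q H\<^sub>q, 0) }
    \<union> {(comm M\<^sub>q (gen X), 0) | X. True}"

end

theory Submission
  imports Defs
begin

text \<open>On the free algebra the given coproduct, together with the counit vanishing on generators and an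
  antipode read off from the coproduct, satisfies all Hopf algebra axioms exactly. Hence only the
  compatibility of coproduct and antipode with the relations has to be checked, by normal ordering
  in the quotient of the tensor square; the commutators with \<open>exp (t a H)\<close> follow from those with
  \<open>H\<close>. Topological freeness needs no basis theorem: replacing \<open>H\<close>, \<open>M\<close>, \<open>C\<close> by
  \<open>ln (1 + 2 a H) / (2 a)\<close>, \<open>- ln (1 - 2 c M) / (2 c)\<close>, \<open>C + a D\<^sup>2 / 2\<close> turns the undeformed relations
  into the deformed ones and is the identity modulo \<open>a\<close> and \<open>c\<close>, so the leading coefficients of
  the deformed ideal lie in the ideal of the enveloping algebra.\<close>

section \<open>The adic filtration and the scalars\<close>

text \<open>The substitution is found by integrating the relations. In the undeformed algebra ad D
  acts on series in H as -2 H d/dH, and f = ln (1 + 2 a H) / (2 a) is the solution of -2 H f' = (exp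
  (-2 a f) - 1) / a that starts with H; the series in M inverts m -> (1 - exp (-2 c m)) / (2 c); the
  summand a D^2 / 2 absorbs the quadratic term of [D,C]. A homomorphism in one direction suffices:
  an element of order k in the deformed ideal and its image have the same coefficients in total
  degree k. Two obstacles shape the rest. An element of a closed ideal is only a limit of
  combinations of the relations, so statements about series are proved modulo every power of the
  ideal (a, c), splitting off one factor of positive order at a time. Moreover, two relations
  contain quotients by a and 2 c. These factors are cancelled in the free algebra, where this is a
  shift of coefficients, and not modulo the deformed ideal; hence coproduct and antipode of both
  quotients are computed in the free algebra, and the quotients stay separate symbols during normal
  ordering.\<close>

lemma ser_eqI: "(\<And>i j. x $ i $ j = y $ i $ j) \<Longrightarrow> x = (y :: 'a::zero fps fps)"
  by (simp add: fps_eq_iff)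

lemma fps2_mult_nth:
  "(x * y) $ i $ j = (\<Sum>k\<le>i. \<Sum>l\<le>j. x $ k $ l * y $ (i - k) $ (j - l))"
  for x y :: "'a::semiring_0 fps fps"
  by (simp add: fps_mult_nth fps_sum_nth atLeast0AtMost)

lemma poly_mapping_sum_singles:
  "(v :: 'm \<Rightarrow>\<^sub>0 'a::comm_monoid_add)
    = (\<Sum>m\<in>Poly_Mapping.keys v. Poly_Mapping.single m (Poly_Mapping.lookup v m))"
proof (rule poly_mapping_eqI)
  fix k
  show "Poly_Mapping.lookup v k = Poly_Mapping.lookup
      (\<Sum>m\<in>Poly_Mapping.keys v. Poly_Mapping.single m (Poly_Mapping.lookup v m)) k"
    by (cases "k \<in> Poly_Mapping.keys v")
      (simp_all add: lookup_sum lookup_single when_def sum.delta' in_keys_iff)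
qed

lemma single_zero_commute:
  "Poly_Mapping.single 0 t * v = v * Poly_Mapping.single 0 (t :: real)" for v :: "'m::monoid_add \<Rightarrow>\<^sub>0 real"
proof -
  let ?v = "\<Sum>m\<in>Poly_Mapping.keys v. Poly_Mapping.single m (Poly_Mapping.lookup v m)"
  have "Poly_Mapping.single 0 t * ?v = ?v * Poly_Mapping.single 0 t"
    by (simp add: sum_distrib_left sum_distrib_right mult_single mult.commute)
  then show ?thesis
    using poly_mapping_sum_singles[of v] by simp
qed

lemma lookup_single_zero_mult:
  "Poly_Mapping.lookup (Poly_Mapping.single 0 t * v) k = t * Poly_Mapping.lookup v k"
  for v :: "'m::monoid_add \<Rightarrow>\<^sub>0 real"
proof -
  let ?v = "\<Sum>m\<in>Poly_Mapping.keys v. Poly_Mapping.single m (Poly_Mapping.lookup v m)"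
  have "Poly_Mapping.lookup (Poly_Mapping.single 0 t * ?v) k = t * Poly_Mapping.lookup ?v k"
    by (simp add: sum_distrib_left mult_single lookup_sum lookup_single when_def if_distrib
        sum_distrib_left cong: if_cong)
  then show ?thesis
    using poly_mapping_sum_singles[of v] by simp
qed

lemma adicD: "x \<in> adic k \<Longrightarrow> i + j < k \<Longrightarrow> x $ i $ j = 0"
  by (simp add: adic_def)

lemma adic_0 [simp]: "x \<in> adic 0"
  by (simp add: adic_def)

lemma zero_in_adic [simp]: "0 \<in> adic k"
  by (simp add: adic_def)

lemma adic_add: "x \<in> adic k \<Longrightarrow> y \<in> adic k \<Longrightarrow> x + y \<in> adic k"
  for x y :: "'a::monoid_add fps fps"
  by (simp add: adic_def)

lemma adic_diff: "x \<in> adic k \<Longrightarrow> y \<in> adic k \<Longrightarrow> x - y \<in> adic k"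
  for x y :: "'a::group_add fps fps"
  by (simp add: adic_def)

lemma adic_uminus: "x \<in> adic k \<Longrightarrow> - x \<in> adic k"
  for x :: "'a::group_add fps fps"
  by (simp add: adic_def)

lemma adic_sum: "(\<And>i. i \<in> A \<Longrightarrow> f i \<in> adic k) \<Longrightarrow> sum f A \<in> adic k"
  for f :: "'b \<Rightarrow> 'a::comm_monoid_add fps fps"
  by (induction A rule: infinite_finite_induct) (simp_all add: adic_add)

lemma adic_mono: "x \<in> adic k \<Longrightarrow> l \<le> k \<Longrightarrow> x \<in> adic l"
  by (simp add: adic_def)

lemma adic_mult:
  fixes x y :: "'a::semiring_0 fps fps"
  assumes "x \<in> adic k" "y \<in> adic l"
  shows "x * y \<in> adic (k + l)"
  unfolding adic_def
proof (intro CollectI allI impI)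
  fix i j assume ij: "i + j < k + l"
  have "x $ p $ q * y $ (i - p) $ (j - q) = 0" if "p \<le> i" "q \<le> j" for p q
  proof (cases "p + q < k")
    case False
    \<comment> \<open>Total degrees add up to i + j < k + l, so one of the two factors has too small
      a degree.\<close>
    then have "i - p + (j - q) < l"
      using that ij by linarith
    then show ?thesis
      using assms(2) by (simp add: adicD)
  qed (use assms(1) in \<open>simp add: adicD\<close>)
  then show "(x * y) $ i $ j = 0"
    by (simp add: fps2_mult_nth)
qed

lemma adic_mult_left: "y \<in> adic k \<Longrightarrow> x * y \<in> adic k" for x y :: "'a::semiring_0 fps fps"
  using adic_mult[of x 0 y k] by simp

lemma adic_mult_right: "x \<in> adic k \<Longrightarrow> x * y \<in> adic k" for x y :: "'a::semiring_0 fps fps"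
  using adic_mult[of x k y 0] by simp

lemma adic_power: "x \<in> adic 1 \<Longrightarrow> x ^ n \<in> adic n" for x :: "'a::semiring_1 fps fps"
  using adic_mult[of x 1] by (induction n) auto

text \<open>The topology is separated. Equalities of series are therefore proved modulo
  \<open>adic k\<close> by induction on k.\<close>

lemma eq_0_if_adic: "(\<And>k. x \<in> adic k) \<Longrightarrow> x = 0"
proof (rule ser_eqI)
  fix i j
  assume "\<And>k. x \<in> adic k"
  then show "x $ i $ j = 0 $ i $ j"
    using adicD[of x "Suc (i + j)" i j] by simp
qed

lemma eq_if_adic: "(\<And>k. x - y \<in> adic k) \<Longrightarrow> x = y" for x y :: "'a::group_add fps fps"
  using eq_0_if_adic[of "x - y"] by simp

lemma par_a_adic: "par_a \<in> adic 1" and par_c_adic: "par_c \<in> adic 1"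
  by (auto simp: adic_def fps_X_def)

text \<open>All monomials divisible by a go into the second summand, the remaining pure powers of c
  into the third. Inductions on the order split off one parameter in this way.\<close>

lemma fps2_decompose:
  "x = const2 (x $ 0 $ 0) + par_a * fps_shift 1 x + par_c * fps_const (fps_shift 1 (x $ 0))"
  for x :: "'a::ring_1 fps fps"
proof (rule ser_eqI)
  fix i j
  show "x $ i $ j = (const2 (x $ 0 $ 0) + par_a * fps_shift 1 x
      + par_c * fps_const (fps_shift 1 (x $ 0))) $ i $ j"
    by (cases i; cases j) (simp_all add: )
qed

lemma adic_1_decompose:
  fixes x :: "'a::ring_1 fps fps"
  assumes "x $ 0 $ 0 = 0"
  obtains y z where "x = par_a * y + par_c * z"
proof (rule that)
  show "x = par_a * fps_shift 1 x + par_c * fps_const (fps_shift 1 (x $ 0))"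
    using fps2_decompose[of x] assms by (simp del: fps_const_mult)
qed

lemma mult_par_a_adic: "x \<in> adic k \<Longrightarrow> par_a * x \<in> adic (Suc k)"
  and mult_par_c_adic: "x \<in> adic k \<Longrightarrow> par_c * x \<in> adic (Suc k)" for x :: "'a::ring_1 fps fps"
  using adic_mult[OF par_a_adic, of x k] adic_mult[OF par_c_adic, of x k] by simp_all

section \<open>The central embedding of the scalars\<close>

lemma scal_nth [simp]: "scal s $ i $ j = Poly_Mapping.single 0 (s $ i $ j)"
  by (simp add: scal_def)

lemma scal_0 [simp]: "scal 0 = 0"
  by (rule ser_eqI) simp

lemma scal_1 [simp]: "scal 1 = 1"
  by (rule ser_eqI) (simp add: fps_one_nth)

lemma scal_add: "scal (s + t) = scal s + scal t"
  by (rule ser_eqI) (simp add: single_add)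

lemma scal_uminus: "scal (- s) = - scal s"
  by (rule ser_eqI) (simp add: single_uminus)

lemma scal_mult: "scal (s * t) = scal s * (scal t :: 'm::monoid_add ser)"
proof (rule ser_eqI)
  fix i j
  have single_sum: "Poly_Mapping.single 0 (sum f A) = (\<Sum>i\<in>A. Poly_Mapping.single (0::'m) (f i))"
    for f :: "nat \<Rightarrow> real" and A
    by (induction A rule: infinite_finite_induct) (simp_all add: single_add)
  show "scal (s * t) $ i $ j = (scal s * scal t :: 'm ser) $ i $ j"
    by (simp add: fps2_mult_nth single_sum mult_single)
qed

lemma scal_par_a [simp]: "scal par_a = par_a"
  by (rule ser_eqI) (simp add: fps_X_def)

lemma scal_par_c [simp]: "scal par_c = par_c"
  by (rule ser_eqI) (simp add: fps_X_def)

lemma scal_const2: "scal (const2 t) = const2 (Poly_Mapping.single 0 t)"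
  by (rule ser_eqI) simp

text \<open>The coefficients of a scalar series are real multiples of the unit and hence central;
  reversing both Cauchy sums does the rest.\<close>

lemma scal_commute: "scal s * x = x * scal s" for x :: "'m::monoid_add ser"
proof (rule ser_eqI)
  fix i j
  have rev: "sum f {..n} = (\<Sum>k\<le>n. f (n - k))" for f :: "nat \<Rightarrow> 'm \<Rightarrow>\<^sub>0 real" and n
    by (rule sum.reindex_bij_witness[of _ "\<lambda>k. n - k" "\<lambda>k. n - k"]) auto
  have "(scal s * x) $ i $ j
      = (\<Sum>k\<le>i. \<Sum>l\<le>j. x $ (i - k) $ (j - l) * scal s $ k $ l)"
    by (simp add: fps2_mult_nth single_zero_commute)
  also have "\<dots> = (\<Sum>k\<le>i. \<Sum>l\<le>j. x $ (i - k) $ l * scal s $ k $ (j - l))"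
    by (rule sum.cong[OF refl], subst (2) rev) (auto intro!: sum.cong)
  also have "\<dots> = (\<Sum>k\<le>i. \<Sum>l\<le>j. x $ k $ l * scal s $ (i - k) $ (j - l))"
    by (subst (2) rev) (auto intro!: sum.cong)
  finally show "(scal s * x) $ i $ j = (x * scal s) $ i $ j"
    by (simp add: fps2_mult_nth)
qed

lemma const2_sum: "const2 (sum f A) = (\<Sum>i\<in>A. const2 (f i))"
  for f :: "'i \<Rightarrow> 'a::comm_monoid_add"
  by (induction A rule: infinite_finite_induct) (simp_all flip: fps_const_add)

lemma basis_0 [simp]: "basis 0 = 1"
  by (simp add: basis_def)

lemma basis_mult: "basis m * basis n = basis (m + n)"
  by (simp add: basis_def mult_single)

lemma const2_eq_sum_basis:
  "const2 v = (\<Sum>m\<in>Poly_Mapping.keys v. const2 (Poly_Mapping.lookup v m) \<odot> basis m)"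
  for v :: "'m::monoid_add \<Rightarrow>\<^sub>0 real"
  by (subst poly_mapping_sum_singles) (simp add: const2_sum smult_def scal_const2 basis_def mult_single)

lemma smult_mult_left: "(s \<odot> x) * y = s \<odot> (x * y)"
  by (simp add: smult_def mult.assoc)

lemma smult_mult_right: "x * (s \<odot> y) = s \<odot> (x * y)"
  by (metis smult_def mult.assoc scal_commute)

lemma smult_add_right: "s \<odot> (x + y) = s \<odot> x + s \<odot> y"
  by (simp add: smult_def distrib_left)

lemma smult_diff_right: "s \<odot> (x - y) = s \<odot> x - s \<odot> y"
  by (simp add: smult_def right_diff_distrib)

lemma smult_smult: "s \<odot> t \<odot> x = (s * t) \<odot> x"
  by (simp add: smult_def mult.assoc scal_mult)

lemma smult_1 [simp]: "1 \<odot> x = x" and smult_0 [simp]: "0 \<odot> x = 0"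
  and smult_zero_right [simp]: "s \<odot> 0 = 0"
  by (simp_all add: smult_def)

lemma smult_par_a: "par_a \<odot> x = par_a * x" and smult_par_c: "par_c \<odot> x = par_c * x"
  by (simp_all add: smult_def)


section \<open>Closed ideals and linear maps\<close>

lemma two_sided_idealD:
  assumes "two_sided_ideal J"
  shows "0 \<in> J" "x \<in> J \<Longrightarrow> y \<in> J \<Longrightarrow> x + y \<in> J" "x \<in> J \<Longrightarrow> y * x \<in> J" "x \<in> J \<Longrightarrow> x * y \<in> J"
    "x \<in> J \<Longrightarrow> - x \<in> J" "x \<in> J \<Longrightarrow> y \<in> J \<Longrightarrow> x - y \<in> J"
proof -
  show "0 \<in> J" and add: "x \<in> J \<Longrightarrow> y \<in> J \<Longrightarrow> x + y \<in> J" for x y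
    using assms by (auto simp: two_sided_ideal_def)
  show mult: "x \<in> J \<Longrightarrow> y * x \<in> J" "x \<in> J \<Longrightarrow> x * y \<in> J" for x y
    using assms by (auto simp: two_sided_ideal_def)
  show uminus: "x \<in> J \<Longrightarrow> - x \<in> J" for x
    using mult(1)[of x "- 1"] by simp
  show "x \<in> J \<Longrightarrow> y \<in> J \<Longrightarrow> x - y \<in> J"
    using add[of x "- y"] uminus[of y] by simp
qed

lemma two_sided_ideal_sum:
  "two_sided_ideal J \<Longrightarrow> (\<And>i. i \<in> A \<Longrightarrow> f i \<in> J) \<Longrightarrow> sum f A \<in> J"
  by (induction A rule: infinite_finite_induct) (auto intro: two_sided_idealD)

lemma two_sided_ideal_hull: "two_sided_ideal (two_sided_ideal hull A)"
  by (rule hull_in) (auto simp: two_sided_ideal_def)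

lemma closed_ideal_two_sided: "closed_ideal J \<Longrightarrow> two_sided_ideal J"
  by (simp add: closed_ideal_def)

lemmas closed_idealD = two_sided_idealD[OF closed_ideal_two_sided]

lemma closed_ideal_closed:
  "closed_ideal J \<Longrightarrow> (\<And>k. \<exists>y\<in>J. x - y \<in> adic k) \<Longrightarrow> x \<in> J"
  by (simp add: closed_ideal_def)

lemma closed_ideal_smult: "closed_ideal J \<Longrightarrow> x \<in> J \<Longrightarrow> s \<odot> x \<in> J"
  by (simp add: smult_def closed_idealD)

text \<open>Closedness passes to intersections, because approximants taken from the intersection lie
  in every member. So the hull is itself a closed ideal.\<close>

lemma closed_ideal_hull: "closed_ideal (closed_ideal hull A)"
proof (rule hull_in)
  fix T :: "'a ser set set" assume T: "Ball T closed_ideal"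
  show "closed_ideal (\<Inter> T)"
    unfolding closed_ideal_def
  proof (intro conjI allI impI)
    show "two_sided_ideal (\<Inter> T)"
      using T by (auto simp: two_sided_ideal_def closed_ideal_def)
    fix x assume "\<forall>k. \<exists>y\<in>\<Inter> T. x - y \<in> adic k"
    then show "x \<in> \<Inter> T"
      using T by (meson InterE InterI closed_ideal_closed)
  qed
qed

text \<open>With this ideal, membership results specialise to equalities: two linear maps agree when
  their difference lands in it.\<close>

lemma closed_ideal_0: "closed_ideal {0}"
  by (auto simp: closed_ideal_def two_sided_ideal_def intro: eq_0_if_adic)

lemma ser_linearD:
  assumes "ser_linear F"
  shows "F (x + y) = F x + F y" "F (s \<odot> x) = s \<odot> F x" "F 0 = 0" "F (- x) = - F x"
    "F (x - y) = F x - F y" "F (scal s * x) = scal s * F x"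
proof -
  show add: "F (x + y) = F x + F y" and smult: "F (s \<odot> x) = s \<odot> F x" for x y s
    using assms by (auto simp: ser_linear_def)
  show "F 0 = 0"
    using add[of 0 0] by simp
  show uminus: "F (- x) = - F x" for x
    using smult[of "- 1" x] by (simp add: smult_def scal_uminus)
  show "F (x - y) = F x - F y"
    using add[of x "- y"] uminus[of y] by simp
  show "F (scal s * x) = scal s * F x"
    using smult[of s x] by (simp add: smult_def)
qed

lemma ser_linear_sum: "ser_linear F \<Longrightarrow> F (sum f A) = (\<Sum>i\<in>A. F (f i))"
  by (induction A rule: infinite_finite_induct) (simp_all add: ser_linearD)

lemma ser_linear_par:
  assumes "ser_linear F"
  shows "F (par_a * x) = par_a * F x" "F (par_c * x) = par_c * F x"
  using ser_linearD(6)[OF assms, of par_a] ser_linearD(6)[OF assms, of par_c] by simp_all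

lemma ser_linear_const2:
  assumes "ser_linear F"
  shows "F (const2 v) = (\<Sum>m\<in>Poly_Mapping.keys v. const2 (Poly_Mapping.lookup v m) \<odot> F (basis m))"
  by (subst const2_eq_sum_basis) (simp add: ser_linear_sum ser_linearD assms)

lemma ser_linear_id [simp]: "ser_linear (\<lambda>x. x)" "ser_linear id"
  by (simp_all add: ser_linear_def)

lemma ser_linear_comp: "ser_linear F \<Longrightarrow> ser_linear G \<Longrightarrow> ser_linear (\<lambda>x. F (G x))"
  by (simp add: ser_linear_def)

lemma ser_linear_diff: "ser_linear F \<Longrightarrow> ser_linear G \<Longrightarrow> ser_linear (\<lambda>x. F x - G x)"
  by (simp add: ser_linear_def algebra_simps smult_diff_right)

lemma ser_linear_mult_left: "ser_linear F \<Longrightarrow> ser_linear (\<lambda>x. y * F x)"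
  by (simp add: ser_linear_def distrib_left smult_mult_right)

lemma ser_linear_mult_right: "ser_linear F \<Longrightarrow> ser_linear (\<lambda>x. F x * y)"
  by (simp add: ser_linear_def distrib_right smult_mult_left)

text \<open>Since \<open>F\<close> maps \<open>adic k\<close> to \<open>adic k\<close>, it is determined up to \<open>adic k\<close> by finitely many
  values on basis elements.\<close>

lemma ser_linear_in_closed_ideal:
  assumes F: "ser_linear F" and J: "closed_ideal J" and basis: "\<And>m. F (basis m) \<in> J"
  shows "F x \<in> J"
proof (rule closed_ideal_closed[OF J])
  fix k
  show "\<exists>y\<in>J. F x - y \<in> adic k"
  proof (induction k arbitrary: x)
    case 0
    then show ?case
      using closed_idealD(1)[OF J] by auto
  next
    case (Suc k)
    define x' x'' where x_parts: "x' = fps_shift 1 x" "x'' = fps_const (fps_shift 1 (x $ 0))"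
    have x: "F x = F (const2 (x $ 0 $ 0)) + par_a * F x' + par_c * F x''"
      using arg_cong[OF fps2_decompose[of x], of F]
    by (simp add: ser_linearD ser_linear_par F x_parts del: fps_const_mult)
    obtain y' y'' where y: "y' \<in> J" "F x' - y' \<in> adic k" "y'' \<in> J" "F x'' - y'' \<in> adic k"
      using Suc.IH by meson
    define y where "y = F (const2 (x $ 0 $ 0)) + par_a * y' + par_c * y''"
    have "F (const2 (x $ 0 $ 0)) \<in> J"
      using J basis by (simp add: ser_linear_const2[OF F] two_sided_ideal_sum
          closed_ideal_two_sided closed_ideal_smult)
    then have "y \<in> J"
      unfolding y_def using y by (intro closed_idealD[OF J])
    moreover have "F x - y = par_a * (F x' - y') + par_c * (F x'' - y'')"
      by (simp add: x y_def algebra_simps)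
    then have "F x - y \<in> adic (Suc k)"
      using y by (simp add: adic_add mult_par_a_adic mult_par_c_adic)
    ultimately show ?case
      by blast
  qed
qed

lemma ser_linear_eqI:
  assumes "ser_linear F" "ser_linear G" "\<And>m. F (basis m) = G (basis m)"
  shows "F x = G x"
  using ser_linear_in_closed_ideal[OF ser_linear_diff[OF assms(1,2)] closed_ideal_0] assms(3) by simp

text \<open>Continuity is automatic: a linear map commutes with a and c, so the parameters split off
  from x can be taken out of F x.\<close>

lemma ser_linear_adic:
  assumes F: "ser_linear F"
  shows "x \<in> adic k \<Longrightarrow> F x \<in> adic k"
proof (induction k arbitrary: x)
  case (Suc k)
  have *: "fps_shift 1 x \<in> adic k" "fps_const (fps_shift 1 (x $ 0)) \<in> adic k" "x $ 0 $ 0 = 0"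
    using Suc.prems by (auto simp: adic_def)
  have "F x = par_a * F (fps_shift 1 x) + par_c * F (fps_const (fps_shift 1 (x $ 0)))"
    using arg_cong[OF fps2_decompose[of x], of F] \<open>x $ 0 $ 0 = 0\<close>
    by (simp add: ser_linearD ser_linear_par F del: fps_const_mult)
  then show ?case
    using * by (simp add: adic_add mult_par_a_adic mult_par_c_adic Suc.IH)
qed simp

text \<open>Reduces linearity over all power series to the reals and the two parameters. Decomposing
  s pushes the defect F (s x) - s F x into ever higher order.\<close>

lemma ser_linearI:
  assumes add: "\<And>x y. F (x + y) = F x + F y"
    and a: "\<And>x. F (par_a * x) = par_a * F x" and c: "\<And>x. F (par_c * x) = par_c * F x"
    and const: "\<And>t x. F (const2 (Poly_Mapping.single 0 t) * x) = const2 (Poly_Mapping.single 0 t) * F x"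
  shows "ser_linear F"
proof -
  have "F (scal s * x) - scal s * F x \<in> adic k" for s x k
  proof (induction k arbitrary: s)
    case (Suc k)
    define s' s'' where s_parts: "s' = fps_shift 1 s" "s'' = fps_const (fps_shift 1 (s $ 0))"
    have s: "scal s = const2 (Poly_Mapping.single 0 (s $ 0 $ 0)) + par_a * scal s'
        + (par_c * scal s'' :: 'z::monoid_add ser)"
      unfolding s_parts
      by (subst fps2_decompose[of s])
        (simp only: scal_add scal_mult scal_const2 scal_par_a scal_par_c)
    have "F (scal s * x) - scal s * F x
        = par_a * (F (scal s' * x) - scal s' * F x) + par_c * (F (scal s'' * x) - scal s'' * F x)"
      unfolding s by (simp add: algebra_simps add const a c)
    then show ?case
      by (simp add: Suc.IH adic_add mult_par_a_adic mult_par_c_adic)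
  qed simp
  then have "F (scal s * x) = scal s * F x" for s x
    by (rule eq_if_adic)
  then show ?thesis
    by (simp add: ser_linear_def smult_def add)
qed

lemma ser_linear_lin_ext: "ser_linear (lin_ext f)" for f :: "'m::monoid_add \<Rightarrow> 'n::monoid_add ser"
proof -
  define \<Phi> where "\<Phi> p q v = (\<Sum>m\<in>Poly_Mapping.keys v.
      Poly_Mapping.single 0 (Poly_Mapping.lookup v m) * (f m $ p $ q))" for p q and v :: "'m \<Rightarrow>\<^sub>0 real"
  \<comment> \<open>Terms outside the support vanish, so sums over different supports can be
    compared over one finite set; additivity needs this because supports can shrink.\<close>
  have superset: "\<Phi> p q v = (\<Sum>m\<in>A. Poly_Mapping.single 0 (Poly_Mapping.lookup v m) * (f m $ p $ q))"
    if "finite A" "Poly_Mapping.keys v \<subseteq> A" for A p q v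
    unfolding \<Phi>_def using that by (intro sum.mono_neutral_left) (auto simp: in_keys_iff)
  have \<Phi>_add: "\<Phi> p q (u + v) = \<Phi> p q u + \<Phi> p q v" for p q u v
  proof -
    let ?A = "Poly_Mapping.keys u \<union> Poly_Mapping.keys v"
    have "Poly_Mapping.keys (u + v) \<subseteq> ?A"
      by (rule Poly_Mapping.keys_add)
    then show ?thesis
      by (simp add: superset[of ?A] lookup_add single_add distrib_right sum.distrib)
  qed
  have \<Phi>_0: "\<Phi> p q 0 = 0" for p q
    by (simp add: \<Phi>_def)
  have \<Phi>_const: "\<Phi> p q (Poly_Mapping.single 0 t * v) = Poly_Mapping.single 0 t * \<Phi> p q v" for p q t v
  proof -
    have "Poly_Mapping.keys (Poly_Mapping.single 0 t * v) \<subseteq> Poly_Mapping.keys v"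
      by (auto simp: in_keys_iff lookup_single_zero_mult)
    then have "\<Phi> p q (Poly_Mapping.single 0 t * v) = (\<Sum>m\<in>Poly_Mapping.keys v.
        Poly_Mapping.single 0 t * (Poly_Mapping.single 0 (Poly_Mapping.lookup v m) * (f m $ p $ q)))"
      by (simp add: superset[of "Poly_Mapping.keys v"] lookup_single_zero_mult
          mult.assoc[symmetric] mult_single)
    then show ?thesis
      by (simp add: \<Phi>_def sum_distrib_left)
  qed
  have lin_ext: "lin_ext f x $ k $ l = (\<Sum>i\<le>k. \<Sum>j\<le>l. \<Phi> (k - i) (l - j) (x $ i $ j))" for x k l
    by (simp add: lin_ext_def \<Phi>_def)
  show ?thesis
  proof (rule ser_linearI; rule ser_eqI)
    fix x y k l
    show "lin_ext f (x + y) $ k $ l = (lin_ext f x + lin_ext f y) $ k $ l"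
      by (simp add: lin_ext \<Phi>_add sum.distrib)
    show "lin_ext f (par_a * x) $ k $ l = (par_a * lin_ext f x) $ k $ l"
    proof (cases k)
      case (Suc k')
      then show ?thesis
        by (simp add: lin_ext \<Phi>_0 sum.atMost_Suc_shift del: sum.atMost_Suc)
    qed (simp add: lin_ext \<Phi>_0)
    show "lin_ext f (par_c * x) $ k $ l = (par_c * lin_ext f x) $ k $ l"
    proof (cases l)
      case (Suc l')
      then show ?thesis
        by (simp add: lin_ext \<Phi>_0 sum.atMost_Suc_shift del: sum.atMost_Suc)
    qed (simp add: lin_ext \<Phi>_0)
    fix t
    show "lin_ext f (const2 (Poly_Mapping.single 0 t) * x) $ k $ l
        = (const2 (Poly_Mapping.single 0 t) * lin_ext f x) $ k $ l"
      by (simp add: lin_ext \<Phi>_const sum_distrib_left)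
  qed
qed

lemma lin_ext_basis [simp]: "lin_ext f (basis m) = f m" for f :: "'m \<Rightarrow> 'n::monoid_add ser"
proof (rule ser_eqI)
  fix k l
  have "(\<Sum>j\<le>l. \<Sum>m'\<in>Poly_Mapping.keys (basis m $ i $ j).
      Poly_Mapping.single 0 (Poly_Mapping.lookup (basis m $ i $ j) m') * (f m' $ (k - i) $ (l - j)))
    = (if i = 0 then f m $ k $ l else 0)" for i
  proof (cases "i = 0")
    case True
    have "(\<Sum>m'\<in>Poly_Mapping.keys (basis m $ i $ j).
      Poly_Mapping.single 0 (Poly_Mapping.lookup (basis m $ i $ j) m') * (f m' $ (k - i) $ (l - j)))
      = (if j = 0 then f m $ k $ l else 0)" for j
      using True by (simp add: basis_def)
    then show ?thesis
      using True by simp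
  qed (simp add: basis_def)
  then show "lin_ext f (basis m) $ k $ l = f m $ k $ l"
    by (simp add: lin_ext_def)
qed


section \<open>Homomorphisms\<close>

lemma ser_homD:
  assumes "ser_hom F"
  shows "ser_linear F" "F 1 = 1" "F (x * y) = F x * F y"
  using assms by (auto simp: ser_hom_def)

lemmas ser_hom_linearD = ser_linearD[OF ser_homD(1)]
lemmas ser_hom_par = ser_linear_par[OF ser_homD(1)]

lemma ser_hom_scal: "ser_hom F \<Longrightarrow> F (scal s) = scal s"
  using ser_hom_linearD(6)[of F s 1] by (simp add: ser_homD)

lemma ser_hom_id [simp]: "ser_hom (\<lambda>x. x)" "ser_hom id"
  by (simp_all add: ser_hom_def)

lemma ser_hom_comp: "ser_hom F \<Longrightarrow> ser_hom G \<Longrightarrow> ser_hom (\<lambda>x. F (G x))"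
  by (simp add: ser_hom_def ser_linear_comp)

text \<open>Both sides are linear in each argument, so basis elements suffice in one argument after
  the other.\<close>

lemma ser_linear_mult_eqI:
  assumes F: "ser_linear F" and basis: "\<And>m n. F (basis m * basis n) = F (basis m) * F (basis n)"
  shows "F (x * y) = F x * F y"
proof -
  have "F (basis m * y) = F (basis m) * F y" for m
    by (rule ser_linear_eqI[where x = y, OF ser_linear_comp[OF F ser_linear_mult_left[OF ser_linear_id(1)]]
          ser_linear_mult_left[OF F]]) (rule basis)
  then show ?thesis
    by (intro ser_linear_eqI[where x = x, OF ser_linear_comp[OF F ser_linear_mult_right[OF ser_linear_id(1)]]
          ser_linear_mult_right[OF F]])
qed

lemma ser_hom_lin_ext:
  assumes "f 0 = 1" "\<And>m n. f (m + n) = f m * f n"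
  shows "ser_hom (lin_ext f)"
proof -
  have "lin_ext f 1 = 1"
    using lin_ext_basis[of f 0] assms by simp
  moreover have "lin_ext f (x * y) = lin_ext f x * lin_ext f y" for x y
    by (rule ser_linear_mult_eqI[OF ser_linear_lin_ext]) (simp add: basis_mult assms)
  ultimately show ?thesis
    by (simp add: ser_hom_def ser_linear_lin_ext)
qed

text \<open>The third hypothesis is weaker than multiplicativity so that the antipode, which
  reverses products, is covered as well.\<close>

lemma closed_ideal_vimage:
  assumes F: "ser_linear F" and J: "closed_ideal J"
    and ideal: "\<And>x y. F x \<in> J \<Longrightarrow> F (x * y) \<in> J \<and> F (y * x) \<in> J"
  shows "closed_ideal (F -` J)"
  unfolding closed_ideal_def
proof (intro conjI allI impI)
  show "two_sided_ideal (F -` J)"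
    using ideal by (auto simp: two_sided_ideal_def ser_linearD[OF F] closed_idealD[OF J])
  fix x assume x: "\<forall>k. \<exists>y\<in>F -` J. x - y \<in> adic k"
  have "F x \<in> J"
  proof (rule closed_ideal_closed[OF J])
    fix k
    obtain y where "F y \<in> J" "x - y \<in> adic k"
      using x by auto
    then show "\<exists>y\<in>J. F x - y \<in> adic k"
      using ser_linear_adic[OF F, of "x - y" k] by (auto simp: ser_linearD[OF F])
  qed
  then show "x \<in> F -` J"
    by simp
qed

lemma closed_ideal_hom_vimage: "ser_hom F \<Longrightarrow> closed_ideal J \<Longrightarrow> closed_ideal (F -` J)"
  by (rule closed_ideal_vimage) (simp_all add: ser_homD closed_idealD)

lemma gen_mult_basis: "gen g * basis w = basis (g # w)"
  by (simp add: gen_def basis_mult plus_list_def)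

lemma basis_Nil [simp]: "basis [] = 1"
  unfolding zero_list_def[symmetric] by (rule basis_0)

definition free_hom :: "('g \<Rightarrow> ('n::monoid_add) ser) \<Rightarrow> 'g list ser \<Rightarrow> 'n ser"
  where "free_hom f = lin_ext (\<lambda>w. prod_list (map f w))"

lemma ser_hom_free_hom: "ser_hom (free_hom f)"
  unfolding free_hom_def by (rule ser_hom_lin_ext) (simp_all add: zero_list_def plus_list_def)

lemma free_hom_gen [simp]: "free_hom f (gen g) = f g"
  by (simp add: free_hom_def gen_def)

lemma ser_hom_gen_eqI:
  assumes "ser_hom F" "ser_hom G" "\<And>g. F (gen g) = G (gen g)"
  shows "F x = G x"
proof (rule ser_linear_eqI[where F = F and G = G])
  fix w
  show "F (basis w) = G (basis w)"
    by (induction w) (simp_all add: assms ser_homD flip: gen_mult_basis)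
qed (use assms in \<open>simp_all add: ser_homD\<close>)


section \<open>Anti-homomorphisms out of the free algebra\<close>

definition free_antihom :: "('g \<Rightarrow> ('n::monoid_add) ser) \<Rightarrow> 'g list ser \<Rightarrow> 'n ser"
  where "free_antihom f = lin_ext (\<lambda>w. prod_list (rev (map f w)))"

lemma ser_linear_free_antihom: "ser_linear (free_antihom f)"
  by (simp add: free_antihom_def ser_linear_lin_ext)

lemma free_antihom_gen [simp]: "free_antihom f (gen g) = f g"
  by (simp add: free_antihom_def gen_def)

lemma free_antihom_1 [simp]: "free_antihom f 1 = 1"
  using lin_ext_basis[of "\<lambda>w. prod_list (rev (map f w))" "[]"] by (simp add: free_antihom_def)

lemma free_antihom_mult: "free_antihom f (x * y) = free_antihom f y * free_antihom f x"
proof -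
  have lin: "ser_linear (\<lambda>x. free_antihom f (x * y))" "ser_linear (\<lambda>y. free_antihom f (x * y))" for x y
    by (rule ser_linear_comp[OF ser_linear_free_antihom ser_linear_mult_right[OF ser_linear_id(1)]]
        ser_linear_comp[OF ser_linear_free_antihom ser_linear_mult_left[OF ser_linear_id(1)]])+
  have "free_antihom f (basis v * basis w) = free_antihom f (basis w) * free_antihom f (basis v)" for v w
    by (simp add: basis_mult free_antihom_def plus_list_def)
  then have "free_antihom f (basis v * y) = free_antihom f y * free_antihom f (basis v)" for v
    by (intro ser_linear_eqI[where x = y, OF lin(2) ser_linear_mult_right[OF ser_linear_free_antihom]])
  then show ?thesis
    by (intro ser_linear_eqI[where x = x, OF lin(1) ser_linear_mult_left[OF ser_linear_free_antihom]])
qed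

section \<open>Completed tensor products\<close>

lemma ser_hom_inl: "ser_hom (lin_ext (\<lambda>m. basis (m, 0)) :: 'm ser \<Rightarrow> ('m::monoid_add \<times> 'n::monoid_add) ser)"
  by (rule ser_hom_lin_ext) (simp_all add: basis_mult flip: zero_prod_def)

lemma ser_hom_inr: "ser_hom (lin_ext (\<lambda>n. basis (0, n)) :: 'n ser \<Rightarrow> ('m::monoid_add \<times> 'n::monoid_add) ser)"
  by (rule ser_hom_lin_ext) (simp_all add: basis_mult flip: zero_prod_def)

lemma basis_tens_basis [simp]: "basis m \<otimes> basis n = basis (m, n)"
  by (simp add: tens_def basis_mult)

text \<open>The two legs commute, which is what makes pure tensors multiply componentwise.\<close>

lemma inl_inr_commute:
  "lin_ext (\<lambda>n. basis (0, n)) y * lin_ext (\<lambda>m. basis (m, 0)) x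
    = lin_ext (\<lambda>m. basis (m, 0)) x * (lin_ext (\<lambda>n. basis (0, n)) y :: ('m::monoid_add \<times> 'n::monoid_add) ser)"
proof -
  have "lin_ext (\<lambda>n. basis (0, n)) (basis n) * lin_ext (\<lambda>m. basis (m, 0)) x
    = lin_ext (\<lambda>m. basis (m, 0)) x * (lin_ext (\<lambda>n. basis (0, n)) (basis n) :: ('m \<times> 'n) ser)" for n
    by (rule ser_linear_eqI[where x = x, OF ser_linear_mult_left[OF ser_linear_lin_ext]
          ser_linear_mult_right[OF ser_linear_lin_ext]]) (simp add: basis_mult)
  then show ?thesis
    by (intro ser_linear_eqI[where x = y, OF ser_linear_mult_right[OF ser_linear_lin_ext]
          ser_linear_mult_left[OF ser_linear_lin_ext]])
qed

lemma tens_mult: "(x \<otimes> y) * (x' \<otimes> y') = (x * x') \<otimes> (y * y')"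
proof -
  have interchange: "(a * b) * (c * d) = (a * c) * (b * d)" if "b * c = c * b" for a b c d :: "('a \<times> 'b) ser"
    using that by (metis mult.assoc)
  show ?thesis
    unfolding tens_def ser_homD(3)[OF ser_hom_inl] ser_homD(3)[OF ser_hom_inr]
    by (rule interchange[OF inl_inr_commute])
qed

lemma ser_linear_tens_left: "ser_linear (\<lambda>x. x \<otimes> y)"
  unfolding tens_def by (rule ser_linear_mult_right[OF ser_linear_lin_ext])

lemma ser_linear_tens_right: "ser_linear (\<lambda>y. x \<otimes> y)"
  unfolding tens_def by (rule ser_linear_mult_left[OF ser_linear_lin_ext])

lemmas tens_left = ser_linearD[OF ser_linear_tens_left]
lemmas tens_right = ser_linearD[OF ser_linear_tens_right]

lemma one_tens_one [simp]: "1 \<otimes> 1 = 1"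
  by (simp add: tens_def ser_homD[OF ser_hom_inl] ser_homD[OF ser_hom_inr])

lemma ser_hom_tens_one: "ser_hom (\<lambda>x. x \<otimes> 1)"
  by (simp add: ser_hom_def ser_linear_tens_left tens_mult)

lemma ser_hom_one_tens: "ser_hom (\<lambda>y. 1 \<otimes> y)"
  by (simp add: ser_hom_def ser_linear_tens_right tens_mult)

lemma tens_par: "(par_a * x) \<otimes> y = par_a * (x \<otimes> y)" "x \<otimes> (par_a * y) = par_a * (x \<otimes> y)"
  "(par_c * x) \<otimes> y = par_c * (x \<otimes> y)" "x \<otimes> (par_c * y) = par_c * (x \<otimes> y)"
  using ser_linear_par[OF ser_linear_tens_left] ser_linear_par[OF ser_linear_tens_right] by blast+

lemma ser_linear_tens_eqI:
  assumes "ser_linear F" "ser_linear G" "\<And>x y. F (x \<otimes> y) = G (x \<otimes> y)"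
  shows "F z = G z"
proof (rule ser_linear_eqI[where F = F and G = G])
  fix p
  show "F (basis p) = G (basis p)"
    by (cases p) (metis assms(3) basis_tens_basis)
qed (use assms in auto)

text \<open>\<open>lin_ext\<close> sees a bilinear map only on pairs of basis elements. This
  recovers its values on all pure tensors, and thereby those of the flip, the multiplication, the
  tensor product of maps and the contractions with the counit.\<close>

lemma lin_ext_tens:
  assumes left: "\<And>y. ser_linear (\<lambda>x. B x y)" and right: "\<And>x. ser_linear (\<lambda>y. B x y)"
  shows "lin_ext (\<lambda>(m, n). B (basis m) (basis n)) (x \<otimes> y) = B x y"
proof -
  let ?L = "lin_ext (\<lambda>(m, n). B (basis m) (basis n))"
  have "?L (basis m \<otimes> y) = B (basis m) y" for m
    by (rule ser_linear_eqI[where x = y,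
          OF ser_linear_comp[OF ser_linear_lin_ext ser_linear_tens_right] right]) simp
  then show ?thesis
    by (intro ser_linear_eqI[where x = x,
          OF ser_linear_comp[OF ser_linear_lin_ext ser_linear_tens_left] left])
qed

lemma ser_linear_tens_map: "ser_linear (tens_map F G)"
  by (simp add: tens_map_def ser_linear_lin_ext)

lemma tens_map_tens:
  assumes "ser_linear F" "ser_linear G"
  shows "tens_map F G (x \<otimes> y) = F x \<otimes> G y"
  unfolding tens_map_def
  by (rule lin_ext_tens[OF ser_linear_comp[OF ser_linear_tens_left assms(1)]
        ser_linear_comp[OF ser_linear_tens_right assms(2)]])

lemma ser_linear_mult_map: "ser_linear mult_map"
  by (simp add: mult_map_def ser_linear_lin_ext)

lemma mult_map_tens: "mult_map (x \<otimes> y) = x * y"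
  using lin_ext_tens[of "(*)" x y]
  by (simp add: mult_map_def basis_mult ser_linear_mult_left ser_linear_mult_right)

lemma ser_linear_flip: "ser_linear flip"
  by (simp add: flip_def ser_linear_lin_ext)

lemma flip_tens: "flip (x \<otimes> y) = y \<otimes> x"
  using lin_ext_tens[of "\<lambda>x y. y \<otimes> x" x y]
  by (simp add: flip_def ser_linear_tens_left ser_linear_tens_right)

lemma ser_linear_assoc: "ser_linear assoc"
  by (simp add: assoc_def ser_linear_lin_ext)

lemma assoc_tens: "assoc ((x \<otimes> y) \<otimes> z) = x \<otimes> (y \<otimes> z)"
proof -
  have linear: "ser_linear (\<lambda>x. assoc ((x \<otimes> y) \<otimes> z))" "ser_linear (\<lambda>y. assoc ((x \<otimes> y) \<otimes> z))"
    "ser_linear (\<lambda>z. assoc ((x \<otimes> y) \<otimes> z))" for x :: "'a ser" and y :: "'b ser" and z :: "'c ser"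
    by (rule ser_linear_comp[OF ser_linear_assoc ser_linear_comp[OF ser_linear_tens_left ser_linear_tens_left]]
        ser_linear_comp[OF ser_linear_assoc ser_linear_comp[OF ser_linear_tens_left ser_linear_tens_right]]
        ser_linear_comp[OF ser_linear_assoc ser_linear_tens_right])+
  have linear': "ser_linear (\<lambda>x. x \<otimes> (y \<otimes> z))" "ser_linear (\<lambda>y. x \<otimes> (y \<otimes> z))"
    "ser_linear (\<lambda>z. x \<otimes> (y \<otimes> z))" for x :: "'a ser" and y :: "'b ser" and z :: "'c ser"
    by (rule ser_linear_tens_left ser_linear_comp[OF ser_linear_tens_right ser_linear_tens_left]
        ser_linear_comp[OF ser_linear_tens_right ser_linear_tens_right])+
  have "assoc ((basis m \<otimes> basis n) \<otimes> basis p) = basis m \<otimes> (basis n \<otimes> basis p)"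
    for m :: 'a and n :: 'b and p :: 'c
    by (simp add: assoc_def)
  then have "assoc ((basis m \<otimes> basis n) \<otimes> z) = basis m \<otimes> (basis n \<otimes> z)" for m :: 'a and n :: 'b
    by (intro ser_linear_eqI[where x = z, OF linear(3) linear'(3)])
  then have "assoc ((basis m \<otimes> y) \<otimes> z) = basis m \<otimes> (y \<otimes> z)" for m :: 'a
    by (intro ser_linear_eqI[where x = y, OF linear(2) linear'(2)])
  then show ?thesis
    by (intro ser_linear_eqI[where x = x, OF linear(1) linear'(1)])
qed

lemma ser_hom_tensI:
  assumes F: "ser_linear F" and one: "F (1 \<otimes> 1) = 1"
    and mult: "\<And>x y x' y'. F ((x \<otimes> y) * (x' \<otimes> y')) = F (x \<otimes> y) * F (x' \<otimes> y')"
  shows "ser_hom F"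
proof -
  have "F (z * z') = F z * F z'" for z z'
  proof (rule ser_linear_mult_eqI[OF F])
    fix p q
    show "F (basis p * basis q) = F (basis p) * F (basis q)"
      by (cases p; cases q) (metis mult basis_tens_basis)
  qed
  then show ?thesis
    using F one by (simp add: ser_hom_def)
qed

lemma ser_hom_tens_map: "ser_hom F \<Longrightarrow> ser_hom G \<Longrightarrow> ser_hom (tens_map F G)"
  by (rule ser_hom_tensI)
    (simp_all add: ser_linear_tens_map tens_map_tens ser_homD tens_mult del: one_tens_one,
      simp add: one_tens_one)

lemma ser_hom_assoc: "ser_hom assoc"
proof -
  have "assoc 1 = 1"
    using assoc_tens[of 1 1 1] by simp
  moreover have "assoc (z * z') = assoc z * assoc z'" for z z' :: "(('a \<times> 'b) \<times> 'c) ser"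
  proof (rule ser_linear_mult_eqI[OF ser_linear_assoc])
    fix p q :: "('a \<times> 'b) \<times> 'c"
    obtain m n l m' n' l' where "p = ((m, n), l)" "q = ((m', n'), l')"
      by (metis surj_pair)
    then show "assoc (basis p * basis q) = assoc (basis p) * assoc (basis q)"
      by (simp add: assoc_def basis_mult)
  qed
  ultimately show ?thesis
    by (simp add: ser_hom_def ser_linear_assoc)
qed

lemma closed_tens_ideal: "closed_ideal (tens_ideal I J)"
  unfolding tens_ideal_def by (rule closed_ideal_hull)

lemma tens_idealI: "x \<in> I \<Longrightarrow> x \<otimes> 1 \<in> tens_ideal I J" "y \<in> J \<Longrightarrow> 1 \<otimes> y \<in> tens_ideal I J"
  unfolding tens_ideal_def by (auto intro!: hull_inc)

lemma closed_presented_ideal: "closed_ideal (presented_ideal R)"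
  unfolding presented_ideal_def by (rule closed_ideal_hull)

lemma presented_ideal_rel: "(x, y) \<in> R \<Longrightarrow> x - y \<in> presented_ideal R"
  unfolding presented_ideal_def by (rule hull_inc) blast

lemma presented_ideal_subset:
  assumes "closed_ideal J" "\<And>x y. (x, y) \<in> R \<Longrightarrow> x - y \<in> J"
  shows "presented_ideal R \<subseteq> J"
  unfolding presented_ideal_def using assms by (intro hull_minimal) blast+


section \<open>Evaluation of real power series at topologically nilpotent elements\<close>

abbreviation rsc :: "real \<Rightarrow> 'm::monoid_add ser" where "rsc t \<equiv> scal (const2 t)"

lemma rsc_add: "rsc (s + t) = rsc s + rsc t"
  by (simp flip: scal_add)

lemma rsc_mult: "rsc (s * t) = rsc s * rsc t"
  by (simp flip: scal_mult)

lemma rsc_1: "rsc 1 = 1"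
  by simp

lemma rsc_of_nat: "rsc (of_nat n) = of_nat n"
  by (induction n) (simp_all add: rsc_add del: scal_nth)

text \<open>Generalises \<open>sexp\<close> from the exponential to any series, so that logarithms,
  derivatives and the divided series in the quotients are treated alike. The cut-off at i + j loses
  nothing when x lies in \<open>adic 1\<close>.\<close>

definition ev :: "('m::monoid_add) ser \<Rightarrow> real fps \<Rightarrow> 'm ser"
  where "ev x F = Abs_fps (\<lambda>i. Abs_fps (\<lambda>j.
      \<Sum>n\<le>i + j. Poly_Mapping.single 0 (F $ n) * ((x ^ n) $ i $ j)))"

lemma sexp_eq_ev: "sexp x = ev x (fps_exp 1)"
  by (simp add: sexp_def ev_def)

lemma ev_nth:
  assumes "x \<in> adic 1" "i + j \<le> N"
  shows "ev x F $ i $ j = (\<Sum>n\<le>N. Poly_Mapping.single 0 (F $ n) * ((x ^ n) $ i $ j))"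
proof -
  have "(x ^ n) $ i $ j = 0" if "n > i + j" for n
    using adic_power[OF assms(1), of n] that by (simp add: adicD)
  then show ?thesis
    unfolding ev_def using assms(2) by (simp, intro sum.mono_neutral_left) auto
qed

text \<open>Horner's rule. The factor x raises the order by one, which drives the inductions on k.
  Multiplying by x raises the largest power from i + j to i + j + 1; the extra power does not reach
  the coefficient in question.\<close>

lemma ev_unfold:
  assumes x: "x \<in> adic 1"
  shows "ev x F = rsc (F $ 0) + x * ev x (fps_shift 1 F)"
proof (rule ser_eqI)
  fix i j
  let ?G = "fps_shift 1 F"
  have pull: "u * (Poly_Mapping.single 0 t * v) = Poly_Mapping.single 0 t * (u * v)"
    for t and u v :: "'a \<Rightarrow>\<^sub>0 real"
    by (metis mult.assoc single_zero_commute)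
  have "(x * ev x ?G) $ i $ j = (\<Sum>k\<le>i. \<Sum>l\<le>j. \<Sum>n\<le>i + j.
      x $ k $ l * (Poly_Mapping.single 0 (?G $ n) * ((x ^ n) $ (i - k) $ (j - l))))"
    by (simp add: fps2_mult_nth ev_nth[OF x, of _ _ "i + j"] sum_distrib_left)
  also have "\<dots> = (\<Sum>k\<le>i. \<Sum>n\<le>i + j. \<Sum>l\<le>j.
      x $ k $ l * (Poly_Mapping.single 0 (?G $ n) * ((x ^ n) $ (i - k) $ (j - l))))"
    by (intro sum.cong refl sum.swap)
  also have "\<dots> = (\<Sum>n\<le>i + j. \<Sum>k\<le>i. \<Sum>l\<le>j.
      x $ k $ l * (Poly_Mapping.single 0 (?G $ n) * ((x ^ n) $ (i - k) $ (j - l))))"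
    by (rule sum.swap)
  also have "\<dots> = (\<Sum>n\<le>i + j. Poly_Mapping.single 0 (F $ Suc n) * ((x ^ Suc n) $ i $ j))"
    by (simp add: fps2_mult_nth sum_distrib_left pull)
  finally have "(rsc (F $ 0) + x * ev x ?G) $ i $ j
      = (\<Sum>n\<le>Suc (i + j). Poly_Mapping.single 0 (F $ n) * ((x ^ n) $ i $ j))"
    by (subst sum.atMost_Suc_shift) (simp add: fps_one_nth)
  then show "ev x F $ i $ j = (rsc (F $ 0) + x * ev x ?G) $ i $ j"
    by (simp add: ev_nth[OF x, of i j "Suc (i + j)"])
qed

lemma fps_split: "F = fps_const (F $ 0) + fps_X * fps_shift 1 F" for F :: "'a::comm_ring_1 fps"
proof (rule fps_ext)
  fix n
  show "F $ n = (fps_const (F $ 0) + fps_X * fps_shift 1 F) $ n"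
    by (cases n) simp_all
qed

text \<open>By \<open>ev_unfold\<close>, the following statements hold up to \<open>adic k\<close> by induction on \<open>k\<close>.\<close>

lemma ev_add:
  assumes x: "x \<in> adic 1"
  shows "ev x (F + G) = ev x F + ev x G"
proof (rule eq_if_adic)
  fix k
  show "ev x (F + G) - (ev x F + ev x G) \<in> adic k"
  proof (induction k arbitrary: F G)
    case (Suc k)
    let ?F = "fps_shift 1 F" and ?G = "fps_shift 1 G"
    have "ev x (F + G) - (ev x F + ev x G) = x * (ev x (?F + ?G) - (ev x ?F + ev x ?G))"
      by (subst (1 2 3) ev_unfold[OF x])
        (simp add: algebra_simps rsc_add fps_shift_add del: fps_const_add)
    then show ?case
      using adic_mult[OF x Suc.IH] by simp
  qed simp
qed

lemma ev_mult:
  assumes x: "x \<in> adic 1"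
  shows "ev x (F * G) = ev x F * ev x G"
proof (rule eq_if_adic)
  fix k
  have const: "ev x (fps_const t * G) = rsc t * ev x G" for t G
    by (rule ser_eqI) (simp add: ev_def scal_const2 sum_distrib_left mult_single flip: mult.assoc)
  show "ev x (F * G) - ev x F * ev x G \<in> adic k"
  proof (induction k arbitrary: F)
    case (Suc k)
    let ?F = "fps_shift 1 F"
    have "F * G = fps_const (F $ 0) * G + fps_X * (?F * G)"
      by (subst fps_split[of F]) (simp only: distrib_right mult.assoc)
    moreover have "ev x (fps_X * H) = x * ev x H" for H
    proof -
      have "fps_shift 1 (fps_X * H) = H"
        by (simp add: fps_eq_iff)
      then show ?thesis
        by (subst ev_unfold[OF x]) simp
    qed
    ultimately have "ev x (F * G) = rsc (F $ 0) * ev x G + x * ev x (?F * G)"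
      by (simp add: ev_add[OF x] const)
    then have "ev x (F * G) - ev x F * ev x G = x * (ev x (?F * G) - ev x ?F * ev x G)"
      by (subst (2) ev_unfold[OF x]) (simp add: algebra_simps)
    then show ?case
      using adic_mult[OF x Suc.IH] by simp
  qed simp
qed

lemma ev_0 [simp]: "ev x 0 = 0"
  by (rule ser_eqI) (simp add: ev_def)

lemma ev_const: "x \<in> adic 1 \<Longrightarrow> ev x (fps_const t) = rsc t"
  by (subst ev_unfold) (auto simp: fps_shift_fps_const)

lemma ev_1: "x \<in> adic 1 \<Longrightarrow> ev x 1 = 1"
  using ev_const[of x 1] by simp

lemma ev_X: "x \<in> adic 1 \<Longrightarrow> ev x fps_X = x"
  by (subst ev_unfold) (auto simp: ev_1)

lemma ev_commute: "x \<in> adic 1 \<Longrightarrow> ev x F * ev x G = ev x G * ev x F"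
  by (metis ev_mult mult.commute)

lemma ev_adic: "x \<in> adic 1 \<Longrightarrow> F $ 0 = 0 \<Longrightarrow> ev x F \<in> adic 1"
  by (subst ev_unfold) (auto intro: adic_mult_right)

text \<open>Multiplicativity is demanded on commuting pairs only, where homomorphisms and
  anti-homomorphisms behave alike; both are instances.\<close>

lemma linear_image_ev:
  assumes \<Phi>: "ser_linear \<Phi>" "\<Phi> 1 = 1" and mult: "\<And>y z. y * z = z * y \<Longrightarrow> \<Phi> (y * z) = \<Phi> y * \<Phi> z"
    and x: "x \<in> adic 1"
  shows "\<Phi> (ev x F) = ev (\<Phi> x) F"
proof (rule eq_if_adic)
  fix k
  have \<Phi>x: "\<Phi> x \<in> adic 1"
    using ser_linear_adic[OF \<Phi>(1) x] .
  have mult_x: "\<Phi> (x * ev x G) = \<Phi> x * \<Phi> (ev x G)" for G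
    using mult[of x "ev x G"] ev_commute[OF x, of fps_X G] by (simp add: ev_X[OF x])
  have scal: "\<Phi> (scal s) = scal s" for s
    using ser_linearD(6)[OF \<Phi>(1), of s 1] \<Phi>(2) by simp
  show "\<Phi> (ev x F) - ev (\<Phi> x) F \<in> adic k"
  proof (induction k arbitrary: F)
    case (Suc k)
    let ?F = "fps_shift 1 F"
    have "\<Phi> (ev x F) - ev (\<Phi> x) F = \<Phi> x * (\<Phi> (ev x ?F) - ev (\<Phi> x) ?F)"
      by (subst ev_unfold[OF x], subst ev_unfold[OF \<Phi>x])
        (simp only: ser_linearD(1)[OF \<Phi>(1)] mult_x scal right_diff_distrib add_diff_cancel_left)
    then show ?case
      using adic_mult[OF \<Phi>x Suc.IH] by simp
  qed simp
qed

lemma ser_hom_ev: "ser_hom \<Phi> \<Longrightarrow> x \<in> adic 1 \<Longrightarrow> \<Phi> (ev x F) = ev (\<Phi> x) F"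
  by (rule linear_image_ev[OF ser_homD(1-3)])

text \<open>Horner's rule for F at \<open>ev x G\<close> matches F oo G = F(0) + G (F1 oo G), F1
  being the shifted F. Identities such as exp (ln (1 + X)) = 1 + X thus transfer from real series to
  the algebra.\<close>

lemma ev_compose:
  assumes x: "x \<in> adic 1" and G: "G $ 0 = 0"
  shows "ev (ev x G) F = ev x (F oo G)"
proof (rule eq_if_adic)
  fix k
  have y: "ev x G \<in> adic 1"
    by (rule ev_adic[OF x G])
  show "ev (ev x G) F - ev x (F oo G) \<in> adic k"
  proof (induction k arbitrary: F)
    case (Suc k)
    let ?F = "fps_shift 1 F"
    have "F oo G = (fps_const (F $ 0) + fps_X * ?F) oo G"
      by (subst fps_split[of F]) (rule refl)
    also have "\<dots> = fps_const (F $ 0) + G * (?F oo G)"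
      by (simp add: fps_compose_add_distrib fps_compose_mult_distrib G mult.commute)
    finally have "ev x (F oo G) = rsc (F $ 0) + ev x G * ev x (?F oo G)"
      by (simp add: ev_add[OF x] ev_mult[OF x] ev_const[OF x])
    then have "ev (ev x G) F - ev x (F oo G) = ev x G * (ev (ev x G) ?F - ev x (?F oo G))"
      by (subst ev_unfold[OF y]) (simp add: algebra_simps)
    then show ?case
      using adic_mult[OF y Suc.IH] by simp
  qed simp
qed

lemma sexp_rsc_mult:
  assumes "x \<in> adic 1"
  shows "sexp (rsc t * x) = ev x (fps_exp t)"
proof -
  have "rsc t * x = ev x (fps_const t * fps_X)"
    by (simp add: ev_mult[OF assms] ev_const[OF assms] ev_X[OF assms])
  then show ?thesis
    by (simp add: sexp_eq_ev ev_compose[OF assms])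
qed

text \<open>The hypotheses say that \<open>ad x\<close> maps \<open>y\<close> to \<open>d\<close>, \<open>d\<close> to \<open>w\<close> and \<open>w\<close> to \<open>0\<close>, so the Taylor
  expansion of \<open>F(x) y\<close> stops after three terms.\<close>

lemma ev_commutation:
  assumes J: "closed_ideal J" and x: "x \<in> adic 1"
    and y: "x * y - (y * x + d) \<in> J" and d: "x * d - (d * x + w) \<in> J" and w: "x * w - w * x \<in> J"
  shows "ev x F * y - (y * ev x F + d * ev x (fps_deriv F)
    + rsc (1 / 2) * w * ev x (fps_deriv (fps_deriv F))) \<in> J"
proof (rule closed_ideal_closed[OF J])
  define T where "T F = ev x F * y - (y * ev x F + d * ev x (fps_deriv F)
    + rsc (1 / 2) * w * ev x (fps_deriv (fps_deriv F)))" for F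
  have T_add: "T (F + G) = T F + T G" for F G
    by (simp add: T_def ev_add[OF x] algebra_simps)
  have T_const: "T (fps_const t) = 0" for t
    by (simp add: T_def ev_const[OF x] scal_commute)
  \<comment> \<open>T measures the failure of the expansion. Modulo J it satisfies T (X G) = x T G,
    and it kills constants; hence T F is x times the defect of the shifted series, one order
    smaller.\<close>
  have T_X: "T (fps_X * G) - x * T G \<in> J" for G
  proof -
    let ?G = "ev x G" and ?G' = "ev x (fps_deriv G)" and ?G'' = "ev x (fps_deriv (fps_deriv G))"
    have eqs: "ev x (fps_X * G) = x * ?G" "ev x (fps_deriv (fps_X * G)) = ?G + x * ?G'"
      "ev x (fps_deriv (fps_deriv (fps_X * G))) = ?G' + ?G' + x * ?G''"
    proof -
      have "fps_deriv (fps_X * G) = G + fps_X * fps_deriv G"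
        "fps_deriv (fps_deriv (fps_X * G)) = fps_deriv G + fps_deriv G + fps_X * fps_deriv (fps_deriv G)"
        by (simp_all add: algebra_simps)
      then show "ev x (fps_X * G) = x * ?G" "ev x (fps_deriv (fps_X * G)) = ?G + x * ?G'"
        "ev x (fps_deriv (fps_deriv (fps_X * G))) = ?G' + ?G' + x * ?G''"
        by (simp_all only: ev_add[OF x] ev_mult[OF x] ev_X[OF x])
    qed
    obtain h :: "'a ser" where h: "h = rsc (1 / 2)" and "h + h = 1"
      and x_h: "x * (h * z) = h * (x * z)" for z
    proof (rule that)
      show "rsc (1 / 2) + rsc (1 / 2) = (1 :: 'a ser)"
        unfolding rsc_add[symmetric] by simp
      show "x * (rsc (1 / 2) * z) = rsc (1 / 2) * (x * z)" for z
        by (metis mult.assoc scal_commute)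
    qed simp
    \<comment> \<open>The second derivative of X G is 2 G' + X G''. The 2 cancels the factor 1/2 and
      leaves the summand w G' required by the commutator of x and d.\<close>
    have "h * w * (z + z + u) = w * z + h * w * u" for z u
    proof -
      have "h * w * (z + z + u) = (h + h) * (w * z) + h * w * u"
        by (simp only: distrib_left distrib_right mult.assoc)
      then show ?thesis
        by (simp add: \<open>h + h = 1\<close>)
    qed
    then have "T (fps_X * G) - x * T G = (x * y - (y * x + d)) * ?G + (x * d - (d * x + w)) * ?G'
        + h * ((x * w - w * x) * ?G'')"
      unfolding T_def eqs by (simp add: x_h algebra_simps flip: h)
    then show ?thesis
      using closed_idealD(2)[OF J closed_idealD(2)[OF J closed_idealD(4)[OF J y] closed_idealD(4)[OF J d]]
          closed_idealD(3)[OF J closed_idealD(4)[OF J w]]] by simp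
  qed
  fix k
  have "\<exists>z\<in>J. T F - z \<in> adic k" for F
  proof (induction k arbitrary: F)
    case 0
    then show ?case
      using closed_idealD(1)[OF J] by auto
  next
    case (Suc k)
    let ?F = "fps_shift 1 F"
    obtain z where z: "z \<in> J" "T ?F - z \<in> adic k"
      using Suc.IH by blast
    have "F = fps_const (F $ 0) + fps_X * ?F"
      by (rule fps_split)
    then have "T F = T (fps_X * ?F)"
      by (metis T_add T_const add_0)
    then have "T F - (T (fps_X * ?F) - x * T ?F + x * z) = x * (T ?F - z)"
      by (simp add: algebra_simps)
    moreover have "T (fps_X * ?F) - x * T ?F + x * z \<in> J"
      by (rule closed_idealD(2)[OF J T_X closed_idealD(3)[OF J z(1)]])
    ultimately show ?case
      using adic_mult[OF x z(2)] by (metis plus_1_eq_Suc)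
  qed
  then show "\<exists>z\<in>J. ev x F * y - (y * ev x F + d * ev x (fps_deriv F)
    + rsc (1 / 2) * w * ev x (fps_deriv (fps_deriv F))) - z \<in> adic k"
    by (simp add: T_def)
qed

lemma ev_central:
  assumes J: "closed_ideal J" and x: "x \<in> adic 1" and comm: "\<And>y. x * y - y * x \<in> J"
  shows "ev x F * y - y * ev x F \<in> J"
  using ev_commutation[OF J x, of y 0 0 F] comm[of y] by (simp add: closed_idealD(1)[OF J])

text \<open>The commutator with z is a derivation, so its values on words are generated by those on
  letters.\<close>

lemma central_if_gen_central:
  assumes J: "closed_ideal J" and gen: "\<And>g. z * gen g - gen g * z \<in> J"
  shows "z * x - x * z \<in> J"
proof (rule ser_linear_in_closed_ideal[OF _ J, where F = "\<lambda>x. z * x - x * z"])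
  show "ser_linear (\<lambda>x. z * x - x * z)"
    by (intro ser_linear_diff ser_linear_mult_left ser_linear_mult_right ser_linear_id(1))
  fix w
  show "z * basis w - basis w * z \<in> J"
  proof (induction w)
    case (Cons g w)
    have "z * basis (g # w) - basis (g # w) * z
        = (z * gen g - gen g * z) * basis w + gen g * (z * basis w - basis w * z)"
      by (simp add: algebra_simps flip: gen_mult_basis)
    then show ?case
      using closed_idealD(2)[OF J closed_idealD(4)[OF J gen] closed_idealD(3)[OF J Cons.IH]] by simp
  qed (simp add: closed_idealD(1)[OF J])
qed

section \<open>The exponential of a sum of commuting elements\<close>

lemma power_add_commuting:
  fixes x y :: "'a::ring_1"
  assumes "x * y = y * x"
  shows "(x + y) ^ n = (\<Sum>k\<le>n. of_nat (n choose k) * (x ^ k * y ^ (n - k)))"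
proof (induction n)
  case (Suc n)
  let ?g = "\<lambda>k. x ^ k * y ^ (Suc n - k)"
  have pull: "z * (of_nat c * z') = of_nat c * (z * z')" for c and z z' :: 'a
    by (simp only: mult.assoc[symmetric] mult_of_nat_commute[of c z])
  have x_mult: "x * (of_nat c * (x ^ k * y ^ (n - k))) = of_nat c * ?g (Suc k)" for c k
    unfolding pull by (simp add: mult.assoc)
  have y_mult: "y * (of_nat c * (x ^ k * y ^ (n - k))) = of_nat c * ?g k" if "k \<le> n" for c k
  proof -
    have "y * (x ^ k * z) = x ^ k * (y * z)" for z
      unfolding mult.assoc[symmetric] power_commuting_commutes[OF assms] ..
    then show ?thesis
      unfolding pull using that by (simp add: Suc_diff_le)
  qed
  have "(\<Sum>k\<le>n. of_nat (n choose k) * ?g k) = (\<Sum>k\<le>Suc n. of_nat (n choose k) * ?g k)"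
    by (simp add: binomial_eq_0)
  also have "\<dots> = ?g 0 + (\<Sum>k\<le>n. of_nat (n choose Suc k) * ?g (Suc k))"
    by (subst sum.atMost_Suc_shift) simp
  finally have shift: "(\<Sum>k\<le>n. of_nat (n choose k) * ?g k)
      = ?g 0 + (\<Sum>k\<le>n. of_nat (n choose Suc k) * ?g (Suc k))" .
  have "(x + y) ^ Suc n = x * (\<Sum>k\<le>n. of_nat (n choose k) * (x ^ k * y ^ (n - k)))
      + y * (\<Sum>k\<le>n. of_nat (n choose k) * (x ^ k * y ^ (n - k)))"
    by (simp add: Suc.IH distrib_right)
  also have "\<dots> = (\<Sum>k\<le>n. of_nat (n choose k) * ?g (Suc k)) + (\<Sum>k\<le>n. of_nat (n choose k) * ?g k)"
    unfolding sum_distrib_left x_mult using y_mult by (intro arg_cong2[where f = "(+)"] sum.cong) auto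
  also have "\<dots> = (\<Sum>k\<le>n. of_nat (n choose k) * ?g (Suc k))
      + (?g 0 + (\<Sum>k\<le>n. of_nat (n choose Suc k) * ?g (Suc k)))"
    by (simp only: shift)
  also have "\<dots> = ?g 0 + (\<Sum>k\<le>n. of_nat (Suc n choose Suc k) * ?g (Suc k))"
    by (simp add: sum.distrib distrib_right add.left_commute)
  also have "\<dots> = (\<Sum>k\<le>Suc n. of_nat (Suc n choose k) * ?g k)"
    by (subst sum.atMost_Suc_shift) simp
  finally show ?case .
qed simp

lemma sexp_nth:
  assumes "x \<in> adic 1" "i + j \<le> N"
  shows "sexp x $ i $ j = (\<Sum>n\<le>N. Poly_Mapping.single 0 (1 / fact n) * ((x ^ n) $ i $ j))"
  unfolding sexp_eq_ev by (subst ev_nth[OF assms]) simp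

lemma sexp_trunc:
  assumes "x \<in> adic 1"
  shows "sexp x - (\<Sum>n<N. rsc (1 / fact n) * x ^ n) \<in> adic N"
  unfolding adic_def
proof (intro CollectI allI impI)
  fix i j assume "i + j < N"
  then obtain N' where "N = Suc N'" "i + j \<le> N'"
    by (cases N) auto
  then show "(sexp x - (\<Sum>n<N. rsc (1 / fact n) * x ^ n)) $ i $ j = 0"
    by (simp add: sexp_nth[OF assms] fps_sum_nth scal_const2 lessThan_Suc_atMost)
qed

text \<open>As two different elements are involved, \<open>ev_mult\<close> does not apply and
  partial sums are compared. The product of two partial sums runs over a square, that of the sum
  over the triangle i + j < N; the remaining terms contain x^i y^j with i + j \<ge> N and have order
  N.\<close>

lemma sexp_add:
  assumes x: "x \<in> adic 1" and y: "y \<in> adic 1" and comm: "x * y = y * x"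
  shows "sexp (x + y) = sexp x * sexp y"
proof (rule eq_if_adic)
  fix N
  let ?x = "\<lambda>n. rsc (1 / fact n) * x ^ n" and ?y = "\<lambda>n. rsc (1 / fact n) * y ^ n"
  let ?X = "\<Sum>n<N. ?x n" and ?Y = "\<Sum>n<N. ?y n" and ?T = "{(i, j). i + j < N}"
  have term_eq: "rsc (1 / fact n) * (of_nat (n choose k) * (x ^ k * y ^ (n - k))) = ?x k * ?y (n - k)"
    if "k \<le> n" for n k
  proof -
    have "1 / fact n * real (n choose k) = 1 / fact k * (1 / fact (n - k))"
      using that by (simp add: binomial_fact)
    then have *: "rsc (1 / fact n) * of_nat (n choose k) = rsc (1 / fact k) * (rsc (1 / fact (n - k)) :: 'a ser)"
      by (simp only: flip: rsc_of_nat rsc_mult)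
    have "rsc (1 / fact n) * (of_nat (n choose k) * (x ^ k * y ^ (n - k)))
        = rsc (1 / fact k) * (rsc (1 / fact (n - k)) * x ^ k) * y ^ (n - k)"
      unfolding mult.assoc[of "rsc (1 / fact n)", symmetric] * by (simp only: mult.assoc)
    also have "\<dots> = ?x k * ?y (n - k)"
      unfolding scal_commute[of "const2 (1 / fact (n - k))" "x ^ k"] by (simp only: mult.assoc)
    finally show ?thesis .
  qed
  have "(\<Sum>n<N. rsc (1 / fact n) * (x + y) ^ n) = (\<Sum>n<N. \<Sum>k\<le>n. ?x k * ?y (n - k))"
    by (simp add: power_add_commuting[OF comm] sum_distrib_left term_eq)
  also have "\<dots> = (\<Sum>(i, j)\<in>?T. ?x i * ?y j)"
    by (rule sum.triangle_reindex[symmetric])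
  finally have sum: "(\<Sum>n<N. rsc (1 / fact n) * (x + y) ^ n) = (\<Sum>(i, j)\<in>?T. ?x i * ?y j)" .
  have "?X * ?Y = (\<Sum>(i, j)\<in>{..<N} \<times> {..<N}. ?x i * ?y j)"
    by (simp add: sum_product sum.cartesian_product)
  also have "\<dots> = (\<Sum>(i, j)\<in>?T. ?x i * ?y j) + (\<Sum>(i, j)\<in>{..<N} \<times> {..<N} - ?T. ?x i * ?y j)"
    by (subst add.commute, intro sum.subset_diff) auto
  finally have "?X * ?Y - (\<Sum>n<N. rsc (1 / fact n) * (x + y) ^ n)
      = (\<Sum>(i, j)\<in>{..<N} \<times> {..<N} - ?T. ?x i * ?y j)"
    by (simp add: sum)
  also have "\<dots> \<in> adic N"
  proof (rule adic_sum)
    fix p assume p: "p \<in> {..<N} \<times> {..<N} - ?T"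
    obtain i j where ij: "p = (i, j)"
      by (cases p)
    have "?x i * ?y j \<in> adic N"
      by (rule adic_mono[OF adic_mult[OF adic_mult_left[OF adic_power[OF x]] adic_mult_left[OF adic_power[OF y]]]])
        (use p ij in auto)
    then show "(case p of (i, j) \<Rightarrow> ?x i * ?y j) \<in> adic N"
      by (simp add: ij)
  qed
  finally have XY: "?X * ?Y - (\<Sum>n<N. rsc (1 / fact n) * (x + y) ^ n) \<in> adic N" .
  have "sexp (x + y) - sexp x * sexp y = (sexp (x + y) - (\<Sum>n<N. rsc (1 / fact n) * (x + y) ^ n))
      - ((sexp x - ?X) * sexp y + ?X * (sexp y - ?Y)
          + (?X * ?Y - (\<Sum>n<N. rsc (1 / fact n) * (x + y) ^ n)))"
    by (simp add: algebra_simps)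
  also have "\<dots> \<in> adic N"
    by (intro adic_diff adic_add adic_mult_left adic_mult_right sexp_trunc x y XY adic_add)
  finally show "sexp (x + y) - sexp x * sexp y \<in> adic N" .
qed

section \<open>Division by the parameters\<close>

lemma quot_eqI: "p * y = x \<Longrightarrow> (\<And>z. p * z = 0 \<Longrightarrow> z = 0) \<Longrightarrow> quot x p = y"
  unfolding quot_def
proof (rule the_equality)
  fix y' assume "p * y = x" and cancel: "\<And>z. p * z = 0 \<Longrightarrow> z = 0" and "p * y' = x"
  then have "p * (y' - y) = 0"
    by (simp add: right_diff_distrib)
  then show "y' = y"
    using cancel by fastforce
qed

lemma par_a_cancel: "par_a * z = 0 \<Longrightarrow> z = 0"
  and two_par_c_cancel: "2 * par_c * z = 0 \<Longrightarrow> z = 0" for z :: "'m::monoid_add ser"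
proof -
  show "z = 0" if "par_a * z = 0"
  proof (rule ser_eqI)
    fix i j
    show "z $ i $ j = 0 $ i $ j"
      using arg_cong[OF that, of "\<lambda>x. x $ Suc i $ j"] by simp
  qed
  show "z = 0" if "2 * par_c * z = 0"
  proof (rule ser_eqI)
    fix i j
    \<comment> \<open>The 2 is inverted as a real scalar, which leaves a shift in c.\<close>
    have "par_c * z = rsc (1 / 2) * (2 * par_c * z)"
    proof -
      have "rsc (1 / 2) * 2 = (1 :: 'm ser)"
        using rsc_mult[of "1 / 2" "of_nat 2", where 'a = 'm] unfolding rsc_of_nat by simp
      then show ?thesis
        by (simp flip: mult.assoc)
    qed
    then have "par_c * z = 0"
      using that by simp
    show "z $ i $ j = 0 $ i $ j"
      using arg_cong[OF \<open>par_c * z = 0\<close>, of "\<lambda>x. x $ i $ Suc j"] by simp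
  qed
qed


section \<open>The augmentation of the free algebra\<close>

definition counit :: "'g list ser \<Rightarrow> scalar"
  where "counit x = Abs_fps (\<lambda>i. Abs_fps (\<lambda>j. Poly_Mapping.lookup (x $ i $ j) []))"

lemma scal_eq_iff [simp]: "scal s = scal t \<longleftrightarrow> s = t"
proof
  assume eq: "scal s = (scal t :: 'a ser)"
  have "Poly_Mapping.lookup (scal s $ i $ j :: 'a \<Rightarrow>\<^sub>0 real) 0 = Poly_Mapping.lookup (scal t $ i $ j) (0 :: 'a)" for i j
    by (simp only: eq)
  then show "s = t"
    by (auto intro!: ser_eqI)
qed simp

text \<open>The counit has values in the scalars, whereas the lemmas on linear maps concern series
  algebras; they are applied to \<open>scal (counit x)\<close>, and injectivity of
  \<open>scal\<close> brings the results back.\<close>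

lemma ser_linear_counit: "ser_linear (\<lambda>x. scal (counit x) :: ('m::monoid_add) ser)"
proof (rule ser_linearI)
  fix x y :: "'a list ser" and t
  show "scal (counit (x + y)) = scal (counit x) + (scal (counit y) :: 'm ser)"
    by (simp add: counit_def lookup_add fps_eq_iff flip: scal_add)
  show "scal (counit (par_a * x)) = par_a * (scal (counit x) :: 'm ser)"
    by (rule ser_eqI) (simp add: counit_def)
  show "scal (counit (par_c * x)) = par_c * (scal (counit x) :: 'm ser)"
    by (rule ser_eqI) (simp add: counit_def)
  show "scal (counit (const2 (Poly_Mapping.single 0 t) * x))
      = const2 (Poly_Mapping.single 0 t) * (scal (counit x) :: 'm ser)"
    by (rule ser_eqI)
      (simp add: counit_def lookup_single_zero_mult mult_single flip: zero_list_def)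
qed

lemma scal_counit: "scal (counit x) = (free_hom (\<lambda>_. 0) x :: ('m::monoid_add) ser)"
proof (rule ser_linear_eqI[where x = x, OF ser_linear_counit ser_homD(1)[OF ser_hom_free_hom]])
  fix w :: "'a list"
  have "counit (basis w) = (if w = [] then 1 else 0)"
    by (rule ser_eqI) (simp add: counit_def basis_def lookup_single when_def fps_one_nth)
  then show "scal (counit (basis w)) = (free_hom (\<lambda>_. 0) (basis w) :: 'm ser)"
    using lin_ext_basis[of "\<lambda>w. prod_list (map (\<lambda>_. 0) w)" w] by (cases w) (simp_all add: free_hom_def)
qed

lemma ser_character_counit: "ser_character counit"
proof -
  note hom = ser_homD[OF ser_hom_free_hom, of "\<lambda>_. 0"]
  have "counit (x + y) = counit x + counit y" "counit (s \<odot> x) = s * counit x"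
    "counit 1 = 1" "counit (x * y) = counit x * counit y" for x y :: "'a list ser" and s
    unfolding scal_eq_iff[where 'a = "'a list", symmetric] scal_add scal_mult scal_counit
    by (simp_all add: hom ser_linearD[OF hom(1)] smult_def ser_hom_scal[OF ser_hom_free_hom])
  then show ?thesis
    by (simp add: ser_character_def)
qed

lemma counit_gen [simp]: "counit (gen g) = 0"
  unfolding scal_eq_iff[where 'a = "'a list", symmetric] scal_counit by simp

lemma counit_1 [simp]: "counit 1 = 1"
  by (rule ser_character_counit[unfolded ser_character_def, THEN conjunct2, THEN conjunct2, THEN conjunct1])


section \<open>Exponentials\<close>

lemma scal_left_commute: "z * (scal s * u) = scal s * (z * u)"
  by (simp only: mult.assoc[symmetric] scal_commute[of s z])

lemma rsc_uminus: "rsc (- t) = - rsc t"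
  by (simp flip: scal_uminus)

lemma rsc_numeral: "rsc (numeral n) = numeral n"
  using rsc_of_nat[of "numeral n"] by simp

text \<open>This is exp (t x), with the real number t kept apart so that products of exponentials
  reduce to addition of real numbers.\<close>

definition pexp :: "('m::monoid_add) ser \<Rightarrow> real \<Rightarrow> 'm ser"
  where "pexp x t = ev x (fps_exp t)"

lemma sexp_eq_pexp: "x \<in> adic 1 \<Longrightarrow> sexp (rsc t * x) = pexp x t"
  by (simp add: pexp_def sexp_rsc_mult)

lemma pexp_mult: "x \<in> adic 1 \<Longrightarrow> pexp x s * pexp x t = pexp x (s + t)"
  by (simp add: pexp_def ev_mult[symmetric] fps_exp_add_mult)

lemma pexp_0: "x \<in> adic 1 \<Longrightarrow> pexp x 0 = 1"
  by (simp add: pexp_def ev_1)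

lemma pexp_add:
  assumes "x \<in> adic 1" "y \<in> adic 1" "x * y = y * x"
  shows "pexp (x + y) t = pexp x t * pexp y t"
proof -
  have "rsc t * x * (rsc t * y) = rsc t * y * (rsc t * x)"
    unfolding mult.assoc scal_left_commute[of x] scal_left_commute[of y] assms(3) ..
  then show ?thesis
    using assms by (simp add: sexp_add adic_mult_left adic_add distrib_left flip: sexp_eq_pexp)
qed

lemma ser_hom_pexp: "ser_hom \<Phi> \<Longrightarrow> x \<in> adic 1 \<Longrightarrow> \<Phi> (pexp x t) = pexp (\<Phi> x) t"
  by (simp add: pexp_def ser_hom_ev)

lemma pexp_uminus: "x \<in> adic 1 \<Longrightarrow> pexp (- x) t = pexp x (- t)"
  using sexp_eq_pexp[of "- x" t] sexp_eq_pexp[of x "- t"] by (simp add: adic_uminus rsc_uminus)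

lemma free_antihom_pexp:
  assumes x: "x \<in> adic 1"
  shows "free_antihom f (pexp x t) = pexp (free_antihom f x) t"
  unfolding pexp_def
proof (rule linear_image_ev[OF ser_linear_free_antihom free_antihom_1 _ x])
  show "free_antihom f (y * z) = free_antihom f y * free_antihom f z" if "y * z = z * y" for y z
    unfolding that by (rule free_antihom_mult)
qed

text \<open>The two summands commute, so the exponential of the sum factors. For x = y this says
  that exponentials of primitive elements are group-like.\<close>

lemma pexp_tens:
  assumes "x \<in> adic 1" "y \<in> adic 1"
  shows "pexp (1 \<otimes> y + x \<otimes> 1) t = pexp x t \<otimes> pexp y t"
proof -
  have "pexp (1 \<otimes> y + x \<otimes> 1) t = pexp (1 \<otimes> y) t * pexp (x \<otimes> 1) t"
    by (rule pexp_add[OF ser_linear_adic[OF ser_linear_tens_right assms(2)]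
          ser_linear_adic[OF ser_linear_tens_left assms(1)]]) (simp add: tens_mult)
  also have "\<dots> = (1 \<otimes> pexp y t) * (pexp x t \<otimes> 1)"
    by (simp add: ser_hom_pexp[OF ser_hom_tens_one assms(1)] ser_hom_pexp[OF ser_hom_one_tens assms(2)])
  finally show ?thesis
    by (simp add: tens_mult)
qed

lemma pexp_zero: "pexp 0 t = 1"
  by (metis sexp_eq_pexp pexp_0 mult_zero_right zero_in_adic)

section \<open>The Hopf algebra structure before imposing the relations\<close>

lemma aH_adic: "par_a * H\<^sub>q \<in> adic 1" and cM_adic: "par_c * M\<^sub>q \<in> adic 1"
  by (rule adic_mult_right[OF par_a_adic] adic_mult_right[OF par_c_adic])+

abbreviation expH :: "real \<Rightarrow> sgen list ser" where "expH \<equiv> pexp (par_a * H\<^sub>q)"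
abbreviation expM :: "real \<Rightarrow> sgen list ser" where "expM \<equiv> pexp (par_c * M\<^sub>q)"

lemma sexp_eq_exps:
  "sexp (- 2 * par_a * H\<^sub>q) = expH (- 2)" "sexp (par_a * H\<^sub>q) = expH 1"
  "sexp (- par_a * H\<^sub>q) = expH (- 1)" "sexp (- par_c * M\<^sub>q) = expM (- 1)"
  "sexp (- 2 * par_c * M\<^sub>q) = expM (- 2)"
  using sexp_eq_pexp[OF aH_adic, of "- 2"] sexp_eq_pexp[OF aH_adic, of 1]
    sexp_eq_pexp[OF aH_adic, of "- 1"] sexp_eq_pexp[OF cM_adic, of "- 1"]
    sexp_eq_pexp[OF cM_adic, of "- 2"]
  unfolding rsc_uminus rsc_numeral rsc_1 by (simp_all add: mult.assoc del: fps_const_neg)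

fun coprod_gen :: "sgen \<Rightarrow> (sgen list \<times> sgen list) ser" where
  "coprod_gen Hg = 1 \<otimes> H\<^sub>q + H\<^sub>q \<otimes> 1"
| "coprod_gen Mg = 1 \<otimes> M\<^sub>q + M\<^sub>q \<otimes> 1"
| "coprod_gen Dg = 1 \<otimes> D\<^sub>q + D\<^sub>q \<otimes> expH (- 2)"
| "coprod_gen Cg = 1 \<otimes> C\<^sub>q + C\<^sub>q \<otimes> expH (- 2)"
| "coprod_gen Pg = 1 \<otimes> P\<^sub>q + P\<^sub>q \<otimes> (expH 1 * expM (- 1))"
| "coprod_gen Kg = 1 \<otimes> K\<^sub>q + K\<^sub>q \<otimes> (expH (- 1) * expM (- 1)) + (par_a * D\<^sub>q) \<otimes> (expH (- 2) * P\<^sub>q)"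

definition coprod :: "sgen list ser \<Rightarrow> (sgen list \<times> sgen list) ser"
  where "coprod = free_hom coprod_gen"

text \<open>Solved from the left antipode axiom on generators. For K, the value on D turns the axiom
  into K + S(K) exp (-a H) exp (-c M) - a D P = 0.\<close>

fun antipode_gen :: "sgen \<Rightarrow> sgen list ser" where
  "antipode_gen Hg = - H\<^sub>q"
| "antipode_gen Mg = - M\<^sub>q"
| "antipode_gen Dg = - D\<^sub>q * expH 2"
| "antipode_gen Cg = - C\<^sub>q * expH 2"
| "antipode_gen Pg = - P\<^sub>q * (expM 1 * expH (- 1))"
| "antipode_gen Kg = (par_a * D\<^sub>q * P\<^sub>q - K\<^sub>q) * (expM 1 * expH 1)"

definition antipode :: "sgen list ser \<Rightarrow> sgen list ser"
  where "antipode = free_antihom antipode_gen"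

lemma ser_hom_coprod: "ser_hom coprod"
  unfolding coprod_def by (rule ser_hom_free_hom)

lemma coprod_gen_eq [simp]: "coprod (gen X) = coprod_gen X"
  by (simp add: coprod_def)

lemma ser_linear_antipode: "ser_linear antipode"
  unfolding antipode_def by (rule ser_linear_free_antihom)

lemma antipode_gen_eq [simp]: "antipode (gen X) = antipode_gen X"
  by (simp add: antipode_def)

lemma antipode_1 [simp]: "antipode 1 = 1"
  by (simp add: antipode_def)

lemma antipode_mult: "antipode (x * y) = antipode y * antipode x"
  by (simp add: antipode_def free_antihom_mult)

lemmas coprod_linearD = ser_hom_linearD[OF ser_hom_coprod]
lemmas coprod_homD = ser_homD[OF ser_hom_coprod]
lemmas coprod_par = ser_hom_par[OF ser_hom_coprod]
lemmas antipode_linearD = ser_linearD[OF ser_linear_antipode]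
lemmas antipode_par = ser_linear_par[OF ser_linear_antipode]

lemma coprod_exp: "coprod (expH t) = expH t \<otimes> expH t" "coprod (expM t) = expM t \<otimes> expM t"
proof -
  have "coprod (par_a * H\<^sub>q) = 1 \<otimes> (par_a * H\<^sub>q) + (par_a * H\<^sub>q) \<otimes> 1"
    "coprod (par_c * M\<^sub>q) = 1 \<otimes> (par_c * M\<^sub>q) + (par_c * M\<^sub>q) \<otimes> 1"
    by (simp_all add: coprod_par tens_par distrib_left)
  then show "coprod (expH t) = expH t \<otimes> expH t" "coprod (expM t) = expM t \<otimes> expM t"
    by (simp_all add: ser_hom_pexp[OF ser_hom_coprod aH_adic] ser_hom_pexp[OF ser_hom_coprod cM_adic]
        pexp_tens[OF aH_adic aH_adic] pexp_tens[OF cM_adic cM_adic])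
qed

lemma antipode_exp: "antipode (expH t) = expH (- t)" "antipode (expM t) = expM (- t)"
  using pexp_uminus[OF aH_adic, of t] pexp_uminus[OF cM_adic, of t] antipode_par(1)[of "H\<^sub>q"]
    antipode_par(2)[of "M\<^sub>q"]
  unfolding antipode_def free_antihom_pexp[OF aH_adic] free_antihom_pexp[OF cM_adic]
  by simp_all

lemma exp_mult: "expH s * expH t = expH (s + t)" "expM s * expM t = expM (s + t)"
  "expH s * (expH t * x) = expH (s + t) * x" "expM s * (expM t * x) = expM (s + t) * x"
  by (simp_all add: pexp_mult[OF aH_adic] pexp_mult[OF cM_adic] flip: mult.assoc)

lemma exp_0: "expH 0 = 1" "expM 0 = 1"
  by (simp_all add: pexp_0[OF aH_adic] pexp_0[OF cM_adic])

lemma counit_exp: "counit (expH t) = 1" "counit (expM t) = 1"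
proof -
  have "scal (counit (expH t)) = (1 :: sgen list ser)" "scal (counit (expM t)) = (1 :: sgen list ser)"
    unfolding scal_counit
    by (simp_all add: ser_hom_pexp[OF ser_hom_free_hom aH_adic] ser_hom_pexp[OF ser_hom_free_hom cM_adic]
        ser_homD[OF ser_hom_free_hom] pexp_zero)
  then show "counit (expH t) = 1" "counit (expM t) = 1"
    by (metis scal_1 scal_eq_iff)+
qed

lemma counit_mult: "counit (x * y) = counit x * counit y"
  using ser_character_counit by (auto simp: ser_character_def)

lemma counit_smult: "counit (s \<odot> x) = s * counit x"
  using ser_character_counit by (auto simp: ser_character_def)

lemma counit_add: "counit (x + y) = counit x + counit y"
  using ser_character_counit by (auto simp: ser_character_def)

definition counit_left :: "('g list \<times> ('m::monoid_add)) ser \<Rightarrow> 'm ser"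
  where "counit_left = lin_ext (\<lambda>(m, n). counit (basis m) \<odot> basis n)"

definition counit_right :: "(('m::monoid_add) \<times> 'g list) ser \<Rightarrow> 'm ser"
  where "counit_right = lin_ext (\<lambda>(m, n). counit (basis n) \<odot> basis m)"

lemma ser_linear_counit_smult: "ser_linear (\<lambda>x. counit x \<odot> y)"
  by (simp add: ser_linear_def smult_def counit_add counit_smult[unfolded smult_def] scal_add
      scal_mult distrib_right mult.assoc)

lemma ser_linear_smult: "ser_linear (\<lambda>x. s \<odot> x)"
  by (simp add: ser_linear_def smult_add_right smult_smult mult.commute)

lemma counit_left_tens: "counit_left (x \<otimes> y) = counit x \<odot> y"
  unfolding counit_left_def by (rule lin_ext_tens[OF ser_linear_counit_smult ser_linear_smult])

lemma counit_right_tens: "counit_right (x \<otimes> y) = counit y \<odot> x"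
  unfolding counit_right_def by (rule lin_ext_tens[OF ser_linear_smult ser_linear_counit_smult])

lemma ser_hom_counit_left: "ser_hom counit_left"
proof (rule ser_hom_tensI)
  show "ser_linear counit_left"
    unfolding counit_left_def by (rule ser_linear_lin_ext)
qed (simp_all only: counit_left_tens tens_mult counit_mult smult_mult_left smult_mult_right
    smult_smult counit_1 smult_1 mult.commute)

lemma ser_hom_counit_right: "ser_hom counit_right"
proof (rule ser_hom_tensI)
  show "ser_linear counit_right"
    unfolding counit_right_def by (rule ser_linear_lin_ext)
qed (simp_all only: counit_right_tens tens_mult counit_mult smult_mult_left smult_mult_right
    smult_smult counit_1 smult_1 mult.commute)

lemma counit_par: "counit (par_a * x) = par_a * counit x"
  using counit_smult[of par_a x] by (simp add: smult_def)

lemma counit_coprod: "counit_left (coprod x) = x" "counit_right (coprod x) = x"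
proof -
  show "counit_left (coprod x) = x"
  proof (rule ser_hom_gen_eqI[where x = x, OF ser_hom_comp[OF ser_hom_counit_left ser_hom_coprod] ser_hom_id(1)])
    show "counit_left (coprod (gen X)) = gen X" for X
      by (cases X) (simp_all add: ser_hom_linearD[OF ser_hom_counit_left] counit_left_tens counit_par)
  qed
  show "counit_right (coprod x) = x"
  proof (rule ser_hom_gen_eqI[where x = x, OF ser_hom_comp[OF ser_hom_counit_right ser_hom_coprod] ser_hom_id(1)])
    show "counit_right (coprod (gen X)) = gen X" for X
      by (cases X) (simp_all add: ser_hom_linearD[OF ser_hom_counit_right] counit_right_tens
          counit_mult counit_exp)
  qed
qed

text \<open>Both sides are homomorphisms, so generators suffice. For K the exponents fit: the
  coproduct of exp (-2 a H) P puts exp (-2 a H) exp (a H) exp (-c M) into the last leg of the term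
  starting with a D, and this equals the factor exp (-a H) exp (-c M) that accompanies K.\<close>

lemma coprod_coassoc: "assoc (tens_map coprod id (coprod x)) = tens_map id coprod (coprod x)"
proof (rule ser_hom_gen_eqI[where x = x,
      OF ser_hom_comp[OF ser_hom_assoc ser_hom_comp[OF ser_hom_tens_map[OF ser_hom_coprod ser_hom_id(2)] ser_hom_coprod]]
        ser_hom_comp[OF ser_hom_tens_map[OF ser_hom_id(2) ser_hom_coprod] ser_hom_coprod]])
  fix X
  note simps = ser_linearD(1)[OF ser_linear_tens_map] tens_map_tens[OF ser_homD(1)[OF ser_hom_coprod] ser_linear_id(2)]
    tens_map_tens[OF ser_linear_id(2) ser_homD(1)[OF ser_hom_coprod]] ser_linearD(1)[OF ser_linear_assoc]
    assoc_tens coprod_homD coprod_par coprod_exp tens_left(1) tens_right(1) tens_mult exp_mult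
    ser_linear_par[OF ser_linear_tens_map] ser_linear_par[OF ser_linear_assoc]
  show "assoc (tens_map coprod id (coprod (gen X))) = tens_map id coprod (coprod (gen X))"
    by (cases X) (simp_all add: simps tens_par distrib_left flip: one_tens_one)
qed

definition antipode_left :: "(sgen list \<times> sgen list) ser \<Rightarrow> sgen list ser"
  where "antipode_left z = mult_map (tens_map antipode id z)"

definition antipode_right :: "(sgen list \<times> sgen list) ser \<Rightarrow> sgen list ser"
  where "antipode_right z = mult_map (tens_map id antipode z)"

lemma antipode_left_tens: "antipode_left (x \<otimes> y) = antipode x * y"
  by (simp add: antipode_left_def tens_map_tens ser_linear_antipode mult_map_tens)

lemma antipode_right_tens: "antipode_right (x \<otimes> y) = x * antipode y"
  by (simp add: antipode_right_def tens_map_tens ser_linear_antipode mult_map_tens)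

lemma ser_linear_antipode_left: "ser_linear antipode_left"
  unfolding antipode_left_def by (rule ser_linear_comp[OF ser_linear_mult_map ser_linear_tens_map])

lemma ser_linear_antipode_right: "ser_linear antipode_right"
  unfolding antipode_right_def by (rule ser_linear_comp[OF ser_linear_mult_map ser_linear_tens_map])

text \<open>Since the antipode S reverses products, contracting z (x \<otimes> y) gives S(x), then
  the contraction of z, then y; a scalar in the middle moves out. Hence the antipode axiom need only
  be checked on generators.\<close>

lemma antipode_left_mult:
  assumes "antipode_left z = scal s"
  shows "antipode_left (z * z') = scal s * antipode_left z'"
proof (rule ser_linear_tens_eqI[where z = z', OF ser_linear_comp[OF ser_linear_antipode_left
        ser_linear_mult_left[OF ser_linear_id(1)]] ser_linear_mult_left[OF ser_linear_antipode_left]])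
  fix x y
  have "antipode_left (z * (x \<otimes> y)) = antipode x * antipode_left z * y"
    by (rule ser_linear_tens_eqI[where z = z, OF ser_linear_comp[OF ser_linear_antipode_left
            ser_linear_mult_right[OF ser_linear_id(1)]]
          ser_linear_mult_right[OF ser_linear_mult_left[OF ser_linear_antipode_left]]])
      (simp add: tens_mult antipode_left_tens antipode_mult mult.assoc)
  then show "antipode_left (z * (x \<otimes> y)) = scal s * antipode_left (x \<otimes> y)"
    by (simp add: assms antipode_left_tens mult.assoc scal_left_commute)
qed

lemma antipode_right_mult:
  assumes "antipode_right z' = scal s"
  shows "antipode_right (z * z') = scal s * antipode_right z"
proof (rule ser_linear_tens_eqI[where z = z, OF ser_linear_comp[OF ser_linear_antipode_right
        ser_linear_mult_right[OF ser_linear_id(1)]] ser_linear_mult_left[OF ser_linear_antipode_right]])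
  fix x y
  have "antipode_right ((x \<otimes> y) * z') = x * antipode_right z' * antipode y"
    by (rule ser_linear_tens_eqI[where z = z', OF ser_linear_comp[OF ser_linear_antipode_right
            ser_linear_mult_left[OF ser_linear_id(1)]]
          ser_linear_mult_right[OF ser_linear_mult_left[OF ser_linear_antipode_right]]])
      (simp add: tens_mult antipode_right_tens antipode_mult mult.assoc)
  then show "antipode_right ((x \<otimes> y) * z') = scal s * antipode_right (x \<otimes> y)"
    by (simp add: assms antipode_right_tens mult.assoc scal_left_commute)
qed

lemma antipode_coprod_gen: "antipode_left (coprod_gen X) = 0" "antipode_right (coprod_gen X) = 0"
proof -
  show "antipode_left (coprod_gen X) = 0"
    by (cases X) (simp_all add: ser_linearD[OF ser_linear_antipode_left] antipode_left_tens
        antipode_par exp_mult exp_0 mult.assoc algebra_simps)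
  show "antipode_right (coprod_gen X) = 0"
    by (cases X) (simp_all add: ser_linearD[OF ser_linear_antipode_right] antipode_right_tens
        antipode_par antipode_mult antipode_exp exp_mult exp_0 mult.assoc algebra_simps)
qed

lemma antipode_coprod: "antipode_left (coprod x) = scal (counit x)"
  "antipode_right (coprod x) = scal (counit x)"
proof -
  have words: "antipode_left (coprod (basis w)) = scal (counit (basis w))"
    "antipode_right (coprod (basis w)) = scal (counit (basis w))" for w
  proof (induction w)
    case Nil
    have "antipode_left (1 \<otimes> 1) = 1" "antipode_right (1 \<otimes> 1) = 1"
      by (simp_all only: antipode_left_tens antipode_right_tens antipode_1 mult_1)
    then show "antipode_left (coprod (basis [])) = scal (counit (basis []))"
      "antipode_right (coprod (basis [])) = scal (counit (basis []))"
      by (simp_all add: coprod_homD)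
  next
    case (Cons X w)
    \<comment> \<open>The left contraction starts from the first letter and the right one from the
      remaining word. In both cases the letter contributes 0, as it does under the counit.\<close>
    have gen_0: "antipode_left (coprod_gen X) = scal 0"
      by (simp add: antipode_coprod_gen)
    show "antipode_left (coprod (basis (X # w))) = scal (counit (basis (X # w)))"
      "antipode_right (coprod (basis (X # w))) = scal (counit (basis (X # w)))"
      unfolding gen_mult_basis[symmetric] counit_mult coprod_homD(3) coprod_gen_eq
        antipode_left_mult[OF gen_0] antipode_right_mult[OF Cons.IH(2)]
      by (simp_all add: antipode_coprod_gen)
  qed
  show "antipode_left (coprod x) = scal (counit x)"
    by (rule ser_linear_eqI[where x = x, OF ser_linear_comp[OF ser_linear_antipode_left coprod_homD(1)]
          ser_linear_counit words(1)])
  show "antipode_right (coprod x) = scal (counit x)"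
    by (rule ser_linear_eqI[where x = x, OF ser_linear_comp[OF ser_linear_antipode_right coprod_homD(1)]
          ser_linear_counit words(2)])
qed

section \<open>Consequences of the relations\<close>

abbreviation sch_ideal :: "sgen list ser set" where "sch_ideal \<equiv> presented_ideal sch_relations"

text \<open>An explicit value for (exp (-2 a H) - 1) / a: the shifted exponential series drops the
  constant term and one factor a H, of which H is put back. The definition for M is analogous, -1/2
  accounting for the sign and the 2 in the denominator.\<close>

definition expH_quot :: "sgen list ser"
  where "expH_quot = H\<^sub>q * ev (par_a * H\<^sub>q) (fps_shift 1 (fps_exp (- 2)))"

definition expM_quot :: "sgen list ser"
  where "expM_quot = rsc (- 1 / 2) * (M\<^sub>q * ev (par_c * M\<^sub>q) (fps_shift 1 (fps_exp (- 2))))"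

lemma par_a_mult_expH_quot: "par_a * expH_quot = expH (- 2) - 1"
  unfolding pexp_def expH_quot_def
  by (subst (2) ev_unfold[OF aH_adic]) (simp add: mult.assoc)

lemma par_c_mult_expM_quot: "2 * par_c * expM_quot = 1 - expM (- 2)"
proof -
  let ?y = "par_c * (M\<^sub>q * ev (par_c * M\<^sub>q) (fps_shift 1 (fps_exp (- 2))))"
  have "2 * par_c * expM_quot = 2 * rsc (- 1 / 2) * ?y"
    by (simp only: expM_quot_def mult.assoc scal_left_commute)
  also have "2 * rsc (- 1 / 2) = (- 1 :: sgen list ser)"
    using rsc_mult[of 2 "- 1 / 2", where 'a = "sgen list"] rsc_numeral[of "num.Bit0 num.One", where 'a = "sgen list"]
      rsc_uminus[of 1, where 'a = "sgen list"] by simp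
  also have "- 1 * ?y = 1 - expM (- 2)"
    unfolding pexp_def by (subst (2) ev_unfold[OF cM_adic]) (simp add: mult.assoc)
  finally show ?thesis .
qed

lemma quot_expH: "quot (sexp (- 2 * par_a * H\<^sub>q) - 1) par_a = expH_quot"
  unfolding sexp_eq_exps by (rule quot_eqI[OF par_a_mult_expH_quot par_a_cancel])

lemma quot_expM: "quot (1 - sexp (- 2 * par_c * M\<^sub>q)) (2 * par_c) = expM_quot"
  unfolding sexp_eq_exps by (rule quot_eqI[OF par_c_mult_expM_quot two_par_c_cancel])

text \<open>With a / 2 as the basic scalar, the quadratic relations have integer coefficients and
  normal ordering involves no fractions.\<close>

definition half_a :: "sgen list ser" where "half_a = rsc (1 / 2) * par_a"

lemma half_a_commute: "half_a * x = x * half_a"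
  using scal_commute[of "const2 (1 / 2) * par_a" x] by (simp add: half_a_def scal_mult)

lemma par_a_eq_half_a: "par_a = half_a + half_a"
proof -
  have "half_a + half_a = (rsc (1 / 2) + rsc (1 / 2)) * par_a"
    by (simp only: half_a_def distrib_right)
  also have "rsc (1 / 2) + rsc (1 / 2) = (1 :: sgen list ser)"
    unfolding rsc_add[symmetric] by simp
  finally show ?thesis
    by simp
qed

lemma half_a_smult: "(const2 (1 / 2) * par_a) \<odot> x = half_a * x"
  by (simp only: smult_def half_a_def scal_mult scal_par_a)

lemma half_a_smult_uminus: "(- (const2 (1 / 2) * par_a)) \<odot> x = - (half_a * x)"
  by (simp only: smult_def half_a_def scal_mult scal_par_a scal_uminus mult_minus_left)

lemma sch_ideal_rel:
  "D\<^sub>q * P\<^sub>q - P\<^sub>q * D\<^sub>q - - P\<^sub>q \<in> sch_ideal"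
  "D\<^sub>q * K\<^sub>q - K\<^sub>q * D\<^sub>q - K\<^sub>q \<in> sch_ideal"
  "K\<^sub>q * P\<^sub>q - P\<^sub>q * K\<^sub>q - expM_quot \<in> sch_ideal"
  "D\<^sub>q * H\<^sub>q - H\<^sub>q * D\<^sub>q - expH_quot \<in> sch_ideal"
  "D\<^sub>q * C\<^sub>q - C\<^sub>q * D\<^sub>q - (2 * C\<^sub>q - par_a * D\<^sub>q ^ 2) \<in> sch_ideal"
  "H\<^sub>q * C\<^sub>q - C\<^sub>q * H\<^sub>q - D\<^sub>q \<in> sch_ideal"
  "K\<^sub>q * H\<^sub>q - H\<^sub>q * K\<^sub>q - expH (- 2) * P\<^sub>q \<in> sch_ideal"
  "K\<^sub>q * C\<^sub>q - C\<^sub>q * K\<^sub>q - - (half_a * (K\<^sub>q * D\<^sub>q + D\<^sub>q * K\<^sub>q)) \<in> sch_ideal"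
  "P\<^sub>q * C\<^sub>q - C\<^sub>q * P\<^sub>q - (- K\<^sub>q + half_a * (D\<^sub>q * P\<^sub>q + P\<^sub>q * D\<^sub>q)) \<in> sch_ideal"
  "P\<^sub>q * H\<^sub>q - H\<^sub>q * P\<^sub>q - 0 \<in> sch_ideal"
  "M\<^sub>q * gen X - gen X * M\<^sub>q - 0 \<in> sch_ideal"
  unfolding comm_def[symmetric] half_a_smult_uminus[symmetric]
  unfolding half_a_smult[symmetric]
    quot_expH[symmetric] quot_expM[symmetric] sexp_eq_exps(1)[symmetric]
  by (intro presented_ideal_rel; unfold sch_relations_def; blast)+

lemmas sch_idealD = closed_idealD[OF closed_presented_ideal[of sch_relations]]

lemma M_central: "M\<^sub>q * x - x * M\<^sub>q \<in> sch_ideal"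
  by (rule central_if_gen_central[OF closed_presented_ideal sch_ideal_rel(11)[unfolded diff_zero]])

lemma par_mult_commutator:
  "par_a * u * v - v * (par_a * u) = par_a * (u * v - v * u)"
  "par_c * u * v - v * (par_c * u) = par_c * (u * v - v * u)" for u v :: "'m::monoid_add ser"
  using scal_left_commute[of v par_a u] scal_left_commute[of v par_c u]
  by (simp_all add: right_diff_distrib mult.assoc)

lemma ev_M_central: "ev (par_c * M\<^sub>q) F * x - x * ev (par_c * M\<^sub>q) F \<in> sch_ideal"
  by (rule ev_central[OF closed_presented_ideal cM_adic])
    (simp only: par_mult_commutator sch_idealD(3)[OF M_central])

text \<open>\<open>ev_commutation\<close> for x = a H and an exponential: each further commutator
  brings a factor a, each further derivative a factor t.\<close>

lemma aH_commutation:
  assumes "H\<^sub>q * y - (y * H\<^sub>q + d) \<in> sch_ideal" "H\<^sub>q * d - (d * H\<^sub>q + w) \<in> sch_ideal"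
    "H\<^sub>q * w - w * H\<^sub>q \<in> sch_ideal"
  shows "expH t * y - (y * expH t + rsc t * (par_a * d) * expH t
    + rsc (t * t / 2) * (par_a * (par_a * w)) * expH t) \<in> sch_ideal"
proof -
  have a: "y * (par_a * z) = par_a * (y * z)" for y z :: "sgen list ser"
    using scal_left_commute[of y par_a z] by simp
  have "par_a * H\<^sub>q * y - (y * (par_a * H\<^sub>q) + par_a * d) = par_a * (H\<^sub>q * y - (y * H\<^sub>q + d))"
    "par_a * H\<^sub>q * (par_a * d) - (par_a * d * (par_a * H\<^sub>q) + par_a * (par_a * w))
      = par_a * (par_a * (H\<^sub>q * d - (d * H\<^sub>q + w)))"
    "par_a * H\<^sub>q * (par_a * (par_a * w)) - par_a * (par_a * w) * (par_a * H\<^sub>q)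
      = par_a * (par_a * (par_a * (H\<^sub>q * w - w * H\<^sub>q)))"
    by (simp_all add: a[of "H\<^sub>q"] a[of y] a[of d] a[of w] algebra_simps)
  then have hyps: "par_a * H\<^sub>q * y - (y * (par_a * H\<^sub>q) + par_a * d) \<in> sch_ideal"
    "par_a * H\<^sub>q * (par_a * d) - (par_a * d * (par_a * H\<^sub>q) + par_a * (par_a * w)) \<in> sch_ideal"
    "par_a * H\<^sub>q * (par_a * (par_a * w)) - par_a * (par_a * w) * (par_a * H\<^sub>q) \<in> sch_ideal"
    using assms by (simp_all only: sch_idealD(3))
  have deriv: "ev (par_a * H\<^sub>q) (fps_deriv (fps_exp t)) = rsc t * expH t"
    "ev (par_a * H\<^sub>q) (fps_deriv (fps_deriv (fps_exp t))) = rsc (t * t) * expH t"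
  proof -
    have "fps_deriv (fps_exp t) = fps_const t * fps_exp t"
      "fps_deriv (fps_deriv (fps_exp t)) = fps_const (t * t) * fps_exp t"
      by (simp_all flip: fps_const_mult add: mult.assoc)
    then show "ev (par_a * H\<^sub>q) (fps_deriv (fps_exp t)) = rsc t * expH t"
      "ev (par_a * H\<^sub>q) (fps_deriv (fps_deriv (fps_exp t))) = rsc (t * t) * expH t"
      by (simp_all only: pexp_def ev_mult[OF aH_adic] ev_const[OF aH_adic])
  qed
  have "rsc (1 / 2) * (par_a * (par_a * w)) * (rsc (t * t) * expH t)
      = rsc (t * t / 2) * (par_a * (par_a * w)) * expH t"
  proof -
    have "rsc (1 / 2) * (par_a * (par_a * w)) * (rsc (t * t) * expH t)
        = (rsc (1 / 2) * rsc (t * t)) * (par_a * (par_a * w)) * expH t"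
      by (simp only: mult.assoc scal_left_commute[of w] scal_left_commute[of par_a])
    then show ?thesis
      by (simp only: flip: rsc_mult) simp
  qed
  moreover have "par_a * d * (rsc t * expH t) = rsc t * (par_a * d) * expH t"
    by (simp only: mult.assoc scal_left_commute[of d] scal_left_commute[of par_a])
  ultimately show ?thesis
    using ev_commutation[OF closed_presented_ideal aH_adic hyps, of "fps_exp t"]
    by (simp only: deriv) (simp only: pexp_def)
qed

text \<open>A series in a H commutes with a H by \<open>ev_commute\<close>; the a is then cancelled
  in the free algebra.\<close>

lemma H_expH_commute: "H\<^sub>q * ev (par_a * H\<^sub>q) F = ev (par_a * H\<^sub>q) F * H\<^sub>q"
proof -
  have "par_a * (H\<^sub>q * ev (par_a * H\<^sub>q) F - ev (par_a * H\<^sub>q) F * H\<^sub>q) = 0"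
    using ev_commute[OF aH_adic, of fps_X F] scal_left_commute[of "ev (par_a * H\<^sub>q) F" par_a "H\<^sub>q"]
    by (simp add: ev_X[OF aH_adic] right_diff_distrib mult.assoc)
  then show ?thesis
    using par_a_cancel by fastforce
qed

lemma H_expH_quot_commute: "H\<^sub>q * expH_quot = expH_quot * H\<^sub>q"
  by (simp add: expH_quot_def mult.assoc H_expH_commute[symmetric])

lemma expH_expH_quot_commute: "expH t * expH_quot = expH_quot * expH t"
proof -
  have "expH t * expH_quot = (H\<^sub>q * expH t) * ev (par_a * H\<^sub>q) (fps_shift 1 (fps_exp (- 2)))"
    by (simp only: expH_quot_def pexp_def H_expH_commute mult.assoc)
  then show ?thesis
    by (simp only: expH_quot_def pexp_def ev_commute[OF aH_adic, of "fps_exp t"] mult.assoc)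
qed

lemma expH_P: "expH t * P\<^sub>q - P\<^sub>q * expH t \<in> sch_ideal"
proof -
  have "H\<^sub>q * P\<^sub>q - (P\<^sub>q * H\<^sub>q + 0) \<in> sch_ideal"
    using sch_idealD(5)[OF sch_ideal_rel(10)] by simp
  from aH_commutation[OF this, of 0 t] show ?thesis
    by (simp add: sch_idealD)
qed

lemma H_D: "H\<^sub>q * D\<^sub>q - (D\<^sub>q * H\<^sub>q + - expH_quot) \<in> sch_ideal"
  using sch_idealD(5)[OF sch_ideal_rel(4)] by (simp add: algebra_simps)

lemma H_uminus_expH_quot:
  "H\<^sub>q * - expH_quot - (- expH_quot * H\<^sub>q + 0) \<in> sch_ideal"
  "H\<^sub>q * - expH_quot - - expH_quot * H\<^sub>q \<in> sch_ideal"
  by (simp_all add: H_expH_quot_commute sch_idealD(1))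

lemma H_0: "H\<^sub>q * 0 - 0 * H\<^sub>q \<in> sch_ideal"
  by (simp add: sch_idealD(1))

text \<open>The a produced by commuting past a series in a H clears the denominator of [D,H], so no
  quotient remains.\<close>

lemma expH_D: "expH t * D\<^sub>q - (D\<^sub>q * expH t - rsc t * (expH (- 2) - 1) * expH t) \<in> sch_ideal"
proof -
  have "rsc t * (par_a * - expH_quot) * expH t = - (rsc t * (expH (- 2) - 1) * expH t)"
    by (simp only: mult_minus_right mult_minus_left par_a_mult_expH_quot)
  then show ?thesis
    using aH_commutation[OF H_D H_uminus_expH_quot(1) H_0, of t] by (simp only:) simp
qed

text \<open>Here the second commutator is nonzero: ad H sends C to D and D to minus the quotient. Of
  the factor a^2 / 2 one a clears the denominator and a / 2 survives.\<close>

lemma expH_C: "expH t * C\<^sub>q - (C\<^sub>q * expH t + rsc t * (par_a * D\<^sub>q) * expH t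
    - rsc (t * t) * (half_a * (expH (- 2) - 1)) * expH t) \<in> sch_ideal"
proof -
  have H_C: "H\<^sub>q * C\<^sub>q - (C\<^sub>q * H\<^sub>q + D\<^sub>q) \<in> sch_ideal"
    using sch_ideal_rel(6) by (simp add: algebra_simps)
  have "rsc (t * t / 2) = rsc (t * t) * (rsc (1 / 2) :: sgen list ser)"
    unfolding rsc_mult[symmetric] by simp
  then have "rsc (t * t / 2) * (par_a * (par_a * - expH_quot)) * expH t
      = - (rsc (t * t) * (half_a * (expH (- 2) - 1)) * expH t)"
    by (simp only: half_a_def mult.assoc mult_minus_right mult_minus_left par_a_mult_expH_quot)
  then show ?thesis
    using aH_commutation[OF H_C H_D H_uminus_expH_quot(2), of t] by (simp only:) simp
qed

text \<open>The relation gives exp (-2 a H) P; by \<open>expH_P\<close> the order can be reversed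
  modulo the ideal, and the result commutes with H.\<close>

lemma expH_K: "expH t * K\<^sub>q - (K\<^sub>q * expH t - rsc t * (par_a * (P\<^sub>q * expH (- 2))) * expH t) \<in> sch_ideal"
proof -
  have eq: "H\<^sub>q * K\<^sub>q - (K\<^sub>q * H\<^sub>q + - (P\<^sub>q * expH (- 2)))
      = - (K\<^sub>q * H\<^sub>q - H\<^sub>q * K\<^sub>q - expH (- 2) * P\<^sub>q) - (expH (- 2) * P\<^sub>q - P\<^sub>q * expH (- 2))"
    by simp
  have HK: "H\<^sub>q * K\<^sub>q - (K\<^sub>q * H\<^sub>q + - (P\<^sub>q * expH (- 2))) \<in> sch_ideal"
    unfolding eq by (rule sch_idealD(6)[OF sch_idealD(5)[OF sch_ideal_rel(7)] expH_P])
  have "H\<^sub>q * - (P\<^sub>q * expH (- 2)) - (- (P\<^sub>q * expH (- 2)) * H\<^sub>q + 0)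
      = (P\<^sub>q * H\<^sub>q - H\<^sub>q * P\<^sub>q - 0) * expH (- 2)"
    using H_expH_commute by (simp add: pexp_def algebra_simps)
  then have "H\<^sub>q * - (P\<^sub>q * expH (- 2)) - (- (P\<^sub>q * expH (- 2)) * H\<^sub>q + 0) \<in> sch_ideal"
    using sch_idealD(4)[OF sch_ideal_rel(10)] by simp
  from aH_commutation[OF HK this H_0, of t] show ?thesis
    by simp
qed

section \<open>Representations of the relations\<close>

text \<open>Constants rather than abbreviations, so that the homomorphism rules below do not split the
  products in them.\<close>

definition Eg :: "sgen list ser" where "Eg = expH (- 2)"
definition Tg :: "sgen list ser" where "Tg = expH 2"
definition Gg :: "sgen list ser" where "Gg = expH 1 * expM (- 1)"
definition Rg :: "sgen list ser" where "Rg = expM 1 * expH (- 1)"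

lemma mult_left_rule: "x * y = z \<Longrightarrow> x * (y * w) = z * w" for w x y z :: "'a::ring_1"
  by (simp flip: mult.assoc)

text \<open>Normal forms carry integer multiples as repeated sums; this brings numerals back to that
  form.\<close>

lemma numeral_mult: "2 * x = x + x" "3 * x = x + x + x" "4 * x = x + x + x + x" for x :: "'a::ring_1"
proof -
  have "(3 :: 'a) = 1 + 1 + 1" "(4 :: 'a) = 1 + 1 + 1 + 1"
    by simp_all
  then show "2 * x = x + x" "3 * x = x + x + x" "4 * x = x + x + x + x"
    by (simp_all only: mult_2 distrib_right mult_1_left)
qed

lemma commute_mult: "x * z = z * x \<Longrightarrow> y * z = z * y \<Longrightarrow> x * y * z = z * (x * y)" for x y z :: "'a::ring_1"
  by (simp add: mult.assoc) (simp flip: mult.assoc)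

text \<open>Congruences modulo an ideal cannot serve as rewrite rules. A map that preserves the ring
  operations and kills the ideal turns them into equations; both embeddings into the quotient of the
  tensor square are of this kind.\<close>

locale sch_rep =
  fixes i :: "sgen list ser \<Rightarrow> 'r::ring_1" and b :: 'r
  assumes add: "i (x + y) = i x + i y" and mult: "i (x * y) = i x * i y" and one: "i 1 = 1"
    and kill: "x \<in> sch_ideal \<Longrightarrow> i x = 0" and half: "i half_a = b"
begin

lemma zero: "i 0 = 0"
  using add[of 0 0] by simp

lemma uminus: "i (- x) = - i x"
  using add[of x "- x"] zero by (simp add: eq_neg_iff_add_eq_0 add.commute)

lemma diff: "i (x - y) = i x - i y"
  using add[of x "- y"] by (simp add: uminus)

lemma eq: "x - y \<in> sch_ideal \<Longrightarrow> i x = i y"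
  using kill[of "x - y"] by (simp add: diff)

lemma two: "i 2 = 1 + 1"
  using add[of 1 1] one by simp

lemma a: "i par_a = b + b"
  using add[of half_a half_a] by (simp add: half flip: par_a_eq_half_a)

lemmas hom = add mult one zero uminus diff two half a

lemma b_central: "i x * b = b * i x"
  using mult[of x half_a] mult[of half_a x] by (simp add: half half_a_commute)

abbreviation (input) "D \<equiv> i D\<^sub>q"
abbreviation (input) "H \<equiv> i H\<^sub>q"
abbreviation (input) "P \<equiv> i P\<^sub>q"
abbreviation (input) "K \<equiv> i K\<^sub>q"
abbreviation (input) "C \<equiv> i C\<^sub>q"
abbreviation (input) "M \<equiv> i M\<^sub>q"
abbreviation (input) "e \<equiv> i Eg"
abbreviation (input) "t \<equiv> i Tg"
abbreviation (input) "g \<equiv> i Gg"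
abbreviation (input) "r \<equiv> i Rg"
abbreviation (input) "q \<equiv> i expH_quot"
abbreviation (input) "z \<equiv> i expM_quot"

lemma generators:
  "K * D = D * K - K"
  "P * D = D * P + P"
  "C * D = D * C - (C + C) + b * (D * D) + b * (D * D)"
  "P * K = K * P - z"
  "C * K = K * C + b * (D * K + D * K - K)"
  "C * P = P * C + K - b * (D * P + D * P + P)"
  "H * D = D * H - q"
  "H * K = K * H - e * P"
  "H * P = P * H"
  "H * C = C * H + D"
proof -
  note rel = sch_ideal_rel[THEN kill]
  show KD: "K * D = D * K - K" and PD: "P * D = D * P + P"
    and "C * D = D * C - (C + C) + b * (D * D) + b * (D * D)"
    "P * K = K * P - z" "H * D = D * H - q" "H * K = K * H - e * P" "H * P = P * H" "H * C = C * H + D"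
    using rel(1-7,10) by (simp_all add: hom Eg_def power2_eq_square mult_2 algebra_simps)
  show "C * K = K * C + b * (D * K + D * K - K)" "C * P = P * C + K - b * (D * P + D * P + P)"
    using rel(8,9) by (simp_all add: hom KD PD algebra_simps)
qed

lemma expM_commute: "i (expM s) * i x = i x * i (expM s)"
  using eq[OF ev_M_central] by (simp add: pexp_def mult)

lemma rsc_simps: "i (rsc 1) = 1" "i (rsc 2) = 1 + 1" "i (rsc 4) = 1 + 1 + 1 + 1"
  "i (rsc (- s)) = - i (rsc s)"
proof -
  show "i (rsc 1) = 1"
    by (simp add: one)
  show two: "i (rsc 2) = 1 + 1"
    by (simp add: rsc_numeral two)
  have "rsc 4 = rsc 2 + (rsc 2 :: sgen list ser)"
    unfolding rsc_add[symmetric] by simp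
  then show "i (rsc 4) = 1 + 1 + 1 + 1"
    by (simp add: add two add.assoc)
  show "i (rsc (- s)) = - i (rsc s)"
    by (simp add: rsc_uminus uminus)
qed

lemma expH_rules:
  "i (expH s) * D = D * i (expH s) - i (rsc s) * (e - 1) * i (expH s)"
  "i (expH s) * P = P * i (expH s)"
  "i (expH s) * C = C * i (expH s) + i (rsc s) * ((b + b) * D) * i (expH s)
    - i (rsc (s * s)) * (b * (e - 1)) * i (expH s)"
  "i (expH s) * K = K * i (expH s) - i (rsc s) * ((b + b) * (P * e)) * i (expH s)"
  using eq[OF expH_D, of s] eq[OF expH_P, of s] eq[OF expH_C, of s] eq[OF expH_K, of s]
  by (simp_all only: hom Eg_def)

lemma exps_mult:
  "i (expH s) * i (expH s') = i (expH (s + s'))" "i (expM s) * i (expM s') = i (expM (s + s'))"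
  "i (expM s) * i (expH s') = i (expH s') * i (expM s)" "i (expH 0) = 1" "i (expM 0) = 1"
  using expM_commute[of s "expH s'"] by (simp_all add: exp_mult exp_0 one flip: mult)

lemma rsc_values:
  "i (rsc (- 2)) = - (1 + 1)" "i (rsc ((- 2) * (- 2))) = 1 + 1 + 1 + 1"
  "i (rsc 2) = 1 + 1" "i (rsc (2 * 2)) = 1 + 1 + 1 + 1"
  "i (rsc 1) = 1" "i (rsc (1 * 1)) = 1" "i (rsc (- 1)) = - 1" "i (rsc ((- 1) * (- 1))) = 1"
  using rsc_simps(1-3) rsc_simps(4)[of 1] rsc_simps(4)[of 2] by simp_all

lemmas expH_rules_at =
  expH_rules[of "- 2", unfolded rsc_values] expH_rules[of 2, unfolded rsc_values]
  expH_rules[of 1, unfolded rsc_values] expH_rules[of "- 1", unfolded rsc_values]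

text \<open>Makes \<open>e\<close>, \<open>t\<close>, \<open>g\<close>, \<open>r\<close> the only
  exponentials left: since \<open>g\<close> is exp (a H) exp (-c M) and \<open>e\<close> is exp (-2
  a H), the series exp (-2 c M) becomes \<open>e * (g * g)\<close>, and similarly for the
  others.\<close>

lemma exp_mutual:
  "t * e = 1" "e * t = 1" "r * g = 1" "g * r = 1" "g * t = t * g" "g * e = e * g" "r * e = e * r"
  "r * t = t * r" "i (expM (- 2)) = e * (g * g)" "i (expM 2) = t * (r * r)" "i (expH (- 1) * expM (- 1)) = e * g"
  "i (expM 1 * expH 1) = t * r"
  by (simp_all add: Eg_def Tg_def Gg_def Rg_def mult mult.assoc exps_mult exps_mult(1-3)[THEN mult_left_rule])

lemma exp_H: "e * H = H * e" "t * H = H * t" "g * H = H * g" "r * H = H * r"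
proof -
  have "i (expH s) * H = H * i (expH s)" for s
    using H_expH_commute[of "fps_exp s"] by (simp add: pexp_def flip: mult)
  then show "e * H = H * e" "t * H = H * t" "g * H = H * g" "r * H = H * r"
    unfolding Eg_def Tg_def Gg_def Rg_def mult by (auto intro!: commute_mult simp: expM_commute)
qed

lemma exp_rules:
  "e * D = D * e + e * e + e * e - e - e"
  "g * D = D * g - e * g + g"
  "t * D = D * t - 1 - 1 + t + t"
  "r * D = D * r + e * r - r"
  "e * P = P * e" "g * P = P * g" "t * P = P * t" "r * P = P * r"
  "e * K = K * e + b * (P * (e * e)) + b * (P * (e * e)) + b * (P * (e * e)) + b * (P * (e * e))"
  "g * K = K * g - b * (P * (e * g)) - b * (P * (e * g))"
  "t * K = K * t - b * P - b * P - b * P - b * P"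
  "r * K = K * r + b * (P * (e * r)) + b * (P * (e * r))"
  "e * C = C * e - b * (D * e) - b * (D * e) - b * (D * e) - b * (D * e)
    - b * (e * e) - b * (e * e) - b * (e * e) - b * (e * e) + b * e + b * e + b * e + b * e"
  "g * C = C * g + b * (D * g) + b * (D * g) - b * (e * g) + b * g"
  "t * C = C * t + b * (D * t) + b * (D * t) + b * (D * t) + b * (D * t)
    - b - b - b - b + b * t + b * t + b * t + b * t"
  "r * C = C * r - b * (D * r) - b * (D * r) - b * (e * r) + b * r"
proof -
  note e = expH_rules_at(1-4)[folded Eg_def]
  note t = expH_rules_at(5-8)[folded Tg_def]
  note gr = expH_rules_at(9-16)
  have gr_eq: "g = i (expH 1) * i (expM (- 1))" "r = i (expH (- 1)) * i (expM 1)"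
    by (simp_all add: Gg_def Rg_def mult exps_mult)
  note normalize = mult.assoc distrib_left distrib_right left_diff_distrib right_diff_distrib
    mult_1_left mult_1_right b_central b_central[THEN mult_left_rule] exp_mutual(1-2)
    exp_mutual(2)[THEN mult_left_rule]
  show "e * D = D * e + e * e + e * e - e - e" "e * P = P * e"
    "e * C = C * e - b * (D * e) - b * (D * e) - b * (D * e) - b * (D * e)
      - b * (e * e) - b * (e * e) - b * (e * e) - b * (e * e) + b * e + b * e + b * e + b * e"
    "e * K = K * e + b * (P * (e * e)) + b * (P * (e * e)) + b * (P * (e * e)) + b * (P * (e * e))"
    unfolding e by (simp_all add: normalize algebra_simps numeral_mult)
  show "t * D = D * t - 1 - 1 + t + t" "t * P = P * t"
    "t * C = C * t + b * (D * t) + b * (D * t) + b * (D * t) + b * (D * t)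
      - b - b - b - b + b * t + b * t + b * t + b * t"
    "t * K = K * t - b * P - b * P - b * P - b * P"
    unfolding t by (simp_all add: normalize algebra_simps numeral_mult)
  show "g * D = D * g - e * g + g" "g * P = P * g"
    "g * K = K * g - b * (P * (e * g)) - b * (P * (e * g))"
    "g * C = C * g + b * (D * g) + b * (D * g) - b * (e * g) + b * g"
    "r * D = D * r + e * r - r" "r * P = P * r"
    "r * K = K * r + b * (P * (e * r)) + b * (P * (e * r))"
    "r * C = C * r - b * (D * r) - b * (D * r) - b * (e * r) + b * r"
    unfolding gr_eq mult.assoc expM_commute[of _ "D\<^sub>q"] expM_commute[of _ "P\<^sub>q"]
      expM_commute[of _ "K\<^sub>q"] expM_commute[of _ "C\<^sub>q"] gr[THEN mult_left_rule]
    by (simp_all add: normalize algebra_simps numeral_mult)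
qed


text \<open>\<open>z\<close> is built from M and is central; \<open>q\<close> is built from H and is
  moved only past H and its exponentials.\<close>

lemma q_z_rules: "q * H = H * q" "q * e = e * q" "q * t = t * q"
  "z * D = D * z" "z * K = K * z" "z * P = P * z" "z * C = C * z" "z * H = H * z"
  "z * e = e * z" "z * g = g * z" "z * t = t * z" "z * r = r * z"
proof -
  show "q * H = H * q" "q * e = e * q" "q * t = t * q"
    by (simp_all add: Eg_def Tg_def H_expH_quot_commute expH_expH_quot_commute flip: mult)
  have "z * i x = i x * z" for x
  proof -
    have "i M\<^sub>q * i x = i x * i M\<^sub>q" for x
      using eq[OF M_central, of x] by (simp add: mult)
    moreover have "i (ev (par_c * M\<^sub>q) F) * i x = i x * i (ev (par_c * M\<^sub>q) F)" for F x
      using eq[OF ev_M_central, of F x] by (simp add: mult)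
    moreover have "i (scal s) * i x = i x * i (scal s)" for s x
      by (simp add: scal_commute flip: mult)
    ultimately show ?thesis
      unfolding expM_quot_def mult by (intro commute_mult)
  qed
  then show "z * D = D * z" "z * K = K * z" "z * P = P * z" "z * C = C * z" "z * H = H * z"
    "z * e = e * z" "z * g = g * z" "z * t = t * z" "z * r = r * z"
    by blast+
qed

lemma b_rules: "i x * b = b * i x" "i x * (b * w) = b * (i x * w)"
  using b_central by (simp_all flip: mult.assoc)

lemmas rules = generators exp_mutual(1-8) exp_H exp_rules q_z_rules
text \<open>Rewriting to the order \<open>b\<close>, \<open>D\<close>, \<open>K\<close>, \<open>P\<close>, \<open>C\<close>, \<open>H\<close>, then the exponentials, \<open>q\<close> and \<open>z\<close>.\<close>

lemmas normal_order = rules rules[THEN mult_left_rule] b_rules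

end

section \<open>The coproduct and the antipode respect the relations\<close>

lemma par_a_mult_cancel: "par_a * x = par_a * y \<Longrightarrow> x = y"
  and two_par_c_mult_cancel: "2 * par_c * x = 2 * par_c * y \<Longrightarrow> x = y" for x y :: "'m::monoid_add ser"
proof -
  show "x = y" if "par_a * x = par_a * y"
    using par_a_cancel[of "x - y"] that by (simp add: right_diff_distrib)
  show "x = y" if "2 * par_c * x = 2 * par_c * y"
  proof -
    have "2 * par_c * (x - y) = 0"
      unfolding right_diff_distrib that by simp
    then show ?thesis
      using two_par_c_cancel by fastforce
  qed
qed

text \<open>The antipode is known on exponentials. Multiplication by a, which cancels in the free
  algebra, transfers this to the quotient; the next three lemmas proceed likewise, with 2 c in the
  case of M.\<close>

lemma antipode_expH_quot: "antipode expH_quot = - (expH_quot * expH 2)"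
proof (rule par_a_mult_cancel)
  have "par_a * antipode expH_quot = expH 2 - 1"
    unfolding antipode_par(1)[symmetric] par_a_mult_expH_quot
    by (simp add: antipode_linearD antipode_exp)
  also have "\<dots> = par_a * - (expH_quot * expH 2)"
    by (simp add: par_a_mult_expH_quot left_diff_distrib exp_mult exp_0 flip: mult.assoc)
  finally show "par_a * antipode expH_quot = par_a * - (expH_quot * expH 2)" .
qed

lemma antipode_expM_quot: "antipode expM_quot = - (expM_quot * expM 2)"
proof (rule two_par_c_mult_cancel)
  have "2 * par_c * antipode expM_quot = antipode (2 * par_c * expM_quot)"
    unfolding mult_2 distrib_right antipode_linearD(1) antipode_par(2) ..
  also have "\<dots> = 1 - expM 2"
    unfolding par_c_mult_expM_quot by (simp add: antipode_linearD antipode_exp)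
  also have "\<dots> = 2 * par_c * - (expM_quot * expM 2)"
    unfolding mult_minus_right mult.assoc[of _ expM_quot, symmetric] par_c_mult_expM_quot
    by (simp add: left_diff_distrib exp_mult exp_0)
  finally show "2 * par_c * antipode expM_quot = 2 * par_c * - (expM_quot * expM 2)" .
qed

lemma coprod_expH_quot: "coprod expH_quot = expH_quot \<otimes> expH (- 2) + 1 \<otimes> expH_quot"
proof (rule par_a_mult_cancel)
  have "par_a * coprod expH_quot = expH (- 2) \<otimes> expH (- 2) - 1"
    unfolding coprod_par(1)[symmetric] par_a_mult_expH_quot
    by (simp add: coprod_linearD coprod_homD coprod_exp)
  also have "\<dots> = (par_a * expH_quot) \<otimes> expH (- 2) + 1 \<otimes> (par_a * expH_quot)"
    unfolding par_a_mult_expH_quot tens_left tens_right by simp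
  also have "\<dots> = par_a * (expH_quot \<otimes> expH (- 2) + 1 \<otimes> expH_quot)"
    unfolding distrib_left tens_par(1,2) ..
  finally show "par_a * coprod expH_quot = par_a * (expH_quot \<otimes> expH (- 2) + 1 \<otimes> expH_quot)" .
qed

lemma coprod_expM_quot: "coprod expM_quot = expM_quot \<otimes> expM (- 2) + 1 \<otimes> expM_quot"
proof (rule two_par_c_mult_cancel)
  have "2 * par_c * coprod expM_quot = coprod (2 * par_c * expM_quot)"
    unfolding mult_2 distrib_right coprod_linearD(1) coprod_par(2) ..
  also have "\<dots> = 1 - expM (- 2) \<otimes> expM (- 2)"
    unfolding par_c_mult_expM_quot by (simp add: coprod_linearD coprod_homD coprod_exp)
  also have "\<dots> = (2 * par_c * expM_quot) \<otimes> expM (- 2) + 1 \<otimes> (2 * par_c * expM_quot)"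
    unfolding par_c_mult_expM_quot tens_left tens_right by simp
  also have "\<dots> = 2 * par_c * (expM_quot \<otimes> expM (- 2) + 1 \<otimes> expM_quot)"
    unfolding mult_2 distrib_right distrib_left tens_left tens_right tens_par(3,4) by (simp add: add_ac)
  finally show "2 * par_c * coprod expM_quot = 2 * par_c * (expM_quot \<otimes> expM (- 2) + 1 \<otimes> expM_quot)" .
qed

lemma sch_relations_induct:
  assumes "(x, y) \<in> sch_relations"
    and "Q (comm D\<^sub>q P\<^sub>q) (- P\<^sub>q)"
    and "Q (comm D\<^sub>q K\<^sub>q) K\<^sub>q"
    and "Q (comm K\<^sub>q P\<^sub>q) expM_quot"
    and "Q (comm D\<^sub>q H\<^sub>q) expH_quot"
    and "Q (comm D\<^sub>q C\<^sub>q) (C\<^sub>q + C\<^sub>q - par_a * (D\<^sub>q * D\<^sub>q))"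
    and "Q (comm H\<^sub>q C\<^sub>q) D\<^sub>q"
    and "Q (comm K\<^sub>q H\<^sub>q) (Eg * P\<^sub>q)"
    and "Q (comm K\<^sub>q C\<^sub>q) (- (half_a * (K\<^sub>q * D\<^sub>q + D\<^sub>q * K\<^sub>q)))"
    and "Q (comm P\<^sub>q C\<^sub>q) (- K\<^sub>q + half_a * (D\<^sub>q * P\<^sub>q + P\<^sub>q * D\<^sub>q))"
    and "Q (comm P\<^sub>q H\<^sub>q) 0"
    and "\<And>X. Q (comm M\<^sub>q (gen X)) 0"
  shows "Q x y"
  using assms unfolding sch_relations_def half_a_smult_uminus half_a_smult quot_expH quot_expM
  unfolding sexp_eq_exps(1) Eg_def[symmetric] mult_2[of "C\<^sub>q"] power2_eq_square
  by blast

context sch_rep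
begin

lemma antipode_gen_rep:
  "i (antipode_gen Hg) = - H" "i (antipode_gen Mg) = - M" "i (antipode_gen Dg) = - (D * t)"
  "i (antipode_gen Cg) = - (C * t)" "i (antipode_gen Pg) = - (P * r)"
  "i (antipode_gen Kg) = ((b + b) * (D * P) - K) * (t * r)"
proof -
  show "i (antipode_gen Kg) = ((b + b) * (D * P) - K) * (t * r)"
    unfolding antipode_gen.simps mult[of _ "expM 1 * expH 1"] exp_mutual(12) by (simp add: hom mult.assoc)
qed (simp_all add: hom Rg_def Tg_def)

lemma antipode_rep:
  assumes "(x, y) \<in> sch_relations"
  shows "i (antipode x) = i (antipode y)"
proof -
  have half_a: "antipode half_a = half_a" and par_a: "antipode par_a = par_a"
    using antipode_linearD(6)[of "const2 (1 / 2) * par_a" 1] antipode_par(1)[of 1]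
    by (simp_all add: half_a_def scal_mult)
  have e: "i (antipode Eg) = t"
    by (simp add: Eg_def antipode_exp Tg_def)
  have q: "i (antipode expH_quot) = - (q * t)" and z: "i (antipode expM_quot) = - (z * (t * (r * r)))"
    by (simp_all add: antipode_expH_quot antipode_expM_quot hom exp_mutual flip: Tg_def)
  note simps = comm_def antipode_linearD antipode_mult antipode_par hom antipode_gen_rep e q z half_a par_a
  show ?thesis
    using assms
  proof (rule sch_relations_induct)
    \<comment> \<open>Centrality of M is kept out of the rewriting because it concerns an arbitrary
      generator.\<close>
    have "M * i x = i x * M" for x
      using eq[OF M_central, of x] by (simp add: mult)
    then show "i (antipode (comm M\<^sub>q (gen X))) = i (antipode 0)" for X
      by (simp add: comm_def antipode_linearD antipode_mult hom antipode_gen_rep(2) del: antipode_gen.simps)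
    \<comment> \<open>The term a D P in the antipode of K, commuted with H, yields a times the
      quotient. The rewrite rules do not evaluate this product, so it is supplied in the form in
      which it occurs.\<close>
    have "(b + b) * q * (P * (t * r)) = (e - 1) * (P * (t * r))"
      using arg_cong[OF par_a_mult_expH_quot, of i] by (simp only: hom Eg_def)
    then show "i (antipode (comm K\<^sub>q H\<^sub>q)) = i (antipode (Eg * P\<^sub>q))"
      by (simp add: simps normal_order algebra_simps numeral_mult del: antipode_gen.simps)
  qed (simp_all add: simps normal_order algebra_simps numeral_mult del: antipode_gen.simps)
qed

end

lemma half_a_eq_scal: "half_a = scal (const2 (1 / 2) * par_a)"
  by (simp only: half_a_def scal_mult scal_par_a)

lemma commute_add: "x * z = z * x \<Longrightarrow> y * z = z * y \<Longrightarrow> (x + y) * z = z * (x + y)" for x y z :: "'a::ring_1"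
  by (simp add: distrib_left distrib_right)

text \<open>The two legs of a tensor square as commuting representations. They share
  \<open>b\<close>, since scalars pass through the tensor sign. Moving the left leg to the front
  lets each leg be normal ordered by its own rules.\<close>

locale sch_rep_pair = L: sch_rep i1 b + R: sch_rep i2 b
  for i1 i2 :: "sgen list ser \<Rightarrow> 'r::ring_1" and b +
  fixes \<Phi> :: "(sgen list \<times> sgen list) ser \<Rightarrow> 'r"
  assumes \<Phi>_add: "\<Phi> (x + y) = \<Phi> x + \<Phi> y" and \<Phi>_mult: "\<Phi> (x * y) = \<Phi> x * \<Phi> y"
    and \<Phi>_tens: "\<Phi> (u \<otimes> v) = i1 u * i2 v" and commute: "i2 v * i1 u = i1 u * i2 v"
begin

lemma \<Phi>_0: "\<Phi> 0 = 0"
  using \<Phi>_add[of 0 0] by simp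

lemma \<Phi>_uminus: "\<Phi> (- x) = - \<Phi> x"
  using \<Phi>_add[of x "- x"] \<Phi>_0 by (simp add: eq_neg_iff_add_eq_0 add.commute)

lemma \<Phi>_diff: "\<Phi> (x - y) = \<Phi> x - \<Phi> y"
  using \<Phi>_add[of x "- y"] by (simp add: \<Phi>_uminus)

lemma coprod_gen_rep:
  "\<Phi> (coprod_gen Hg) = R.H + L.H" "\<Phi> (coprod_gen Mg) = R.M + L.M"
  "\<Phi> (coprod_gen Dg) = R.D + L.D * R.e" "\<Phi> (coprod_gen Cg) = R.C + L.C * R.e"
  "\<Phi> (coprod_gen Pg) = R.P + L.P * R.g"
  "\<Phi> (coprod_gen Kg) = R.K + L.K * (R.e * R.g) + (b + b) * (L.D * (R.e * R.P))"
  "\<Phi> (coprod expH_quot) = R.q + L.q * R.e" "\<Phi> (coprod expM_quot) = R.z + L.z * (R.e * (R.g * R.g))"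
  "\<Phi> (coprod Eg) = L.e * R.e" "\<Phi> (coprod half_a) = b" "\<Phi> (coprod par_a) = b + b"
proof -
  have "coprod half_a = half_a \<otimes> 1" "coprod par_a = par_a \<otimes> 1"
    unfolding half_a_eq_scal scal_par_a[symmetric] ser_hom_scal[OF ser_hom_coprod]
      ser_hom_scal[OF ser_hom_tens_one] by (rule refl)+
  then show "\<Phi> (coprod half_a) = b" "\<Phi> (coprod par_a) = b + b"
    by (simp_all add: \<Phi>_tens L.hom R.hom)
  have "\<Phi> ((par_a * D\<^sub>q) \<otimes> (expH (- 2) * P\<^sub>q)) = (b + b) * (L.D * (R.e * R.P))"
    unfolding \<Phi>_tens by (simp add: L.hom R.hom mult.assoc Eg_def)
  then show "\<Phi> (coprod_gen Kg) = R.K + L.K * (R.e * R.g) + (b + b) * (L.D * (R.e * R.P))"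
    unfolding coprod_gen.simps \<Phi>_add by (simp add: \<Phi>_tens L.one R.one R.exp_mutual(11))
  have "\<Phi> (expM_quot \<otimes> expM (- 2)) = L.z * (R.e * (R.g * R.g))"
    by (simp add: \<Phi>_tens R.exp_mutual(9))
  then show "\<Phi> (coprod expM_quot) = R.z + L.z * (R.e * (R.g * R.g))"
    by (simp add: coprod_expM_quot \<Phi>_add \<Phi>_tens L.one R.one)
qed (simp_all add: \<Phi>_add \<Phi>_tens coprod_expH_quot coprod_exp L.one R.one Eg_def Gg_def)

lemma coprod_rep:
  assumes "(x, y) \<in> sch_relations"
  shows "\<Phi> (coprod x) = \<Phi> (coprod y)"
proof -
  have commute': "i2 v * (i1 u * w) = i1 u * (i2 v * w)" for u v w
    using commute by (simp flip: mult.assoc)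
  note simps = comm_def coprod_linearD coprod_homD \<Phi>_add \<Phi>_0 \<Phi>_uminus \<Phi>_diff \<Phi>_mult coprod_gen_rep
    commute commute' L.normal_order R.normal_order
  show ?thesis
    using assms
  proof (rule sch_relations_induct)
    \<comment> \<open>M is primitive, and its coproduct commutes with the images of both legs, hence
      with every expression composed of them.\<close>
    let ?m = "R.M + L.M"
    have 1: "i1 u * ?m = ?m * i1 u" for u
      using L.eq[OF M_central, of u] by (simp add: L.mult distrib_left distrib_right commute)
    have 2: "i2 u * ?m = ?m * i2 u" for u
      using R.eq[OF M_central, of u] by (simp add: R.mult distrib_left distrib_right commute)
    have b: "b * ?m = ?m * b"
      by (simp add: distrib_left distrib_right L.b_central R.b_central)
    have "\<Phi> (coprod_gen X) * ?m = ?m * \<Phi> (coprod_gen X)" for X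
      by (cases X; hypsubst; unfold coprod_gen_rep; intro commute_mult commute_add 1 2 b)
    then show "\<Phi> (coprod (comm M\<^sub>q (gen X))) = \<Phi> (coprod 0)" for X
      by (simp add: comm_def coprod_linearD coprod_homD(3) \<Phi>_0 \<Phi>_diff \<Phi>_mult coprod_gen_rep(2)
          del: coprod_gen.simps)
    \<comment> \<open>As for the antipode: [D,H] in the left leg of the term a D \<otimes> exp (-2 a
      H) P gives a times the quotient, which must be replaced by exp (-2 a H) - 1.\<close>
    have "(b + b) * L.q * (R.P * R.e) = (L.e - 1) * (R.P * R.e)"
      using arg_cong[OF par_a_mult_expH_quot, of i1] by (simp only: L.hom Eg_def)
    then show "\<Phi> (coprod (comm K\<^sub>q H\<^sub>q)) = \<Phi> (coprod (Eg * P\<^sub>q))"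
      by (simp add: simps algebra_simps numeral_mult del: coprod_gen.simps)
  qed (simp_all add: simps algebra_simps numeral_mult del: coprod_gen.simps)
qed

end


section \<open>The counit on the quotient, and the quotient of the tensor square as a ring\<close>

lemma counit_sch_ideal: "x \<in> sch_ideal \<Longrightarrow> counit x = 0"
proof -
  have hom: "ser_hom (\<lambda>x. scal (counit x) :: sgen list ser)"
    unfolding scal_counit by (rule ser_hom_free_hom)
  have "sch_ideal \<subseteq> (\<lambda>x. scal (counit x) :: sgen list ser) -` {0}"
  proof (rule presented_ideal_subset[OF closed_ideal_hom_vimage[OF hom closed_ideal_0]])
    fix x y assume "(x, y) \<in> sch_relations"
    then have "scal (counit x) = (scal (counit y) :: sgen list ser)"
      by (rule sch_relations_induct)
        (simp_all add: ser_hom_linearD[OF hom] ser_homD(3)[OF hom] comm_def counit_mult counit_add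
          expH_quot_def expM_quot_def)
    then show "x - y \<in> (\<lambda>x. scal (counit x) :: sgen list ser) -` {0}"
      by (simp add: ser_hom_linearD[OF hom])
  qed
  then show "counit x = 0" if "x \<in> sch_ideal"
    using that by (metis (no_types, lifting) scal_0 scal_eq_iff singletonD subsetD vimageD)
qed

abbreviation sch_sq_ideal :: "(sgen list \<times> sgen list) ser set"
  where "sch_sq_ideal \<equiv> tens_ideal sch_ideal sch_ideal"

text \<open>A retraction of the tensor square onto its left leg. It shows that the quotient of the
  tensor square is nonzero and lets membership of x \<otimes> 1 descend to x.\<close>

lemma counit_right_sch_sq_ideal: "z \<in> sch_sq_ideal \<Longrightarrow> counit_right z \<in> sch_ideal"
proof -
  have "sch_sq_ideal \<subseteq> counit_right -` sch_ideal"
    unfolding tens_ideal_def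
    by (rule hull_minimal)
      (auto simp: counit_right_tens counit_sch_ideal sch_idealD(1)
        intro: closed_ideal_hom_vimage[OF ser_hom_counit_right closed_presented_ideal])
  then show "counit_right z \<in> sch_ideal" if "z \<in> sch_sq_ideal"
    using that by blast
qed

lemma one_notin_sch_sq_ideal: "1 \<notin> sch_sq_ideal"
proof
  assume "1 \<in> sch_sq_ideal"
  then have "counit (counit_right (1 :: (sgen list \<times> sgen list) ser)) = 0"
    by (intro counit_sch_ideal counit_right_sch_sq_ideal)
  then show False
    by (simp add: ser_homD[OF ser_hom_counit_right])
qed

lemmas sch_sq_idealD = closed_idealD[OF closed_tens_ideal[of sch_ideal sch_ideal]]

\<comment> \<open>An actual ring type, in which the normal ordering can be carried out with
  equations.\<close>
quotient_type sch_sq = "(sgen list \<times> sgen list) ser" / "\<lambda>x y. x - y \<in> sch_sq_ideal"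
proof (rule equivpI)
  show "reflp (\<lambda>x y. x - y \<in> sch_sq_ideal)"
    by (simp add: reflp_def sch_sq_idealD(1))
  show "symp (\<lambda>x y. x - y \<in> sch_sq_ideal)"
    unfolding symp_def using sch_sq_idealD(5) by fastforce
  show "transp (\<lambda>x y. x - y \<in> sch_sq_ideal)"
    unfolding transp_def using sch_sq_idealD(2) by fastforce
qed

instantiation sch_sq :: ring_1
begin

lift_definition zero_sch_sq :: sch_sq is 0 .
lift_definition one_sch_sq :: sch_sq is 1 .
lift_definition plus_sch_sq :: "sch_sq \<Rightarrow> sch_sq \<Rightarrow> sch_sq" is "(+)"
proof -
  fix x x' y y' assume "x - x' \<in> sch_sq_ideal" "y - y' \<in> sch_sq_ideal"
  then show "x + y - (x' + y') \<in> sch_sq_ideal"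
    unfolding add_diff_add by (rule sch_sq_idealD(2))
qed
lift_definition uminus_sch_sq :: "sch_sq \<Rightarrow> sch_sq" is uminus
proof -
  fix x y assume "x - y \<in> sch_sq_ideal"
  then show "- x - - y \<in> sch_sq_ideal"
    using sch_sq_idealD(5) by force
qed
lift_definition minus_sch_sq :: "sch_sq \<Rightarrow> sch_sq \<Rightarrow> sch_sq" is "(-)"
proof -
  fix x x' y y' assume "x - x' \<in> sch_sq_ideal" "y - y' \<in> sch_sq_ideal"
  then have "(x - x') - (y - y') \<in> sch_sq_ideal"
    by (rule sch_sq_idealD(6))
  then show "x - y - (x' - y') \<in> sch_sq_ideal"
    by (simp add: algebra_simps)
qed
lift_definition times_sch_sq :: "sch_sq \<Rightarrow> sch_sq \<Rightarrow> sch_sq" is "(*)"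
proof -
  fix x x' y y' assume "x - x' \<in> sch_sq_ideal" "y - y' \<in> sch_sq_ideal"
  then have "(x - x') * y + x' * (y - y') \<in> sch_sq_ideal"
    by (intro sch_sq_idealD(2) sch_sq_idealD(3)[of "y - y'"] sch_sq_idealD(4)[of "x - x'"])
  then show "x * y - x' * y' \<in> sch_sq_ideal"
    by (simp add: algebra_simps)
qed

instance
proof
  show "(0 :: sch_sq) \<noteq> 1"
    by transfer (use one_notin_sch_sq_ideal sch_sq_idealD(5)[of "- 1"] in auto)
qed (transfer; simp add: algebra_simps sch_sq_idealD(1))+

end

lemma abs_sch_sq_eq_0_iff: "abs_sch_sq x = 0 \<longleftrightarrow> x \<in> sch_sq_ideal"
  by (simp add: zero_sch_sq_def sch_sq.abs_eq_iff)

interpretation sch_sq: sch_rep_pair "\<lambda>x. abs_sch_sq (x \<otimes> 1)" "\<lambda>y. abs_sch_sq (1 \<otimes> y)"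
  "abs_sch_sq (scal (const2 (1 / 2) * par_a))" abs_sch_sq
proof
  show "abs_sch_sq (half_a \<otimes> 1) = abs_sch_sq (scal (const2 (1 / 2) * par_a))"
    "abs_sch_sq (1 \<otimes> half_a) = abs_sch_sq (scal (const2 (1 / 2) * par_a))"
    by (simp_all only: half_a_eq_scal ser_hom_scal[OF ser_hom_tens_one] ser_hom_scal[OF ser_hom_one_tens])
  show "abs_sch_sq (x \<otimes> 1) = 0" "abs_sch_sq (1 \<otimes> x) = 0" if "x \<in> sch_ideal" for x
    using that by (simp_all add: abs_sch_sq_eq_0_iff tens_idealI)
qed (simp_all add: tens_left tens_right tens_mult one_sch_sq_def plus_sch_sq.abs_eq
    times_sch_sq.abs_eq)

lemma coprod_sch_ideal: "x \<in> sch_ideal \<Longrightarrow> coprod x \<in> sch_sq_ideal"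
proof -
  have "sch_ideal \<subseteq> coprod -` sch_sq_ideal"
  proof (rule presented_ideal_subset[OF closed_ideal_hom_vimage[OF ser_hom_coprod closed_tens_ideal]])
    fix x y assume "(x, y) \<in> sch_relations"
    then have "abs_sch_sq (coprod (x - y)) = 0"
      by (simp add: coprod_linearD sch_sq.\<Phi>_diff sch_sq.coprod_rep)
    then show "x - y \<in> coprod -` sch_sq_ideal"
      by (simp add: abs_sch_sq_eq_0_iff)
  qed
  then show "coprod x \<in> sch_sq_ideal" if "x \<in> sch_ideal"
    using that by blast
qed

text \<open>The left leg of the tensor square serves as the representation, and the counit on the
  right leg brings the result back, so a single quotient type handles coproduct and
  antipode.\<close>

lemma antipode_sch_ideal: "x \<in> sch_ideal \<Longrightarrow> antipode x \<in> sch_ideal"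
proof -
  have "sch_ideal \<subseteq> antipode -` sch_ideal"
  proof (rule presented_ideal_subset[OF closed_ideal_vimage[OF ser_linear_antipode closed_presented_ideal]])
    fix x y assume "(x, y) \<in> sch_relations"
    then have "abs_sch_sq (antipode (x - y) \<otimes> 1) = 0"
      by (simp add: antipode_linearD sch_sq.L.diff sch_sq.L.antipode_rep)
    then have "counit_right (antipode (x - y) \<otimes> (1 :: sgen list ser)) \<in> sch_ideal"
      by (simp only: abs_sch_sq_eq_0_iff counit_right_sch_sq_ideal)
    then show "x - y \<in> antipode -` sch_ideal"
      by (simp add: counit_right_tens)
  qed (simp add: antipode_mult sch_idealD)
  then show "antipode x \<in> sch_ideal" if "x \<in> sch_ideal"
    using that by blast
qed

lemma top_hopf_algebra_sch: "top_hopf_algebra sch_ideal coprod counit antipode"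
  unfolding top_hopf_algebra_def
proof (intro conjI ballI allI)
  fix x
  show "assoc (tens_map coprod id (coprod x)) - tens_map id coprod (coprod x)
      \<in> tens_ideal sch_ideal (tens_ideal sch_ideal sch_ideal)"
    by (simp add: coprod_coassoc closed_idealD(1)[OF closed_tens_ideal])
  show "lin_ext (\<lambda>(m, n). counit (basis m) \<odot> basis n) (coprod x) - x \<in> sch_ideal"
    using counit_coprod(1)[of x] by (simp add: counit_left_def sch_idealD(1))
  show "lin_ext (\<lambda>(m, n). counit (basis n) \<odot> basis m) (coprod x) - x \<in> sch_ideal"
    using counit_coprod(2)[of x] by (simp add: counit_right_def sch_idealD(1))
  show "mult_map (tens_map antipode id (coprod x)) - counit x \<odot> 1 \<in> sch_ideal"
    using antipode_coprod(1)[of x] by (simp add: antipode_left_def smult_def sch_idealD(1))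
  show "mult_map (tens_map id antipode (coprod x)) - counit x \<odot> 1 \<in> sch_ideal"
    using antipode_coprod(2)[of x] by (simp add: antipode_right_def smult_def sch_idealD(1))
qed (simp_all add: closed_presented_ideal ser_hom_coprod coprod_sch_ideal ser_character_counit
    counit_sch_ideal ser_linear_antipode antipode_sch_ideal)

section \<open>The classical limit\<close>

abbreviation env_ideal :: "(sgen list \<Rightarrow>\<^sub>0 real) set" where "env_ideal \<equiv> enveloping_ideal sch_bracket"

definition env_ser :: "sgen list ser set"
  where "env_ser = {x. \<forall>i j. x $ i $ j \<in> env_ideal}"

lemma two_sided_env_ideal: "two_sided_ideal env_ideal"
  unfolding enveloping_ideal_def by (rule two_sided_ideal_hull)

text \<open>Membership is tested coefficient by coefficient, and each coefficient is already
  determined by an approximation of sufficiently high order.\<close>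

lemma closed_env_ser: "closed_ideal env_ser"
  unfolding closed_ideal_def
proof (intro conjI allI impI)
  show "two_sided_ideal env_ser"
    unfolding two_sided_ideal_def env_ser_def
    by (auto simp: fps2_mult_nth intro!: two_sided_ideal_sum[OF two_sided_env_ideal]
        intro: two_sided_idealD(1-4)[OF two_sided_env_ideal])
  fix x assume approx: "\<forall>k. \<exists>y\<in>env_ser. x - y \<in> adic k"
  have "x $ i $ j \<in> env_ideal" for i j
  proof -
    obtain y where y: "y \<in> env_ser" "x - y \<in> adic (Suc (i + j))"
      using approx by blast
    then have "x $ i $ j = y $ i $ j"
      using adicD[OF y(2), of i j] by simp
    then show ?thesis
      using y(1) by (simp add: env_ser_def)
  qed
  then show "x \<in> env_ser"
    by (simp add: env_ser_def)
qed

lemmas env_serD = closed_idealD[OF closed_env_ser]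

text \<open>The series algebra over the enveloping algebra has no torsion under a and c. A relation
  involving a quotient or logarithm may therefore be checked after multiplication by a
  parameter.\<close>

lemma par_a_env_ser: "par_a * x \<in> env_ser \<Longrightarrow> x \<in> env_ser"
  and par_c_env_ser: "par_c * x \<in> env_ser \<Longrightarrow> x \<in> env_ser"
proof -
  show "x \<in> env_ser" if "par_a * x \<in> env_ser"
  proof -
    have "(par_a * x) $ Suc i $ j \<in> env_ideal" for i j
      using that unfolding env_ser_def by blast
    then show ?thesis
      by (simp add: env_ser_def)
  qed
  show "x \<in> env_ser" if "par_c * x \<in> env_ser"
  proof -
    have "(par_c * x) $ i $ Suc j \<in> env_ideal" for i j
      using that unfolding env_ser_def by blast
    then show ?thesis
      by (simp add: env_ser_def)
  qed
qed

section \<open>The undeformed relations\<close>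

lemma emb_single: "emb (Poly_Mapping.single g t) = Poly_Mapping.single [g] t"
proof -
  have "emb (Poly_Mapping.single g t) = (\<Sum>h\<in>UNIV. if h = g then Poly_Mapping.single [g] t else 0)"
    unfolding emb_def by (intro sum.cong) (auto simp: lookup_single when_def)
  then show ?thesis
    by simp
qed

lemma emb_0: "emb 0 = 0"
  by (simp add: emb_def)

lemma emb_uminus: "emb (- v) = - emb v"
  by (simp add: emb_def single_uminus sum_negf)

lemma const2_single: "const2 (Poly_Mapping.single [g] t) = rsc t * gen g"
  by (simp add: gen_def basis_def scal_const2 mult_single)

lemma env_ser_rel: "gen X * gen Y - gen Y * gen X - const2 (emb (sch_bracket X Y)) \<in> env_ser"
proof -
  let ?c = "comm (Poly_Mapping.single [X] 1) (Poly_Mapping.single [Y] 1) - emb (sch_bracket X Y)"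
  have "?c \<in> env_ideal"
    unfolding enveloping_ideal_def by (rule hull_inc) blast
  then have "const2 ?c \<in> env_ser"
    by (simp add: env_ser_def two_sided_idealD(1)[OF two_sided_env_ideal])
  also have "const2 ?c = gen X * gen Y - gen Y * gen X - const2 (emb (sch_bracket X Y))"
    by (simp add: comm_def gen_def basis_def)
  finally show ?thesis .
qed

lemma env_ser_rels:
  "D\<^sub>q * P\<^sub>q - P\<^sub>q * D\<^sub>q + P\<^sub>q \<in> env_ser"
  "D\<^sub>q * K\<^sub>q - K\<^sub>q * D\<^sub>q - K\<^sub>q \<in> env_ser"
  "K\<^sub>q * P\<^sub>q - P\<^sub>q * K\<^sub>q - M\<^sub>q \<in> env_ser"
  "H\<^sub>q * D\<^sub>q - (D\<^sub>q * H\<^sub>q + (H\<^sub>q + H\<^sub>q)) \<in> env_ser"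
  "D\<^sub>q * C\<^sub>q - C\<^sub>q * D\<^sub>q - (C\<^sub>q + C\<^sub>q) \<in> env_ser"
  "H\<^sub>q * C\<^sub>q - (C\<^sub>q * H\<^sub>q + D\<^sub>q) \<in> env_ser"
  "H\<^sub>q * K\<^sub>q - K\<^sub>q * H\<^sub>q + P\<^sub>q \<in> env_ser"
  "K\<^sub>q * C\<^sub>q - C\<^sub>q * K\<^sub>q \<in> env_ser"
  "P\<^sub>q * C\<^sub>q - C\<^sub>q * P\<^sub>q + K\<^sub>q \<in> env_ser"
  "H\<^sub>q * P\<^sub>q - P\<^sub>q * H\<^sub>q \<in> env_ser"
  "M\<^sub>q * gen X - gen X * M\<^sub>q \<in> env_ser"
proof -
  have "sch_bracket Mg X = 0"
    by (cases X) simp_all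
  then show "M\<^sub>q * gen X - gen X * M\<^sub>q \<in> env_ser"
    using env_ser_rel[of Mg X] by (simp add: emb_0)
qed (use env_ser_rel[of Dg Pg] env_ser_rel[of Dg Kg] env_ser_rel[of Kg Pg] env_ser_rel[of Hg Dg]
    env_ser_rel[of Dg Cg] env_ser_rel[of Hg Cg] env_ser_rel[of Hg Kg] env_ser_rel[of Kg Cg]
    env_ser_rel[of Pg Cg] env_ser_rel[of Hg Pg]
    rsc_uminus[of 1, where 'a = "sgen list"] rsc_numeral[of "num.Bit0 num.One", where 'a = "sgen list"]
    in \<open>simp_all only: sch_bracket.simps emb_single emb_0 const2_single rsc_1 mult_2 mult_minus_left mult_1_left
      diff_minus_eq_add diff_diff_eq fps_const_0_eq_0 diff_zero add_0_right add_uminus_conv_diff\<close>)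

text \<open>The series \<open>ln (1 + c X) / c\<close>.\<close>

definition ln_series :: "real \<Rightarrow> real fps"
  where "ln_series c = Abs_fps (\<lambda>n. if n = 0 then 0 else (- c) ^ (n - 1) / real n)"

lemma ln_series_0 [simp]: "ln_series c $ 0 = 0"
  by (simp add: ln_series_def)

lemma ln_series_deriv: "(1 + fps_const c * fps_X) * fps_deriv (ln_series c) = 1"
proof (rule fps_ext)
  fix n
  have "fps_deriv (ln_series c) = Abs_fps (\<lambda>n. (- c) ^ n)"
    by (rule fps_ext) (simp add: ln_series_def del: of_nat_Suc)
  then show "((1 + fps_const c * fps_X) * fps_deriv (ln_series c)) $ n = 1 $ n"
    by (cases n) (simp_all add: distrib_right mult.assoc)
qed

text \<open>Let E be the composite and L the logarithm. From L' = 1 / (1 + c X) follows L'' = -c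
  (L')^2, while E' = c L' E; so E L' has derivative 0 and constant term 1. The second identity
  inverts the first.\<close>

lemma exp_ln_series: "fps_exp c oo ln_series c = 1 + fps_const c * fps_X"
  and exp_uminus_ln_series: "fps_exp (- c) oo ln_series c = fps_deriv (ln_series c)"
proof -
  let ?U = "1 + fps_const c * fps_X" and ?G' = "fps_deriv (ln_series c)"
  let ?E = "fps_exp c oo ln_series c"
  have "fps_deriv (?U * ?G') = 0"
    unfolding ln_series_deriv by simp
  then have "(fps_const c * ?G' + ?U * fps_deriv ?G') * ?G' = 0"
    by (simp add: add.commute)
  then have G'': "fps_const c * ?G' * ?G' + fps_deriv ?G' * (?U * ?G') = 0"
    by (simp add: algebra_simps)
  have "fps_deriv (?E * ?G') = ?E * (fps_const c * ?G' * ?G' + fps_deriv ?G')"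
    by (simp add: fps_compose_deriv algebra_simps fps_const_mult_apply_left)
  also have "\<dots> = 0"
    using G'' unfolding ln_series_deriv by simp
  finally have "?E * ?G' = fps_const ((?E * ?G') $ 0)"
    by (rule iffD1[OF fps_deriv_eq_0_iff])
  also have "(?E * ?G') $ 0 = 1"
    by (simp add: ln_series_def)
  finally have "?E * ?G' = 1"
    by simp
  then have "?E = ?E * (?U * ?G')"
    by (simp add: ln_series_deriv)
  then show E: "?E = ?U"
    using \<open>?E * ?G' = 1\<close> by (simp only: mult.left_commute[of ?E] mult_1_right)
  have "(fps_exp (- c) oo ln_series c) * ?E = (fps_exp (- c) * fps_exp c) oo ln_series c"
    by (simp add: fps_compose_mult_distrib)
  also have "\<dots> = 1"
    by (simp flip: fps_exp_add_mult)
  finally have "(fps_exp (- c) oo ln_series c) * ?U = 1"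
    unfolding E .
  then have "(fps_exp (- c) oo ln_series c) * (?U * ?G') = ?G'"
    by (simp flip: mult.assoc)
  then show "fps_exp (- c) oo ln_series c = ?G'"
    by (simp add: ln_series_deriv)
qed


text \<open>These are \<open>ln (1 + 2 a H) / (2 a)\<close> and \<open>- ln (1 - 2 c M) / (2 c)\<close>.\<close>

definition H_cl :: "sgen list ser"
  where "H_cl = H\<^sub>q * ev (par_a * H\<^sub>q) (fps_shift 1 (ln_series 2))"

definition M_cl :: "sgen list ser"
  where "M_cl = M\<^sub>q * ev (par_c * M\<^sub>q) (fps_shift 1 (ln_series (- 2)))"

fun classical_gen :: "sgen \<Rightarrow> sgen list ser" where
  "classical_gen Hg = H_cl"
| "classical_gen Mg = M_cl"
| "classical_gen Cg = C\<^sub>q + half_a * (D\<^sub>q * D\<^sub>q)"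
| "classical_gen X = gen X"

definition classical :: "sgen list ser \<Rightarrow> sgen list ser"
  where "classical = free_hom classical_gen"

lemma ser_hom_classical: "ser_hom classical"
  unfolding classical_def by (rule ser_hom_free_hom)

lemma classical_gen_eq [simp]: "classical (gen X) = classical_gen X"
  by (simp add: classical_def)

lemmas classical_linearD = ser_hom_linearD[OF ser_hom_classical]
lemmas classical_homD = ser_homD[OF ser_hom_classical]
lemmas classical_par = ser_hom_par[OF ser_hom_classical]

lemma par_a_H_cl: "par_a * H_cl = ev (par_a * H\<^sub>q) (ln_series 2)"
  by (subst ev_unfold[OF aH_adic]) (simp add: H_cl_def mult.assoc)

lemma par_c_M_cl: "par_c * M_cl = ev (par_c * M\<^sub>q) (ln_series (- 2))"
  by (subst ev_unfold[OF cM_adic]) (simp add: M_cl_def mult.assoc)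

text \<open>The value is 1 / (1 + 2 a H). It is kept as the derivative of the logarithm because that
  is what commutators with the logarithm produce.\<close>

lemma classical_expH: "classical (expH (- 2)) = ev (par_a * H\<^sub>q) (fps_deriv (ln_series 2))"
proof -
  have "classical (expH (- 2)) = ev (ev (par_a * H\<^sub>q) (ln_series 2)) (fps_exp (- 2))"
    unfolding pexp_def ser_hom_ev[OF ser_hom_classical aH_adic] classical_par(1) classical_gen_eq
      classical_gen.simps par_a_H_cl ..
  then show ?thesis
    by (simp only: ev_compose[OF aH_adic ln_series_0] exp_uminus_ln_series)
qed

lemma classical_expM: "classical (expM (- 2)) = 1 - 2 * par_c * M\<^sub>q"
proof -
  have "classical (expM (- 2)) = ev (ev (par_c * M\<^sub>q) (ln_series (- 2))) (fps_exp (- 2))"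
    unfolding pexp_def ser_hom_ev[OF ser_hom_classical cM_adic] classical_par(2) classical_gen_eq
      classical_gen.simps par_c_M_cl ..
  also have "\<dots> = ev (par_c * M\<^sub>q) (1 + fps_const (- 2) * fps_X)"
    by (simp only: ev_compose[OF cM_adic ln_series_0] exp_ln_series)
  also have "\<dots> = 1 + rsc (- 2) * (par_c * M\<^sub>q)"
    by (simp only: ev_add[OF cM_adic] ev_mult[OF cM_adic] ev_1[OF cM_adic] ev_X[OF cM_adic] ev_const[OF cM_adic])
  also have "rsc (- 2) = (- 2 :: sgen list ser)"
    by (simp only: rsc_uminus rsc_numeral)
  finally show ?thesis
    by (simp add: mult.assoc)
qed

lemma classical_expM_quot: "classical expM_quot = M\<^sub>q"
proof (rule two_par_c_mult_cancel)
  have "2 * par_c * classical expM_quot = classical (2 * par_c * expM_quot)"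
    unfolding mult_2 distrib_right classical_linearD(1) classical_par(2) ..
  then show "2 * par_c * classical expM_quot = 2 * par_c * M\<^sub>q"
    unfolding par_c_mult_expM_quot by (simp add: classical_linearD classical_homD classical_expM)
qed

lemma par_a_classical_expH_quot:
  "par_a * classical expH_quot = ev (par_a * H\<^sub>q) (fps_deriv (ln_series 2)) - 1"
  unfolding classical_par(1)[symmetric] par_a_mult_expH_quot
  by (simp add: classical_linearD classical_homD classical_expH)

text \<open>In the undeformed algebra ad x, for x = a H, sends D to 2 x, K to -a P, and C to a D and
  then to 2 a x; the last 2 cancels the 1/2 of the Taylor expansion.\<close>

lemma env_ser_ev_commutation:
  "ev (par_a * H\<^sub>q) F * D\<^sub>q - (D\<^sub>q * ev (par_a * H\<^sub>q) F
    + (par_a * H\<^sub>q + par_a * H\<^sub>q) * ev (par_a * H\<^sub>q) (fps_deriv F)) \<in> env_ser" (is ?D)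
  "ev (par_a * H\<^sub>q) F * C\<^sub>q - (C\<^sub>q * ev (par_a * H\<^sub>q) F
    + par_a * (D\<^sub>q * ev (par_a * H\<^sub>q) (fps_deriv F) + par_a * H\<^sub>q * ev (par_a * H\<^sub>q) (fps_deriv (fps_deriv F)))) \<in> env_ser" (is ?C)
  "ev (par_a * H\<^sub>q) F * P\<^sub>q - P\<^sub>q * ev (par_a * H\<^sub>q) F \<in> env_ser" (is ?P)
  "ev (par_a * H\<^sub>q) F * K\<^sub>q - (K\<^sub>q * ev (par_a * H\<^sub>q) F
    - par_a * P\<^sub>q * ev (par_a * H\<^sub>q) (fps_deriv F)) \<in> env_ser" (is ?K)
proof -
  let ?x = "par_a * H\<^sub>q"
  note ev_comm = ev_commutation[OF closed_env_ser aH_adic]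
  have a: "u * (par_a * v) = par_a * (u * v)" for u v :: "sgen list ser"
    using scal_left_commute[of u par_a v] by simp
  have scale: "par_a * u \<in> env_ser" if "u \<in> env_ser" for u
    using that by (rule env_serD(3))
  have zero: "?x * 0 - (0 * ?x + 0) \<in> env_ser" "?x * 0 - 0 * ?x \<in> env_ser"
    by (simp_all add: env_serD(1))
  have xx: "?x * (?x + ?x) - ((?x + ?x) * ?x + 0) \<in> env_ser"
    "?x * (par_a * (?x + ?x)) - par_a * (?x + ?x) * ?x \<in> env_ser"
    by (simp_all add: env_serD(1) algebra_simps a[of "H\<^sub>q"])
  have HD: "?x * D\<^sub>q - (D\<^sub>q * ?x + (?x + ?x)) \<in> env_ser"
    using scale[OF env_ser_rels(4)] by (simp add: algebra_simps a[of "D\<^sub>q"])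
  have HC: "?x * C\<^sub>q - (C\<^sub>q * ?x + par_a * D\<^sub>q) \<in> env_ser"
    using scale[OF env_ser_rels(6)] by (simp add: algebra_simps a[of "C\<^sub>q"])
  have HD': "?x * (par_a * D\<^sub>q) - (par_a * D\<^sub>q * ?x + par_a * (?x + ?x)) \<in> env_ser"
    using scale[OF HD] by (simp add: algebra_simps a[of "H\<^sub>q"])
  have HP: "?x * P\<^sub>q - (P\<^sub>q * ?x + 0) \<in> env_ser"
    using scale[OF env_ser_rels(10)] by (simp add: algebra_simps a[of "P\<^sub>q"])
  have HP': "?x * - (par_a * P\<^sub>q) - (- (par_a * P\<^sub>q) * ?x + 0) \<in> env_ser"
    using env_serD(5)[OF scale[OF HP]] by (simp add: algebra_simps a[of "H\<^sub>q"])
  have HK: "?x * K\<^sub>q - (K\<^sub>q * ?x + - (par_a * P\<^sub>q)) \<in> env_ser"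
    using scale[OF env_ser_rels(7)] by (simp add: algebra_simps a[of "K\<^sub>q"])
  show ?D
    using ev_comm[OF HD xx(1) zero(2), of F] by simp
  show ?P
    using ev_comm[OF HP zero, of F] by simp
  show ?K
    using ev_comm[OF HK HP' zero(2), of F] by simp
  have "rsc (1 / 2) * (par_a * (?x + ?x)) = par_a * ?x"
  proof -
    have "rsc (1 / 2) * (par_a * (?x + ?x)) = half_a * (?x + ?x)"
      by (simp only: half_a_def mult.assoc)
    also have "\<dots> = (half_a + half_a) * ?x"
      by (simp only: distrib_left distrib_right)
    finally show ?thesis
      by (simp only: flip: par_a_eq_half_a)
  qed
  then show ?C
    using ev_comm[OF HC HD' xx(2), of F] by (simp add: distrib_left mult.assoc add.assoc)
qed

lemma M_cl_central: "M_cl * x - x * M_cl \<in> env_ser"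
proof (rule par_c_env_ser)
  have "M\<^sub>q * y - y * M\<^sub>q \<in> env_ser" for y
    by (rule central_if_gen_central[OF closed_env_ser env_ser_rels(11)])
  then have "ev (par_c * M\<^sub>q) F * x - x * ev (par_c * M\<^sub>q) F \<in> env_ser" for F
    by (intro ev_central[OF closed_env_ser cM_adic]) (simp only: par_mult_commutator env_serD(3))
  then show "par_c * (M_cl * x - x * M_cl) \<in> env_ser"
    unfolding par_mult_commutator[symmetric] par_c_M_cl .
qed

text \<open>Relations containing H are multiplied by a first: then the new H enters through the
  series v in x = a H, to which the commutation rules apply.\<close>

lemma classical_rel:
  assumes "(x, y) \<in> sch_relations"
  shows "classical x - classical y \<in> env_ser"
proof -
  \<comment> \<open>Thus v = ln (1 + 2 x) / 2, p = 1 / (1 + 2 x), and s is the derivative of p. The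
    logarithm enters through (1 + 2 x) p = 1 and the derivative of this identity.\<close>
  define G where "G = ln_series 2"
  define x v p s where "x = par_a * H\<^sub>q" and "v = ev x G" and "p = ev x (fps_deriv G)"
    and "s = ev x (fps_deriv (fps_deriv G))"
  note defs = G_def x_def v_def p_def s_def
  have x: "x \<in> adic 1"
    unfolding x_def by (rule aH_adic)
  note ev = ev_add[OF x] ev_mult[OF x] ev_X[OF x] ev_1[OF x]
  have "fps_const 2 * fps_X = fps_X + (fps_X :: real fps)"
    by (simp only: one_add_one[symmetric] fps_const_add[symmetric] fps_const_1_eq_1 distrib_right mult_1_left)
  then have G': "fps_deriv G + (fps_X + fps_X) * fps_deriv G = 1"
    using ln_series_deriv[of 2] by (simp only: G_def distrib_right mult_1_left)
  have "fps_deriv (fps_deriv G + (fps_X + fps_X) * fps_deriv G) = 0"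
    unfolding G' by simp
  then have "fps_deriv (fps_deriv G) + (fps_deriv G + fps_deriv G) + (fps_X + fps_X) * fps_deriv (fps_deriv G) = 0"
    by (simp add: algebra_simps)
  from arg_cong[OF this, of "ev x"] arg_cong[OF G', of "ev x"]
  have p: "p + (x + x) * p = 1" and s: "s + (p + p) + (x + x) * s = 0"
    by (simp_all only: ev ev_0 p_def s_def)
  have half: "half_a * u + half_a * u = par_a * u" for u
    by (simp only: par_a_eq_half_a distrib_right)
  have half_comm: "u * (half_a * w) = half_a * (u * w)" for u w
    unfolding mult.assoc[symmetric] half_a_commute[of u] ..
  have classical_half: "classical half_a = half_a" "classical par_a = par_a"
    using classical_par(1)[of 1] ser_hom_scal[OF ser_hom_classical]
    by (simp_all add: half_a_eq_scal classical_homD)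
  note comms = env_ser_ev_commutation[of G, folded x_def, folded v_def p_def s_def]
  note commp = env_ser_ev_commutation[of "fps_deriv G", folded x_def, folded p_def s_def]
  have aH: "par_a * H_cl = v"
    by (simp add: par_a_H_cl v_def x_def G_def)
  have Eg: "classical Eg = p"
    by (simp add: Eg_def classical_expH p_def x_def G_def)
  note simps = comm_def classical_linearD classical_homD classical_half
  show ?thesis
    using assms
  proof (rule sch_relations_induct)
    show "classical (comm D\<^sub>q P\<^sub>q) - classical (- P\<^sub>q) \<in> env_ser"
      "classical (comm D\<^sub>q K\<^sub>q) - classical K\<^sub>q \<in> env_ser"
      "classical (comm K\<^sub>q P\<^sub>q) - classical expM_quot \<in> env_ser"
      using env_ser_rels(1-3) by (simp_all add: simps classical_expM_quot)
    show "classical (comm M\<^sub>q (gen X)) - classical 0 \<in> env_ser" for X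
      by (simp add: simps M_cl_central)
    show "classical (comm P\<^sub>q H\<^sub>q) - classical 0 \<in> env_ser"
    proof (rule par_a_env_ser)
      have "par_a * (classical (comm P\<^sub>q H\<^sub>q) - classical 0) = - (v * P\<^sub>q - P\<^sub>q * v)"
        using par_mult_commutator(1)[of H_cl "P\<^sub>q"] unfolding aH by (simp add: simps algebra_simps)
      then show "par_a * (classical (comm P\<^sub>q H\<^sub>q) - classical 0) \<in> env_ser"
        using env_serD(5)[OF comms(3)] by simp
    qed
    show "classical (comm D\<^sub>q H\<^sub>q) - classical expH_quot \<in> env_ser"
    proof (rule par_a_env_ser)
      have "par_a * (classical (comm D\<^sub>q H\<^sub>q) - classical expH_quot)
          = - (v * D\<^sub>q - D\<^sub>q * v) - (p - 1)"
        using par_mult_commutator(1)[of H_cl "D\<^sub>q"] par_a_classical_expH_quot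
        unfolding aH by (simp add: simps algebra_simps defs)
      also have "\<dots> = - (v * D\<^sub>q - (D\<^sub>q * v + (x + x) * p))"
        using p by (simp add: algebra_simps)
      finally show "par_a * (classical (comm D\<^sub>q H\<^sub>q) - classical expH_quot) \<in> env_ser"
        using env_serD(5)[OF comms(1)] by simp
    qed
    show "classical (comm K\<^sub>q H\<^sub>q) - classical (Eg * P\<^sub>q) \<in> env_ser"
    proof (rule par_a_env_ser)
      have "par_a * (classical (comm K\<^sub>q H\<^sub>q) - classical (Eg * P\<^sub>q))
          = - (v * K\<^sub>q - K\<^sub>q * v) - par_a * (p * P\<^sub>q)"
        using par_mult_commutator(1)[of H_cl "K\<^sub>q"]
        unfolding aH by (simp add: simps Eg algebra_simps)
      also have "\<dots> = - (v * K\<^sub>q - (K\<^sub>q * v - par_a * P\<^sub>q * p)) - par_a * (p * P\<^sub>q - P\<^sub>q * p)"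
        by (simp add: algebra_simps)
      finally show "par_a * (classical (comm K\<^sub>q H\<^sub>q) - classical (Eg * P\<^sub>q)) \<in> env_ser"
        using env_serD(6)[OF env_serD(5)[OF comms(4)] env_serD(3)[OF commp(3)]] by simp
    qed
    show "classical (comm D\<^sub>q C\<^sub>q) - classical (C\<^sub>q + C\<^sub>q - par_a * (D\<^sub>q * D\<^sub>q)) \<in> env_ser"
      using env_ser_rels(5) half[of "D\<^sub>q * D\<^sub>q"] half_comm[of "D\<^sub>q" "D\<^sub>q * D\<^sub>q"]
      by (simp add: simps algebra_simps)
    let ?r = "D\<^sub>q * K\<^sub>q - K\<^sub>q * D\<^sub>q - K\<^sub>q"
    have "classical (comm K\<^sub>q C\<^sub>q) - classical (- (half_a * (K\<^sub>q * D\<^sub>q + D\<^sub>q * K\<^sub>q)))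
        = (K\<^sub>q * C\<^sub>q - C\<^sub>q * K\<^sub>q) - half_a * (?r * D\<^sub>q + D\<^sub>q * ?r)"
      using half_comm[of "K\<^sub>q" "D\<^sub>q * D\<^sub>q"] by (simp add: simps algebra_simps)
    then show "classical (comm K\<^sub>q C\<^sub>q) - classical (- (half_a * (K\<^sub>q * D\<^sub>q + D\<^sub>q * K\<^sub>q))) \<in> env_ser"
      using env_serD(6)[OF env_ser_rels(8) env_serD(3)[OF env_serD(2)[OF env_serD(4)[OF env_ser_rels(2)]
              env_serD(3)[OF env_ser_rels(2)]]]] by simp
    let ?r = "D\<^sub>q * P\<^sub>q - P\<^sub>q * D\<^sub>q + P\<^sub>q"
    have "classical (comm P\<^sub>q C\<^sub>q) - classical (- K\<^sub>q + half_a * (D\<^sub>q * P\<^sub>q + P\<^sub>q * D\<^sub>q))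
        = (P\<^sub>q * C\<^sub>q - C\<^sub>q * P\<^sub>q + K\<^sub>q) - half_a * (?r * D\<^sub>q + D\<^sub>q * ?r)"
      using half_comm[of "P\<^sub>q" "D\<^sub>q * D\<^sub>q"] by (simp add: simps algebra_simps)
    then show "classical (comm P\<^sub>q C\<^sub>q) - classical (- K\<^sub>q + half_a * (D\<^sub>q * P\<^sub>q + P\<^sub>q * D\<^sub>q)) \<in> env_ser"
      using env_serD(6)[OF env_ser_rels(9) env_serD(3)[OF env_serD(2)[OF env_serD(4)[OF env_ser_rels(1)]
              env_serD(3)[OF env_ser_rels(1)]]]] by simp
    show "classical (comm H\<^sub>q C\<^sub>q) - classical D\<^sub>q \<in> env_ser"
    proof (rule par_a_env_ser)
      \<comment> \<open>For a series u in x with derivative w, this is the defect of its commutation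
        with D. Applying it to v twice gives the commutator of v with D^2, but leaves 2 x p to the
        left of D; moving it across needs the same rule for x p, whose derivative is p + x
        s.\<close>
      let ?e = "\<lambda>u w. u * D\<^sub>q - (D\<^sub>q * u + (x + x) * w)"
      have xp: "ev x (fps_X * fps_deriv G) = x * p" "ev x (fps_deriv (fps_X * fps_deriv G)) = p + x * s"
        by (simp_all add: ev p_def s_def add.commute)
      have e1: "?e (x * p) (p + x * s) \<in> env_ser"
        using env_ser_ev_commutation(1)[of "fps_X * fps_deriv G", folded x_def] unfolding xp .
      have e: "?e v p \<in> env_ser"
        using comms(1) .
      have xp2: "x * p + x * p = 1 - p"
        using p by (simp add: algebra_simps)
      have xs2: "(x + x) * (p + x * s) + (x + x) * (p + x * s) = - (x * s) - (x * s)"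
      proof -
        have "(x + x) * (p + x * s) = x * (s + (p + p) + (x + x) * s) - x * s"
          by (simp add: algebra_simps)
        then show ?thesis
          unfolding s by (simp add: algebra_simps)
      qed
      have "?e v p * D\<^sub>q + D\<^sub>q * ?e v p + (?e (x * p) (p + x * s) + ?e (x * p) (p + x * s))
          = v * (D\<^sub>q * D\<^sub>q) - D\<^sub>q * D\<^sub>q * v - (D\<^sub>q * (x * p + x * p) + D\<^sub>q * (x * p + x * p))
            - ((x + x) * (p + x * s) + (x + x) * (p + x * s))"
        by (simp add: algebra_simps)
      also have "\<dots> = v * (D\<^sub>q * D\<^sub>q) - D\<^sub>q * D\<^sub>q * v
          - (D\<^sub>q - D\<^sub>q * p - x * s) - (D\<^sub>q - D\<^sub>q * p - x * s)"
        unfolding xp2 xs2 by (simp add: algebra_simps)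
      finally have DD_eq: "?e v p * D\<^sub>q + D\<^sub>q * ?e v p + (?e (x * p) (p + x * s) + ?e (x * p) (p + x * s))
          = v * (D\<^sub>q * D\<^sub>q) - D\<^sub>q * D\<^sub>q * v - (D\<^sub>q - D\<^sub>q * p - x * s) - (D\<^sub>q - D\<^sub>q * p - x * s)"
        (is "_ = ?DD") .
      have DD: "?DD \<in> env_ser"
        unfolding DD_eq[symmetric]
        by (rule env_serD(2)[OF env_serD(2)[OF env_serD(4)[OF e] env_serD(3)[OF e]] env_serD(2)[OF e1 e1]])
      have "par_a * (classical (comm H\<^sub>q C\<^sub>q) - classical D\<^sub>q)
          = v * (C\<^sub>q + half_a * (D\<^sub>q * D\<^sub>q)) - (C\<^sub>q + half_a * (D\<^sub>q * D\<^sub>q)) * v - par_a * D\<^sub>q"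
        using par_mult_commutator(1)[of H_cl "C\<^sub>q + half_a * (D\<^sub>q * D\<^sub>q)"]
        unfolding aH by (simp add: simps right_diff_distrib)
      \<comment> \<open>The terms a D p and a x s from the commutator of v with C cancel those from
        (a / 2) D^2; only a D survives.\<close>
      also have "\<dots> = (v * C\<^sub>q - (C\<^sub>q * v + par_a * (D\<^sub>q * p + x * s))) + half_a * ?DD"
        using half[of "D\<^sub>q"] half[of "D\<^sub>q * p"] half[of "x * s"] half_comm[of v "D\<^sub>q * D\<^sub>q"]
        by (simp add: algebra_simps)
      finally show "par_a * (classical (comm H\<^sub>q C\<^sub>q) - classical D\<^sub>q) \<in> env_ser"
        using env_serD(2)[OF comms(2) env_serD(3)[OF DD]] by simp
    qed
  qed
qed

section \<open>Topological freeness\<close>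

lemma closed_ideal_adic: "closed_ideal (adic k :: ('m::monoid_add) ser set)"
  unfolding closed_ideal_def
proof (intro conjI allI impI)
  show "two_sided_ideal (adic k :: 'm ser set)"
    by (auto simp: two_sided_ideal_def intro: adic_add adic_mult_left adic_mult_right)
  fix x :: "'m ser" assume "\<forall>l. \<exists>y\<in>adic k. x - y \<in> adic l"
  then obtain y where "y \<in> adic k" "x - y \<in> adic k"
    by blast
  then show "x \<in> adic k"
    using adic_add[of y k "x - y"] by simp
qed

text \<open>Sharpens \<open>ser_linear_adic\<close>: a gain of one order on basis elements is a gain
  of one order everywhere. The base case uses that \<open>adic 1\<close> is a closed ideal.\<close>

lemma ser_linear_adic_Suc:
  assumes F: "ser_linear F" and basis: "\<And>m. F (basis m) \<in> adic 1"
  shows "x \<in> adic k \<Longrightarrow> F x \<in> adic (Suc k)"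
proof (induction k arbitrary: x)
  case 0
  then show ?case
    using ser_linear_in_closed_ideal[OF F closed_ideal_adic basis] by simp
next
  case (Suc k)
  have *: "fps_shift 1 x \<in> adic k" "fps_const (fps_shift 1 (x $ 0)) \<in> adic k" "x $ 0 $ 0 = 0"
    using Suc.prems by (auto simp: adic_def)
  have "F x = par_a * F (fps_shift 1 x) + par_c * F (fps_const (fps_shift 1 (x $ 0)))"
    using arg_cong[OF fps2_decompose[of x], of F] \<open>x $ 0 $ 0 = 0\<close>
    by (simp add: ser_linearD ser_linear_par F del: fps_const_mult)
  then show ?case
    using * by (simp add: adic_add mult_par_a_adic mult_par_c_adic Suc.IH)
qed

lemma ev_adic_const: "x \<in> adic 1 \<Longrightarrow> ev x F - rsc (F $ 0) \<in> adic 1"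
  by (subst ev_unfold) (auto intro: adic_mult_right)

lemma half_a_adic: "half_a \<in> adic 1"
  unfolding half_a_def by (rule adic_mult_left[OF par_a_adic])

lemma classical_gen_adic: "classical_gen X - gen X \<in> adic 1"
proof -
  have coeff: "fps_shift 1 (ln_series c) $ 0 = 1" for c
    by (simp add: ln_series_def)
  have "H_cl - H\<^sub>q = H\<^sub>q * (ev (par_a * H\<^sub>q) (fps_shift 1 (ln_series 2)) - rsc 1)"
    "M_cl - M\<^sub>q = M\<^sub>q * (ev (par_c * M\<^sub>q) (fps_shift 1 (ln_series (- 2))) - rsc 1)"
    by (simp_all add: H_cl_def M_cl_def right_diff_distrib)
  then have "H_cl - H\<^sub>q \<in> adic 1" "M_cl - M\<^sub>q \<in> adic 1"
    using ev_adic_const[OF aH_adic, of "fps_shift 1 (ln_series 2)"]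
      ev_adic_const[OF cM_adic, of "fps_shift 1 (ln_series (- 2))"]
    by (simp_all only: coeff adic_mult_left)
  moreover have "half_a * (D\<^sub>q * D\<^sub>q) \<in> adic 1"
    by (rule adic_mult_right[OF half_a_adic])
  ultimately show ?thesis
    by (cases X) (simp_all del: One_nat_def)
qed

text \<open>The difference from the identity is linear, and on words it telescopes into differences
  on single letters, each of positive order.\<close>

lemma classical_adic: "x \<in> adic k \<Longrightarrow> classical x - x \<in> adic (Suc k)"
proof (rule ser_linear_adic_Suc[OF ser_linear_diff[OF classical_homD(1) ser_linear_id(1)]])
  fix w
  show "classical (basis w) - basis w \<in> adic 1"
  proof (induction w)
    case (Cons X w)
    have "classical (basis (X # w)) - basis (X # w)
        = (classical_gen X - gen X) * classical (basis w) + gen X * (classical (basis w) - basis w)"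
      by (simp add: classical_homD algebra_simps flip: gen_mult_basis)
    then show ?case
      using adic_add[OF adic_mult_right[OF classical_gen_adic] adic_mult_left[OF Cons.IH]] by simp
  qed (simp add: classical_homD)
qed

lemma classical_sch_ideal: "x \<in> sch_ideal \<Longrightarrow> classical x \<in> env_ser"
proof -
  have "sch_ideal \<subseteq> classical -` env_ser"
  proof (rule presented_ideal_subset[OF closed_ideal_hom_vimage[OF ser_hom_classical closed_env_ser]])
    fix x y assume "(x, y) \<in> sch_relations"
    from classical_rel[OF this] show "x - y \<in> classical -` env_ser"
      by (simp add: classical_linearD)
  qed
  then show "classical x \<in> env_ser" if "x \<in> sch_ideal"
    using that by blast
qed

text \<open>This is the flatness of the deformation.\<close>

lemma leading_coeff_env_ideal:
  assumes x: "x \<in> adic k" and y: "y \<in> sch_ideal" and diff: "x - y \<in> adic (Suc k)" and ij: "i + j = k"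
  shows "x $ i $ j \<in> env_ideal"
proof -
  have "y \<in> adic k"
    using adic_diff[OF x adic_mono[OF diff]] by simp
  then have "classical y - y \<in> adic (Suc k)"
    by (rule classical_adic)
  then have "x $ i $ j = classical y $ i $ j"
    using adicD[of "classical y - y" "Suc k" i j] adicD[OF diff, of i j] ij by simp
  then show ?thesis
    using classical_sch_ideal[OF y] by (simp add: env_ser_def)
qed

text \<open>One inclusion is the case k = 0 of \<open>leading_coeff_env_ideal\<close>. For the
  other, the constant coefficients form a two-sided ideal, as constants lift to series, and the
  deformed relations specialise to the undeformed ones.\<close>

lemma sch_ideal_coeff: "{x $ 0 $ 0 | x. x \<in> sch_ideal} = env_ideal"
proof
  show "{x $ 0 $ 0 | x. x \<in> sch_ideal} \<subseteq> env_ideal"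
    using leading_coeff_env_ideal[of _ 0 _ 0 0] by auto
  let ?Z = "{x $ 0 $ 0 | x. x \<in> sch_ideal}"
  have Z: "x $ 0 $ 0 \<in> ?Z" if "x \<in> sch_ideal" for x
    using that by blast
  have ideal: "two_sided_ideal ?Z"
    unfolding two_sided_ideal_def
  proof (intro conjI ballI allI)
    show "0 \<in> ?Z"
      using Z[OF sch_idealD(1)] by simp
    fix u assume "u \<in> ?Z"
    then obtain x where x: "u = x $ 0 $ 0" "x \<in> sch_ideal"
      by blast
    fix v
    show "v * u \<in> ?Z" "u * v \<in> ?Z"
      using Z[OF sch_idealD(3)[OF x(2), of "const2 v"]] Z[OF sch_idealD(4)[OF x(2), of "const2 v"]] x(1)
      by simp_all
    assume "v \<in> ?Z"
    then obtain y where y: "v = y $ 0 $ 0" "y \<in> sch_ideal"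
      by blast
    show "u + v \<in> ?Z"
      using Z[OF sch_idealD(2)[OF x(2) y(2)]] x(1) y(1) by simp
  qed
  note idealD = two_sided_idealD[OF ideal]
  define g where "g X Y = comm (Poly_Mapping.single [X] 1) (Poly_Mapping.single [Y] 1)
    - emb (sch_bracket X Y)" for X Y :: sgen
  \<comment> \<open>The presentation lists each bracket in one orientation only.\<close>
  have g_sym: "g Y X \<in> ?Z" if "g X Y \<in> ?Z" for X Y
  proof -
    have "g Y X = - g X Y"
      unfolding g_def sch_bracket_antisym[of Y X] by (simp add: comm_def emb_uminus)
    then show ?thesis
      using idealD(5)[OF that] by simp
  qed
  have g_refl: "g X X \<in> ?Z" for X
    using idealD(1) by (cases X) (simp_all add: g_def comm_def emb_0)
  have ev_0: "ev x F $ 0 $ 0 = Poly_Mapping.single 0 (F $ 0)" for x :: "sgen list ser" and F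
    by (simp add: ev_def)
  have quot_0: "expH_quot $ 0 $ 0 = Poly_Mapping.single [Hg] (- 2)" "expM_quot $ 0 $ 0 = Poly_Mapping.single [Mg] 1"
    by (simp_all add: expH_quot_def expM_quot_def ev_0 gen_def basis_def mult_single)
  have exp_0: "expH t $ 0 $ 0 = 1" for t
    by (simp add: pexp_def ev_0)
  have gen_0: "gen X $ 0 $ 0 = Poly_Mapping.single [X] 1" for X :: sgen
    by (simp add: gen_def basis_def)
  have half_0: "half_a $ 0 $ 0 = 0"
    using adicD[OF half_a_adic, of 0 0] by simp
  note simps = g_def comm_def emb_single emb_0 quot_0 exp_0 gen_0 half_0 single_uminus emb_uminus
  have rels: "g Dg Pg \<in> ?Z" "g Dg Kg \<in> ?Z" "g Kg Pg \<in> ?Z" "g Dg Hg \<in> ?Z" "g Dg Cg \<in> ?Z" "g Hg Cg \<in> ?Z"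
    "g Kg Hg \<in> ?Z" "g Kg Cg \<in> ?Z" "g Pg Cg \<in> ?Z" "g Pg Hg \<in> ?Z" "g Mg X \<in> ?Z" for X
  proof -
    have two: "Poly_Mapping.single [Cg] 2 = 2 * Poly_Mapping.single [Cg] (1 :: real)"
      by (simp add: mult_2 flip: single_add)
    have "sch_bracket Mg X = 0"
      by (cases X) simp_all
    then show "g Mg X \<in> ?Z"
      using Z[OF sch_ideal_rel(11)[of X]] by (simp add: simps)
    show "g Dg Cg \<in> ?Z"
      using Z[OF sch_ideal_rel(5)] by (simp add: simps two numeral_fps_const)
    show "g Dg Pg \<in> ?Z" "g Dg Kg \<in> ?Z" "g Kg Pg \<in> ?Z" "g Dg Hg \<in> ?Z" "g Hg Cg \<in> ?Z"
      "g Kg Hg \<in> ?Z" "g Kg Cg \<in> ?Z" "g Pg Cg \<in> ?Z" "g Pg Hg \<in> ?Z"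
      using Z[OF sch_ideal_rel(1)] Z[OF sch_ideal_rel(2)] Z[OF sch_ideal_rel(3)] Z[OF sch_ideal_rel(4)]
        Z[OF sch_ideal_rel(6)] Z[OF sch_ideal_rel(7)] Z[OF sch_ideal_rel(8)]
        Z[OF sch_ideal_rel(9)] Z[OF sch_ideal_rel(10)]
      by (simp_all add: simps)
  qed
  have "g X Y \<in> ?Z" for X Y
    by (cases X; cases Y) (use rels g_sym g_refl in blast)+
  then show "env_ideal \<subseteq> ?Z"
    unfolding enveloping_ideal_def by (intro hull_minimal ideal) (auto simp: g_def)
qed

text \<open>The complement is the kernel of a linear projection onto J, obtained by extending the
  identity of J to the whole space.\<close>

lemma two_sided_ideal_complement:
  fixes J :: "('m::monoid_add \<Rightarrow>\<^sub>0 real) set"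
  assumes J: "two_sided_ideal J"
  obtains V where "0 \<in> V" "\<And>u v. u \<in> V \<Longrightarrow> v \<in> V \<Longrightarrow> u + v \<in> V"
    "\<And>t v. v \<in> V \<Longrightarrow> Poly_Mapping.single 0 t * v \<in> V" "V \<inter> J = {0}"
    "\<And>x. \<exists>v\<in>V. x - v \<in> J"
proof -
  let ?scale = "\<lambda>t v. Poly_Mapping.single 0 t * v :: 'm \<Rightarrow>\<^sub>0 real"
  interpret V: vector_space ?scale
    by unfold_locales (simp_all add: distrib_left distrib_right single_add mult_single flip: mult.assoc)
  interpret VV: vector_space_pair ?scale ?scale ..
  have "V.subspace J"
    by (rule V.subspaceI) (use J in \<open>auto intro: two_sided_idealD\<close>)
  then obtain g where g: "range g \<subseteq> J" "Vector_Spaces.linear ?scale ?scale g" "\<forall>v\<in>J. g v = v"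
    using VV.linear_exists_left_inverse_on[OF V.linear_ident, of J] by auto
  interpret g: Vector_Spaces.linear ?scale ?scale g
    by (rule g(2))
  show thesis
  proof (rule that[of "{v. g v = 0}"])
    show "{v. g v = 0} \<inter> J = {0}"
      using g(3) two_sided_idealD(1)[OF J] g.zero by auto
    fix x
    have "g (x - g x) = 0"
      using g(1,3) g.diff[of x "g x"] by (metis diff_self rangeI subsetD)
    moreover have "x - (x - g x) \<in> J"
      using g(1) by auto
    ultimately show "\<exists>v\<in>{v. g v = 0}. x - v \<in> J"
      by blast
  qed (simp_all add: g.zero g.add g.scale)
qed

text \<open>V is a linear complement of the ideal of the enveloping algebra, so no explicit basis is
  involved. Flatness gives uniqueness; existence is successive approximation followed by a
  limit.\<close>

lemma top_free_sch_ideal: "top_free sch_ideal"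
proof -
  obtain V :: "(sgen list \<Rightarrow>\<^sub>0 real) set" where V_0: "0 \<in> V"
    and V_add: "\<And>u v. u \<in> V \<Longrightarrow> v \<in> V \<Longrightarrow> u + v \<in> V"
    and V_scale: "\<And>t v. v \<in> V \<Longrightarrow> Poly_Mapping.single 0 t * v \<in> V" and V_J: "V \<inter> env_ideal = {0}"
    and V_ex: "\<And>x. \<exists>v\<in>V. x - v \<in> env_ideal"
    using two_sided_ideal_complement[OF two_sided_env_ideal] by metis
  have V_diff: "u - v \<in> V" if "u \<in> V" "v \<in> V" for u v
    using V_add[OF that(1) V_scale[OF that(2), of "- 1"]] by (simp add: single_uminus)
  define VS :: "sgen list ser set" where "VS = {v. \<forall>i j. v $ i $ j \<in> V}"
  have VS_diff: "u - v \<in> VS" if "u \<in> VS" "v \<in> VS" for u v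
    using that V_diff by (simp add: VS_def)
  \<comment> \<open>As long as v has order l < k, its coefficients of degree l are leading
    coefficients of an ideal element, so they lie in V and in the enveloping ideal and
    vanish.\<close>
  have small: "v \<in> adic k" if v: "v \<in> VS" and y: "y \<in> sch_ideal" "v - y \<in> adic k" for v y k
  proof -
    have "v \<in> adic l" if "l \<le> k" for l
      using that
    proof (induction l)
      case (Suc l)
      then have l: "v \<in> adic l"
        by simp
      have "v $ i $ j = 0" if "i + j = l" for i j
      proof -
        have "v $ i $ j \<in> env_ideal"
          using leading_coeff_env_ideal[OF l y(1) adic_mono[OF y(2) Suc.prems] that] .
        then show ?thesis
          using v V_J by (auto simp: VS_def)
      qed
      then show ?case
        using l by (auto simp: adic_def less_Suc_eq)
    qed simp
    then show ?thesis
      by simp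
  qed
  \<comment> \<open>The constant coefficient is split along V and the ideal; what remains is a r + c
    s, and the induction hypothesis applies to r and s.\<close>
  have approx: "\<exists>v\<in>VS. \<exists>y\<in>sch_ideal. x - v - y \<in> adic k" for x k
  proof (induction k arbitrary: x)
    case 0
    have "0 \<in> VS"
      by (simp add: VS_def V_0)
    then show ?case
      using sch_idealD(1) by auto
  next
    case (Suc k)
    obtain p where p: "p \<in> V" "x $ 0 $ 0 - p \<in> env_ideal"
      using V_ex by blast
    then obtain y0 where y0: "y0 \<in> sch_ideal" "y0 $ 0 $ 0 = x $ 0 $ 0 - p"
      unfolding sch_ideal_coeff[symmetric] by auto
    have "(x - const2 p - y0) $ 0 $ 0 = 0"
      using y0(2) by simp
    then obtain r s where rs: "x - const2 p - y0 = par_a * r + par_c * s"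
      by (rule adic_1_decompose)
    obtain v y where vy: "v \<in> VS" "y \<in> sch_ideal" "r - v - y \<in> adic k"
      using Suc.IH by blast
    obtain v' y' where vy': "v' \<in> VS" "y' \<in> sch_ideal" "s - v' - y' \<in> adic k"
      using Suc.IH by blast
    define w where "w = const2 p + par_a * v + par_c * v'"
    have "w $ i $ j \<in> V" for i j
      using vy(1) vy'(1) p(1) V_0 V_add unfolding w_def VS_def
      by (cases i; cases j) (auto simp del: fps_const_mult)
    then have "w \<in> VS"
      by (simp add: VS_def)
    moreover have "y0 + par_a * y + par_c * y' \<in> sch_ideal"
      by (intro sch_idealD(2) sch_idealD(3)[OF vy(2)] sch_idealD(3)[OF vy'(2)] y0(1))
    moreover have "x - w - (y0 + par_a * y + par_c * y') = par_a * (r - v - y) + par_c * (s - v' - y')"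
      using rs by (simp add: w_def algebra_simps)
    then have "x - w - (y0 + par_a * y + par_c * y') \<in> adic (Suc k)"
      using vy(3) vy'(3) by (simp add: adic_add mult_par_a_adic mult_par_c_adic)
    ultimately show ?case
      by blast
  qed
  have "\<exists>!v. v \<in> VS \<and> x - v \<in> sch_ideal" for x
  proof (rule ex_ex1I)
    obtain v y where v: "\<And>k. v k \<in> VS" and y: "\<And>k. y k \<in> sch_ideal" and vy: "\<And>k. x - v k - y k \<in> adic k"
      using approx[of x] by metis
    \<comment> \<open>Two approximations differ by an ideal element up to order k, so
      \<open>small\<close> makes the sequence Cauchy.\<close>
    have close: "v k - v l \<in> adic k" if "k \<le> l" for k l
    proof (rule small[OF VS_diff[OF v v], of "y l - y k"])
      have "(x - v l - y l) - (x - v k - y k) \<in> adic k"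
        using adic_diff[OF adic_mono[OF vy that] vy] .
      then show "v k - v l - (y l - y k) \<in> adic k"
        by (simp add: algebra_simps)
    qed (rule sch_idealD(6)[OF y y])
    \<comment> \<open>The coefficients of total degree i + j are stable from the index i + j + 1
      on.\<close>
    define u where "u = Abs_fps (\<lambda>i. Abs_fps (\<lambda>j. v (Suc (i + j)) $ i $ j))"
    have "u \<in> VS"
      using v by (simp add: u_def VS_def)
    moreover have u: "u - v k \<in> adic k" for k
      unfolding adic_def
    proof (intro CollectI allI impI)
      fix i j assume "i + j < k"
      then show "(u - v k) $ i $ j = 0"
        using adicD[OF close[of "Suc (i + j)" k], of i j] by (simp add: u_def)
    qed
    have "x - u \<in> sch_ideal"
    proof (rule closed_ideal_closed[OF closed_presented_ideal])
      fix k
      have "x - u - y k = (x - v k - y k) - (u - v k)"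
        by simp
      then have "x - u - y k \<in> adic k"
        using adic_diff[OF vy[of k] u[of k]] by (simp only:)
      then show "\<exists>z\<in>sch_ideal. x - u - z \<in> adic k"
        using y by blast
    qed
    ultimately show "\<exists>v. v \<in> VS \<and> x - v \<in> sch_ideal"
      by blast
  next
    fix v v' assume v: "v \<in> VS \<and> x - v \<in> sch_ideal" and v': "v' \<in> VS \<and> x - v' \<in> sch_ideal"
    show "v = v'"
    proof (rule eq_if_adic)
      fix k
      \<comment> \<open>The difference itself is the ideal element in \<open>small\<close>, so it is
        small to every order.\<close>
      show "v - v' \<in> adic k"
        using v v' sch_idealD(6)[of "x - v'" "x - v"]
        by (intro small[OF VS_diff, of v v' "v - v'"]) auto
    qed
  qed
  then show ?thesis
    unfolding top_free_def VS_def using V_0 V_add V_scale by (intro exI[of _ V]) auto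
qed


section \<open>The semiclassical limit\<close>

lemma pexp_adic_1: "x \<in> adic 1 \<Longrightarrow> pexp x t - 1 \<in> adic 1"
  using ev_adic_const[of x "fps_exp t"] by (simp add: pexp_def)

lemma pexp_adic_2:
  assumes x: "x \<in> adic 1"
  shows "pexp x t - (1 + rsc t * x) \<in> adic 2"
proof -
  let ?F = "fps_shift 1 (fps_exp t)"
  have "pexp x t - (1 + rsc t * x) = x * (ev x ?F - rsc t)"
    unfolding pexp_def by (subst ev_unfold[OF x]) (simp add: right_diff_distrib scal_commute)
  moreover have "ev x ?F - rsc t \<in> adic 1"
    using ev_adic_const[OF x, of ?F] by simp
  ultimately show ?thesis
    using adic_mult[OF x, of _ 1] by (simp add: numeral_2_eq_2)
qed

lemma tens_adic: "x \<in> adic k \<Longrightarrow> x \<otimes> y \<in> adic k" "y \<in> adic k \<Longrightarrow> x \<otimes> y \<in> adic k"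
  using ser_linear_adic[OF ser_linear_tens_left] ser_linear_adic[OF ser_linear_tens_right] by blast+

lemma exp_adic:
  "expH t - 1 \<in> adic 1" "expH s * expM t - 1 \<in> adic 1"
  "expH t - (1 + rsc t * (par_a * H\<^sub>q)) \<in> adic 2"
  "expH s * expM t - (1 + rsc s * (par_a * H\<^sub>q) + rsc t * (par_c * M\<^sub>q)) \<in> adic 2"
proof -
  let ?h = "rsc s * (par_a * H\<^sub>q)" and ?m = "rsc t * (par_c * M\<^sub>q)"
  show "expH t - 1 \<in> adic 1" for t
    by (rule pexp_adic_1[OF aH_adic])
  have "expH s * expM t - 1 = (expH s - 1) * expM t + (expM t - 1)"
    by (simp add: algebra_simps)
  then show "expH s * expM t - 1 \<in> adic 1"
    using pexp_adic_1[OF aH_adic, of s] pexp_adic_1[OF cM_adic, of t]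
    by (simp only: adic_add adic_mult_right)
  show 2: "expH t - (1 + rsc t * (par_a * H\<^sub>q)) \<in> adic 2" for t
    by (rule pexp_adic_2[OF aH_adic])
  have "?h * ?m \<in> adic (1 + 1)"
    by (intro adic_mult adic_mult_left aH_adic cM_adic)
  moreover have "expH s * expM t - (1 + ?h + ?m)
      = (expH s - (1 + ?h)) * expM t + (1 + ?h) * (expM t - (1 + ?m)) + ?h * ?m"
    by (simp add: algebra_simps)
  ultimately show "expH s * expM t - (1 + ?h + ?m) \<in> adic 2"
    using 2[of s] pexp_adic_2[OF cM_adic, of t]
    by (simp only: one_add_one adic_add adic_mult_left adic_mult_right)
qed

lemma coprod_limit: "coprod_gen X - (1 \<otimes> gen X + gen X \<otimes> 1) \<in> adic 1"
proof -
  have diff: "x \<otimes> y - x \<otimes> 1 \<in> adic 1" if "y - 1 \<in> adic 1" for x y :: "sgen list ser"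
    using tens_adic(2)[OF that, of x] by (simp only: tens_right(5))
  have "(par_a * D\<^sub>q) \<otimes> (expH (- 2) * P\<^sub>q) \<in> adic 1"
    by (intro tens_adic(1) adic_mult_right par_a_adic)
  then have "coprod_gen Kg - (1 \<otimes> gen Kg + gen Kg \<otimes> 1) \<in> adic 1"
    using adic_add[OF diff[OF exp_adic(2), of "K\<^sub>q" "- 1" "- 1"]] by (simp add: algebra_simps del: One_nat_def)
  then show ?thesis
    using diff[OF exp_adic(1)] diff[OF exp_adic(2)] by (cases X) (simp_all del: One_nat_def coprod_gen.simps(6))
qed

lemma smult_uminus_left: "(- s) \<odot> x = - (s \<odot> x)"
  by (simp add: smult_def scal_uminus)

text \<open>This holds before dividing by the ideal, because \<open>cocommutator\<close> uses the
  brackets of the Lie algebra and not commutators of generators.\<close>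

lemma coprod_semiclassical:
  "coprod_gen X - flip (coprod_gen X) - cocommutator sch_bracket sch_r X \<in> adic 2"
proof -
  \<comment> \<open>Two expansions of exp (-2 a H) are kept: the one to first order suffices in the
    term of K that already carries a factor a.\<close>
  obtain u where u: "u \<in> adic 1" and eu: "expH (- 2) = 1 + u"
    using exp_adic(1)[of "- 2"] by (metis add_diff_cancel_left' diff_add_cancel add.commute)
  obtain e where e: "e \<in> adic 2" and ee: "expH (- 2) = 1 + rsc (- 2) * (par_a * H\<^sub>q) + e"
    using exp_adic(3)[of "- 2"] by (metis add.commute diff_add_cancel)
  obtain g where g: "g \<in> adic 2"
    and eg: "expH 1 * expM (- 1) = 1 + rsc 1 * (par_a * H\<^sub>q) + rsc (- 1) * (par_c * M\<^sub>q) + g"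
    using exp_adic(4)[of 1 "- 1"] by (metis add.commute diff_add_cancel)
  obtain f where f: "f \<in> adic 2"
    and ef: "expH (- 1) * expM (- 1) = 1 + rsc (- 1) * (par_a * H\<^sub>q) + rsc (- 1) * (par_c * M\<^sub>q) + f"
    using exp_adic(4)[of "- 1" "- 1"] by (metis add.commute diff_add_cancel)
  have rsc: "rsc (- 1) = - 1" "rsc (- 2) = - 2" "rsc 1 = 1" "rsc 2 = 2"
    by (simp_all only: rsc_uminus rsc_numeral rsc_1)
  have minus_c: "fps_const (- fps_X) \<odot> x = - (par_c * x)" for x :: "(sgen list \<times> sgen list) ser"
    using smult_uminus_left[of par_c x] by (simp add: smult_par_c)
  note simps = minus_c tens_left tens_right tens_par ser_linearD[OF ser_linear_flip] ser_linear_par[OF ser_linear_flip]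
    flip_tens cocommutator_def UNIV_sgen emb_single emb_0 const2_single smult_par_a smult_par_c
    smult_uminus_left rsc distrib_left right_diff_distrib mult_2
  show ?thesis
  proof (cases X)
    case Dg
    have "coprod_gen Dg - flip (coprod_gen Dg) - cocommutator sch_bracket sch_r Dg = D\<^sub>q \<otimes> e - e \<otimes> D\<^sub>q"
      by (simp add: ee simps)
    then show ?thesis
      unfolding Dg by (simp only: adic_diff tens_adic e)
  next
    case Cg
    have "coprod_gen Cg - flip (coprod_gen Cg) - cocommutator sch_bracket sch_r Cg = C\<^sub>q \<otimes> e - e \<otimes> C\<^sub>q"
      by (simp add: ee simps)
    then show ?thesis
      unfolding Cg by (simp only: adic_diff tens_adic e)
  next
    case Pg
    have "coprod_gen Pg - flip (coprod_gen Pg) - cocommutator sch_bracket sch_r Pg = P\<^sub>q \<otimes> g - g \<otimes> P\<^sub>q"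
      by (simp add: eg simps)
    then show ?thesis
      unfolding Pg by (simp only: adic_diff tens_adic g)
  next
    case Kg
    have "coprod_gen Kg - flip (coprod_gen Kg) - cocommutator sch_bracket sch_r Kg
        = K\<^sub>q \<otimes> f - f \<otimes> K\<^sub>q + par_a * (D\<^sub>q \<otimes> (u * P\<^sub>q) - (u * P\<^sub>q) \<otimes> D\<^sub>q)"
      by (simp add: ef eu simps distrib_right)
    moreover have "par_a * (D\<^sub>q \<otimes> (u * P\<^sub>q) - (u * P\<^sub>q) \<otimes> D\<^sub>q) \<in> adic (1 + 1)"
      by (intro adic_mult[OF par_a_adic] adic_diff tens_adic adic_mult_right u)
    ultimately show ?thesis
      unfolding Kg by (simp only: adic_add adic_diff tens_adic f one_add_one)
  qed (simp_all add: simps)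
qed

theorem mainTheorem10:
  shows "\<exists>\<Delta> E S.
      top_hopf_algebra (presented_ideal sch_relations) \<Delta> E S
    \<and> \<Delta> H\<^sub>q = 1 \<otimes> H\<^sub>q + H\<^sub>q \<otimes> 1
    \<and> \<Delta> M\<^sub>q = 1 \<otimes> M\<^sub>q + M\<^sub>q \<otimes> 1
    \<and> \<Delta> D\<^sub>q = 1 \<otimes> D\<^sub>q + D\<^sub>q \<otimes> sexp (- 2 * par_a * H\<^sub>q)
    \<and> \<Delta> C\<^sub>q = 1 \<otimes> C\<^sub>q + C\<^sub>q \<otimes> sexp (- 2 * par_a * H\<^sub>q)
    \<and> \<Delta> P\<^sub>q = 1 \<otimes> P\<^sub>q + P\<^sub>q \<otimes> (sexp (par_a * H\<^sub>q) * sexp (- par_c * M\<^sub>q))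
    \<and> \<Delta> K\<^sub>q = 1 \<otimes> K\<^sub>q + K\<^sub>q \<otimes> (sexp (- par_a * H\<^sub>q) * sexp (- par_c * M\<^sub>q))
        + (par_a * D\<^sub>q) \<otimes> (sexp (- 2 * par_a * H\<^sub>q) * P\<^sub>q)
    \<and> quantum_deformation sch_bracket sch_r (presented_ideal sch_relations) \<Delta>"
proof (intro exI[of _ coprod] exI[of _ counit] exI[of _ antipode] conjI)
  \<comment> \<open>Both congruences hold for the representatives themselves, so 0 is taken as the
    correcting ideal element.\<close>
  have "eq_upto sch_sq_ideal k x y" if "x - y \<in> adic k" for k x y
    unfolding eq_upto_def using that sch_sq_idealD(1) by (intro bexI[of _ 0]) simp_all
  then show "quantum_deformation sch_bracket sch_r sch_ideal coprod"
    unfolding quantum_deformation_def coprod_gen_eq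
    using top_free_sch_ideal sch_ideal_coeff coprod_limit coprod_semiclassical by blast
qed (simp_all only: top_hopf_algebra_sch coprod_gen_eq coprod_gen.simps sexp_eq_exps)

end
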